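(* Let $k$ be a field and let $\mathcal{A}$ be a $k$-linear abelian category with enough injectives. Let $c\in HH^2_{\mathrm{ex}}(\mathcal{A})$ and let $\mathcal{A}_c$ be the corresponding first order abelian deformation of $\mathcal{A}$. Then for every $M\in D^b(\mathcal{A})$, the element $\chi_{\mathcal{A}}(c)_M\in\operatorname{Ext}^2_{\mathcal{A}}(M,M)$ is the obstruction against deforming $M$ to an object of $D^b(\mathcal{A}_c)$.
   Context: Hochschild complex. Graded means $\mathbb{Z}$-graded, with the Koszul sign rule; $[M,N]^p=\prod_i\operatorname{Hom}_k(M^i,N^{i+p})$; $(\Sigma M)^i=M^{i+1}$, and $\sigma m\in\Sigma M$ is the element of degree $|m|-1$ corresponding to $m$. A quiver $\mathfrak{a}$ consists of a set of objects and graded $k$-modules $\mathfrak{a}(A,A')$. Put $\mathbf{C}_{br}(\mathfrak{a})=\prod_{n\ge 0}\prod_{A_0,\dots,A_n}[\Sigma\mathfrak{a}(A_{n-1},A_n)\otimes\cdots\otimes\Sigma\mathfrak{a}(A_0,A_1),\Sigma\mathfrak{a}(A_0,A_n)]$ (for $n=0$: $\prod_A\Sigma\mathfrak{a}(A,A)$) with braces $\phi\{\phi_1,\dots,\phi_r\}=\sum\phi(1\otimes\cdots\otimes\phi_1\otimes 1\otimes\cdots\otimes\phi_r\otimes 1\otimes\cdots\otimes 1)$ (sum over all order-preserving insertions) and bracket $\langle x,y\rangle=x\{y\}-(-1)^{|x||y|}y\{x\}$. A dg structure is an element $b\in\mathbf{C}_{br}^1(\mathfrak{a})$ with $b\{b\}=0$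 whose only nonzero components have arity $1$ and $2$. The Hochschild complex is $\mathbf{C}(\mathfrak{a})=\Sigma^{-1}\mathbf{C}_{br}(\mathfrak{a})$ with differential induced by $\langle b,-\rangle$, and $HH^n(\mathfrak{a})=H^n\mathbf{C}(\mathfrak{a})$. An element $\phi\in\mathbf{C}^{i,n}(\mathfrak{a})=\prod[\mathfrak{a}(A_{n-1},A_n)\otimes\cdots\otimes\mathfrak{a}(A_0,A_1),\mathfrak{a}(A_0,A_n)]^i$ has Hochschild degree $i+n$ and corresponds to the element of $\mathbf{C}_{br}(\mathfrak{a})$ sending $(\sigma f_n,\dots,\sigma f_1)$ to $(-1)^{ni+(n-1)|f_n|+\cdots+|f_2|}\sigma\phi(f_n,\dots,f_1)$. Characteristic morphism. Let $\operatorname{Inj}(\mathcal{A})$ be the $k$-linear category of injectives of $\mathcal{A}$. Let $D^b_{\mathrm{dg}}(\mathcal{A})$ be the dg category of bounded below complexes of injectives of $\mathcal{A}$ with bounded cohomology (with composition $(fg)_i=f_{i+|g|}g_i$ and differential $d(f)=\delta f-(-1)^{|f|}f\delta$); it is a dg model of $D^b(\mathcal{A})$. Put $HH^*_{\mathrm{ex}}(\mathcal{A})=HH^*(D^b_{\mathrm{dg}}(\mathcal{A}))$. Projection on the arity zero part of the Hochschild complex is a morphism of complexes $\mathbf{C}(D^b_{\mathrm{dg}}(\mathcal{A}))\to\prod_{M}D^b_{\mathrm{dg}}(\mathcal{A})(M,M)$ (differentials being identified up to the canonical shift signs), and in cohomology it gives the characteristic morphism $\chi_{\mathcal{A}}:HH^*_{\mathrm{ex}}(\mathcal{A})\to\mathfrak{Z}^*(D^b(\mathcal{A}))$,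 $c\mapsto(\chi_{\mathcal{A}}(c)_M)_M$ with $\chi_{\mathcal{A}}(c)_M\in\operatorname{Ext}^*_{\mathcal{A}}(M,M)$. Here $\mathfrak{Z}^*$ denotes the graded centre. Deformations. A first order abelian deformation of $\mathcal{A}$ is a flat abelian $k[\epsilon]$-linear category $\mathcal{B}$ ($\epsilon^2=0$) with an equivalence $\mathcal{A}\cong\operatorname{Hom}_{k[\epsilon]}(k,\mathcal{B})$, the full subcategory of objects $B$ of $\mathcal{B}$ on which $\epsilon$ acts as zero; flatness is in the sense of Lowen and Van den Bergh. For a linear category $\mathfrak{a}$ with composition $m$ and a Hochschild 2-cocycle $\phi$, $\mathfrak{a}_\phi[\epsilon]$ denotes the $k[\epsilon]$-linear category with the objects of $\mathfrak{a}$, morphism modules $k[\epsilon]\otimes_k\mathfrak{a}(A,A')$ and composition $m+\phi\epsilon$. The inclusion $\operatorname{Inj}(\mathcal{A})\subset D^b_{\mathrm{dg}}(\mathcal{A})$ (as complexes concentrated in degree $0$) induces an isomorphism $HH^2_{\mathrm{ex}}(\mathcal{A})\cong HH^2(\operatorname{Inj}(\mathcal{A}))$ (restriction of cochains). If $\phi$ is a cocycle representing the image of $c$, the deformation $\mathcal{A}_c$ is the abelian deformation, unique up to equivalence, for which $\operatorname{Inj}(\mathcal{A}_c)$ is the linear deformation $\operatorname{Inj}(\mathcal{A})_\phi[\epsilon]$ of $\operatorname{Inj}(\mathcal{A})$, where reduction modulo $\epsilon$ corresponds to $E\mapsto\operatorname{Hom}_{k[\epsilon]}(k,E)$. Obstruction.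 A deformation of $M\in D^b(\mathcal{A})$ to $D^b(\mathcal{A}_c)$ is an object $\bar M\in D^b(\mathcal{A}_c)$ with an isomorphism $\mathbf{R}\operatorname{Hom}_{k[\epsilon]}(k,\bar M)\cong M$; in terms of injectives, this is a lift along $k\otimes_{k[\epsilon]}-:K^+(\operatorname{Inj}(\mathcal{A})_\phi[\epsilon])\to K^+(\operatorname{Inj}(\mathcal{A}))$. The obstruction against such a deformation is the one of Lowen's obstruction theory for deforming objects of derived categories: if $M$ is represented by a bounded below complex $(I,\delta)$ of injectives, it is the class $[\phi(\delta,\delta)]\in\operatorname{Ext}^2_{\mathcal{A}}(M,M)$, where $\phi$ is applied componentwise. It depends on $c$, and $M$ admits a deformation if and only if it vanishes. *)

theory Defs
  imports Complex_Main "HOL-Library.Function_Algebras" "HOL-Library.Product_Plus"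
begin

section \<open>Dual numbers\<close>

text \<open>The ring \<open>k[\<epsilon>]\<close> with \<open>\<epsilon>\<^sup>2 = 0\<close>; \<open>Dual a b\<close> is \<open>a + b\<epsilon>\<close>.\<close>

datatype 'k dualnum = Dual (dre: 'k) (deps: 'k)

instantiation dualnum :: (comm_ring_1) comm_ring_1
begin
definition "0 = Dual 0 0"
definition "1 = Dual 1 0"
definition "x + y = Dual (dre x + dre y) (deps x + deps y)"
definition "- x = Dual (- dre x) (- deps x)"
definition "x - y = Dual (dre x - dre y) (deps x - deps y)"
definition "x * y = Dual (dre x * dre y) (dre x * deps y + deps x * dre y)"
instance
  by standard
    (auto simp: zero_dualnum_def one_dualnum_def plus_dualnum_def uminus_dualnum_def
      minus_dualnum_def times_dualnum_def algebra_simps dualnum.expand)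
end

definition eps :: "'k::comm_ring_1 dualnum" where
  "eps = Dual 0 1"


section \<open>Linear and abelian categories\<close>

text \<open>All morphism modules are submodules of one ambient module; this is no restriction, since any
  family of modules embeds in its direct sum. Morphism sets need not be disjoint, so composition is
  indexed by objects: \<open>Cmp C X Y Z g f\<close> is \<open>g \<circ> f\<close> for \<open>f : X \<rightarrow> Y\<close> and \<open>g : Y \<rightarrow> Z\<close>.\<close>

record ('r, 'o, 'm) lincat =
  Obj :: "'o set"
  Hom :: "'o \<Rightarrow> 'o \<Rightarrow> 'm set"
  Scale :: "'r \<Rightarrow> 'm \<Rightarrow> 'm"
  Cmp :: "'o \<Rightarrow> 'o \<Rightarrow> 'o \<Rightarrow> 'm \<Rightarrow> 'm \<Rightarrow> 'm"
  Idn :: "'o \<Rightarrow> 'm"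

locale linear_category = module "Scale C"
  for C :: "('r::comm_ring_1, 'o, 'm::ab_group_add) lincat" +
  assumes subspace_Hom: "\<lbrakk>X \<in> Obj C; Y \<in> Obj C\<rbrakk> \<Longrightarrow> subspace (Hom C X Y)"
    and Cmp_in: "\<lbrakk>X \<in> Obj C; Y \<in> Obj C; Z \<in> Obj C; f \<in> Hom C X Y; g \<in> Hom C Y Z\<rbrakk>
      \<Longrightarrow> Cmp C X Y Z g f \<in> Hom C X Z"
    and Cmp_linear_right:
      "\<lbrakk>X \<in> Obj C; Y \<in> Obj C; Z \<in> Obj C; f \<in> Hom C X Y; f' \<in> Hom C X Y; g \<in> Hom C Y Z\<rbrakk>
      \<Longrightarrow> Cmp C X Y Z g (Scale C a f + f') = Scale C a (Cmp C X Y Z g f) + Cmp C X Y Z g f'"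
    and Cmp_linear_left:
      "\<lbrakk>X \<in> Obj C; Y \<in> Obj C; Z \<in> Obj C; f \<in> Hom C X Y; g \<in> Hom C Y Z; g' \<in> Hom C Y Z\<rbrakk>
      \<Longrightarrow> Cmp C X Y Z (Scale C a g + g') f = Scale C a (Cmp C X Y Z g f) + Cmp C X Y Z g' f"
    and Cmp_assoc:
      "\<lbrakk>W \<in> Obj C; X \<in> Obj C; Y \<in> Obj C; Z \<in> Obj C;
        f \<in> Hom C W X; g \<in> Hom C X Y; h \<in> Hom C Y Z\<rbrakk>
      \<Longrightarrow> Cmp C W X Z (Cmp C X Y Z h g) f = Cmp C W Y Z h (Cmp C W X Y g f)"
    and Idn_in: "X \<in> Obj C \<Longrightarrow> Idn C X \<in> Hom C X X"
    and Cmp_Idn_right: "\<lbrakk>X \<in> Obj C; Y \<in> Obj C; f \<in> Hom C X Y\<rbrakk> \<Longrightarrow> Cmp C X X Y f (Idn C X) = f"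
    and Cmp_Idn_left: "\<lbrakk>X \<in> Obj C; Y \<in> Obj C; f \<in> Hom C X Y\<rbrakk> \<Longrightarrow> Cmp C X Y Y (Idn C Y) f = f"

definition iso_objects :: "('r, 'o, 'm) lincat \<Rightarrow> 'o \<Rightarrow> 'o \<Rightarrow> bool" where
  "iso_objects C X Y \<longleftrightarrow> (\<exists>f\<in>Hom C X Y. \<exists>g\<in>Hom C Y X.
     Cmp C X Y X g f = Idn C X \<and> Cmp C Y X Y f g = Idn C Y)"

definition zero_object :: "('r, 'o, 'm::zero) lincat \<Rightarrow> 'o \<Rightarrow> bool" where
  "zero_object C Z \<longleftrightarrow> Z \<in> Obj C \<and> (\<forall>X\<in>Obj C. Hom C X Z = {0} \<and> Hom C Z X = {0})"

definition is_mono :: "('r, 'o, 'm) lincat \<Rightarrow> 'o \<Rightarrow> 'o \<Rightarrow> 'm \<Rightarrow> bool" where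
  "is_mono C X Y f \<longleftrightarrow> X \<in> Obj C \<and> Y \<in> Obj C \<and> f \<in> Hom C X Y \<and>
     (\<forall>W\<in>Obj C. \<forall>g\<in>Hom C W X. \<forall>h\<in>Hom C W X. Cmp C W X Y f g = Cmp C W X Y f h \<longrightarrow> g = h)"

definition is_epi :: "('r, 'o, 'm) lincat \<Rightarrow> 'o \<Rightarrow> 'o \<Rightarrow> 'm \<Rightarrow> bool" where
  "is_epi C X Y f \<longleftrightarrow> X \<in> Obj C \<and> Y \<in> Obj C \<and> f \<in> Hom C X Y \<and>
     (\<forall>W\<in>Obj C. \<forall>g\<in>Hom C Y W. \<forall>h\<in>Hom C Y W. Cmp C X Y W g f = Cmp C X Y W h f \<longrightarrow> g = h)"

text \<open>\<open>is_kernel C X Y f K i\<close>: the morphism \<open>i : K \<rightarrow> X\<close> is a kernel of \<open>f : X \<rightarrow> Y\<close>.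
  \<open>is_cokernel C X Y f Q p\<close>: the morphism \<open>p : Y \<rightarrow> Q\<close> is a cokernel of \<open>f : X \<rightarrow> Y\<close>.\<close>

definition is_kernel ::
    "('r, 'o, 'm::zero) lincat \<Rightarrow> 'o \<Rightarrow> 'o \<Rightarrow> 'm \<Rightarrow> 'o \<Rightarrow> 'm \<Rightarrow> bool" where
  "is_kernel C X Y f K i \<longleftrightarrow> X \<in> Obj C \<and> Y \<in> Obj C \<and> f \<in> Hom C X Y \<and>
     K \<in> Obj C \<and> i \<in> Hom C K X \<and> Cmp C K X Y f i = 0 \<and>
     (\<forall>W\<in>Obj C. \<forall>g\<in>Hom C W X. Cmp C W X Y f g = 0 \<longrightarrow>
        (\<exists>!h. h \<in> Hom C W K \<and> Cmp C W K X i h = g))"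

definition is_cokernel ::
    "('r, 'o, 'm::zero) lincat \<Rightarrow> 'o \<Rightarrow> 'o \<Rightarrow> 'm \<Rightarrow> 'o \<Rightarrow> 'm \<Rightarrow> bool" where
  "is_cokernel C X Y f Q p \<longleftrightarrow> X \<in> Obj C \<and> Y \<in> Obj C \<and> f \<in> Hom C X Y \<and>
     Q \<in> Obj C \<and> p \<in> Hom C Y Q \<and> Cmp C X Y Q p f = 0 \<and>
     (\<forall>W\<in>Obj C. \<forall>g\<in>Hom C Y W. Cmp C X Y W g f = 0 \<longrightarrow>
        (\<exists>!h. h \<in> Hom C Q W \<and> Cmp C Y Q W h p = g))"

definition is_biproduct ::
    "('r, 'o, 'm::ab_group_add) lincat \<Rightarrow> 'o \<Rightarrow> 'o \<Rightarrow> 'o \<Rightarrow> 'm \<Rightarrow> 'm \<Rightarrow> 'm \<Rightarrow> 'm \<Rightarrow> bool" where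
  "is_biproduct C X Y P i j p q \<longleftrightarrow> P \<in> Obj C \<and>
     i \<in> Hom C X P \<and> j \<in> Hom C Y P \<and> p \<in> Hom C P X \<and> q \<in> Hom C P Y \<and>
     Cmp C X P X p i = Idn C X \<and> Cmp C Y P Y q j = Idn C Y \<and>
     Cmp C X P Y q i = 0 \<and> Cmp C Y P X p j = 0 \<and>
     Cmp C P X P i p + Cmp C P Y P j q = Idn C P"

locale abelian_category = linear_category C
  for C :: "('r::comm_ring_1, 'o, 'm::ab_group_add) lincat" +
  assumes ex_zero_object: "\<exists>Z. zero_object C Z"
    and ex_biproduct: "\<lbrakk>X \<in> Obj C; Y \<in> Obj C\<rbrakk> \<Longrightarrow> \<exists>P i j p q. is_biproduct C X Y P i j p q"
    and ex_kernel: "\<lbrakk>X \<in> Obj C; Y \<in> Obj C; f \<in> Hom C X Y\<rbrakk> \<Longrightarrow> \<exists>K i. is_kernel C X Y f K i"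
    and ex_cokernel: "\<lbrakk>X \<in> Obj C; Y \<in> Obj C; f \<in> Hom C X Y\<rbrakk> \<Longrightarrow> \<exists>Q p. is_cokernel C X Y f Q p"
    and mono_is_kernel: "is_mono C X Y f \<Longrightarrow> \<exists>Z g. is_kernel C Y Z g X f"
    and epi_is_cokernel: "is_epi C X Y f \<Longrightarrow> \<exists>W g. is_cokernel C W X g Y f"

definition injective :: "('r, 'o, 'm) lincat \<Rightarrow> 'o \<Rightarrow> bool" where
  "injective C E \<longleftrightarrow> E \<in> Obj C \<and>
     (\<forall>X Y m f. is_mono C X Y m \<longrightarrow> f \<in> Hom C X E \<longrightarrow> (\<exists>g\<in>Hom C Y E. Cmp C X Y E g m = f))"

definition enough_injectives :: "('r, 'o, 'm) lincat \<Rightarrow> bool" where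
  "enough_injectives C \<longleftrightarrow> (\<forall>X\<in>Obj C. \<exists>E m. injective C E \<and> is_mono C X E m)"

definition full_sub :: "('r, 'o, 'm) lincat \<Rightarrow> 'o set \<Rightarrow> ('r, 'o, 'm) lincat" where
  "full_sub C S = C\<lparr>Obj := S\<rparr>"

definition Inj :: "('r, 'o, 'm) lincat \<Rightarrow> ('r, 'o, 'm) lincat" where
  "Inj C = full_sub C {E. injective C E}"

text \<open>A functor given by \<open>Fo\<close> on objects and \<open>Fm\<close> on morphisms, linear along a ring
  homomorphism \<open>h\<close> between the base rings, which is an equivalence of categories.\<close>

definition linear_equivalence ::
    "('r \<Rightarrow> 's) \<Rightarrow> ('r, 'o, 'm::plus) lincat \<Rightarrow> ('s, 'p, 'q::plus) lincat \<Rightarrow>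
      ('o \<Rightarrow> 'p) \<Rightarrow> ('o \<Rightarrow> 'o \<Rightarrow> 'm \<Rightarrow> 'q) \<Rightarrow> bool" where
  "linear_equivalence h C D Fo Fm \<longleftrightarrow>
     (\<forall>X\<in>Obj C. Fo X \<in> Obj D) \<and>
     (\<forall>X\<in>Obj C. Fm X X (Idn C X) = Idn D (Fo X)) \<and>
     (\<forall>X\<in>Obj C. \<forall>Y\<in>Obj C. \<forall>Z\<in>Obj C. \<forall>f\<in>Hom C X Y. \<forall>g\<in>Hom C Y Z.
        Fm X Z (Cmp C X Y Z g f) = Cmp D (Fo X) (Fo Y) (Fo Z) (Fm Y Z g) (Fm X Y f)) \<and>
     (\<forall>X\<in>Obj C. \<forall>Y\<in>Obj C. \<forall>f\<in>Hom C X Y. \<forall>g\<in>Hom C X Y. \<forall>a.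
        Fm X Y (Scale C a f + g) = Scale D (h a) (Fm X Y f) + Fm X Y g) \<and>
     (\<forall>X\<in>Obj C. \<forall>Y\<in>Obj C. bij_betw (Fm X Y) (Hom C X Y) (Hom D (Fo X) (Fo Y))) \<and>
     (\<forall>Y\<in>Obj D. \<exists>X\<in>Obj C. iso_objects D (Fo X) Y)"


section \<open>The Hochschild complex of a graded quiver\<close>

text \<open>\<open>qhom Q X Y p\<close> is the degree \<open>p\<close> part of the graded module of arrows \<open>X \<rightarrow> Y\<close>.
  Different degrees may share elements of the ambient type, so degrees are always passed along.\<close>

record ('k, 'o, 'm) gquiver =
  qobj :: "'o set"
  qhom :: "'o \<Rightarrow> 'o \<Rightarrow> int \<Rightarrow> 'm set"
  qscale :: "'k \<Rightarrow> 'm \<Rightarrow> 'm"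

text \<open>\<open>dcomp D X Y Z p q g f\<close> is the composite of \<open>f : X \<rightarrow> Y\<close> of degree \<open>q\<close> and
  \<open>g : Y \<rightarrow> Z\<close> of degree \<open>p\<close>.\<close>

record ('k, 'o, 'm) dgcat = "('k, 'o, 'm) gquiver" +
  dcomp :: "'o \<Rightarrow> 'o \<Rightarrow> 'o \<Rightarrow> int \<Rightarrow> int \<Rightarrow> 'm \<Rightarrow> 'm \<Rightarrow> 'm"
  ddiff :: "'o \<Rightarrow> 'o \<Rightarrow> int \<Rightarrow> 'm \<Rightarrow> 'm"

text \<open>A cochain takes a list of objects \<open>[A\<^sub>n, \<dots>, A\<^sub>0]\<close>, a list of degrees \<open>[|f\<^sub>n|, \<dots>, |f\<^sub>1|]\<close> and a list
  \<open>[f\<^sub>n, \<dots>, f\<^sub>1]\<close> with \<open>f\<^sub>i : A\<^bsub>i-1\<^esub> \<rightarrow> A\<^sub>i\<close>. An element of the shift \<open>\<Sigma>\<aa>\<close> is written as the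
  corresponding element of \<open>\<aa>\<close>: for \<open>x\<close> in \<open>C_br\<close>, the value on \<open>[f\<^sub>n, \<dots>, f\<^sub>1]\<close> is the \<open>g\<close> with
  \<open>x(\<sigma>f\<^sub>n, \<dots>, \<sigma>f\<^sub>1) = \<sigma>g\<close>. Degrees are those in \<open>\<aa>\<close>, hence \<open>|\<sigma>f| = |f| - 1\<close> below.
  Linear maps out of a tensor product are rendered as multilinear maps.\<close>

type_synonym ('o, 'm) cochain = "'o list \<Rightarrow> int list \<Rightarrow> 'm list \<Rightarrow> 'm"

definition composable ::
    "('k, 'o, 'm, 'z) gquiver_scheme \<Rightarrow> 'o list \<Rightarrow> int list \<Rightarrow> 'm list \<Rightarrow> bool" where
  "composable Q As ds fs \<longleftrightarrow> length As = Suc (length fs) \<and> length ds = length fs \<and>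
     set As \<subseteq> qobj Q \<and> (\<forall>j<length fs. fs ! j \<in> qhom Q (As ! Suc j) (As ! j) (ds ! j))"

definition shifted_deg :: "int list \<Rightarrow> int" where
  "shifted_deg ds = (\<Sum>d\<leftarrow>ds. d - 1)"

definition sgn_act :: "int \<Rightarrow> 'm::ab_group_add \<Rightarrow> 'm" where
  "sgn_act n v = (if even n then v else - v)"

text \<open>The degree \<open>p\<close> part of \<open>C_br\<close>. Cochains are normalised to vanish outside composable
  arguments, so that equality of cochains is equality of functions.\<close>

definition C_br ::
    "('k, 'o, 'm::ab_group_add, 'z) gquiver_scheme \<Rightarrow> int \<Rightarrow> ('o, 'm) cochain set" where
  "C_br Q p = {x.
     (\<forall>As ds fs. composable Q As ds fs \<longrightarrow>
        x As ds fs \<in> qhom Q (last As) (hd As) (p + 1 + shifted_deg ds)) \<and>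
     (\<forall>As ds fs. \<not> composable Q As ds fs \<longrightarrow> x As ds fs = 0) \<and>
     (\<forall>As ds fs j a f g. j < length fs \<longrightarrow>
        composable Q As ds (fs[j := f]) \<longrightarrow> composable Q As ds (fs[j := g]) \<longrightarrow>
        x As ds (fs[j := qscale Q a f + g]) =
          qscale Q a (x As ds (fs[j := f])) + x As ds (fs[j := g]))}"

text \<open>The brace \<open>x{y}\<close> for \<open>y\<close> of degree \<open>q\<close>: the summand \<open>(i, l)\<close> is
  \<open>x(1\<^sup>\<otimes>\<^sup>i \<otimes> y \<otimes> 1\<^sup>\<otimes>\<dots>)\<close> with \<open>y\<close> of arity \<open>l\<close>, and \<open>y\<close> is moved past \<open>\<sigma>f\<^sub>n, \<dots>\<close> (\<open>i\<close> factors).\<close>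

definition brace ::
    "('k, 'o, 'm::ab_group_add, 'z) gquiver_scheme \<Rightarrow> int \<Rightarrow>
      ('o, 'm) cochain \<Rightarrow> ('o, 'm) cochain \<Rightarrow> ('o, 'm) cochain" where
  "brace Q q x y = (\<lambda>As ds fs.
     if composable Q As ds fs then
       (\<Sum>i\<in>{..length fs}. \<Sum>l\<in>{..length fs - i}.
          sgn_act (q * shifted_deg (take i ds))
            (x (take (Suc i) As @ drop (i + l) As)
               (take i ds @ [q + 1 + shifted_deg (take l (drop i ds))] @ drop (i + l) ds)
               (take i fs @ [y (take (Suc l) (drop i As)) (take l (drop i ds)) (take l (drop i fs))]
                 @ drop (i + l) fs)))
     else 0)"

definition br_bracket ::
    "('k, 'o, 'm::ab_group_add, 'z) gquiver_scheme \<Rightarrow> int \<Rightarrow> int \<Rightarrow>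
      ('o, 'm) cochain \<Rightarrow> ('o, 'm) cochain \<Rightarrow> ('o, 'm) cochain" where
  "br_bracket Q p q x y = brace Q q x y - (\<lambda>As ds fs. sgn_act (p * q) (brace Q p y x As ds fs))"

text \<open>The element of \<open>C_br\<close> corresponding to an unshifted cochain of Hochschild degree \<open>N\<close>: in arity
  \<open>n\<close>, where the cochain has degree \<open>N - n\<close>, the sign is
  \<open>(-1)\<close> to the power \<open>n (N - n) + (n-1)|f\<^sub>n| + \<dots> + |f\<^sub>2|\<close>.\<close>

definition to_br ::
    "('k, 'o, 'm::ab_group_add, 'z) gquiver_scheme \<Rightarrow> int \<Rightarrow>
      ('o, 'm) cochain \<Rightarrow> ('o, 'm) cochain" where
  "to_br Q N x = (\<lambda>As ds fs.
     if composable Q As ds fs then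
       (let n = length fs in
        sgn_act (int n * (N - int n) + (\<Sum>j<n. (int n - 1 - int j) * ds ! j)) (x As ds fs))
     else 0)"

definition arity1 ::
    "('o \<Rightarrow> 'o \<Rightarrow> int \<Rightarrow> 'm \<Rightarrow> 'm) \<Rightarrow> ('o, 'm::zero) cochain" where
  "arity1 u = (\<lambda>As ds fs. case fs of [f] \<Rightarrow> u (As ! 1) (As ! 0) (ds ! 0) f | _ \<Rightarrow> 0)"

definition arity2 ::
    "('o \<Rightarrow> 'o \<Rightarrow> 'o \<Rightarrow> int \<Rightarrow> int \<Rightarrow> 'm \<Rightarrow> 'm \<Rightarrow> 'm) \<Rightarrow> ('o, 'm::zero) cochain" where
  "arity2 u = (\<lambda>As ds fs. case fs of
     [g, f] \<Rightarrow> u (As ! 2) (As ! 1) (As ! 0) (ds ! 0) (ds ! 1) g f | _ \<Rightarrow> 0)"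

definition dg_structure :: "('k, 'o, 'm::ab_group_add) dgcat \<Rightarrow> ('o, 'm) cochain" where
  "dg_structure D = to_br D 2 (arity1 (ddiff D) + arity2 (dcomp D))"

text \<open>\<open>C = \<Sigma>\<^sup>-\<^sup>1 C_br\<close>, so Hochschild degree \<open>n\<close> is degree \<open>n - 1\<close> in \<open>C_br\<close>. A cohomology class is
  the set of its representing cocycles.\<close>

definition hoch_diff ::
    "('k, 'o, 'm::ab_group_add) dgcat \<Rightarrow> int \<Rightarrow> ('o, 'm) cochain \<Rightarrow> ('o, 'm) cochain" where
  "hoch_diff D n x = br_bracket D 1 (n - 1) (dg_structure D) x"

definition HZ :: "('k, 'o, 'm::ab_group_add) dgcat \<Rightarrow> int \<Rightarrow> ('o, 'm) cochain set" where
  "HZ D n = {x \<in> C_br D (n - 1). hoch_diff D n x = 0}"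

definition HB :: "('k, 'o, 'm::ab_group_add) dgcat \<Rightarrow> int \<Rightarrow> ('o, 'm) cochain set" where
  "HB D n = hoch_diff D (n - 1) ` C_br D (n - 2)"

definition HH_class ::
    "('k, 'o, 'm::ab_group_add) dgcat \<Rightarrow> int \<Rightarrow> ('o, 'm) cochain \<Rightarrow> ('o, 'm) cochain set" where
  "HH_class D n x = {y \<in> HZ D n. y - x \<in> HB D n}"

definition HH :: "('k, 'o, 'm::ab_group_add) dgcat \<Rightarrow> int \<Rightarrow> ('o, 'm) cochain set set" where
  "HH D n = HH_class D n ` HZ D n"

text \<open>Cohomology \<open>H\<^sup>p(D(X, Y))\<close> of the morphism complexes.\<close>

definition hom_cocycles ::
    "('k, 'o, 'm::ab_group_add) dgcat \<Rightarrow> 'o \<Rightarrow> 'o \<Rightarrow> int \<Rightarrow> 'm set" where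
  "hom_cocycles D X Y p = {f \<in> qhom D X Y p. ddiff D X Y p f = 0}"

definition hom_coboundaries ::
    "('k, 'o, 'm::ab_group_add) dgcat \<Rightarrow> 'o \<Rightarrow> 'o \<Rightarrow> int \<Rightarrow> 'm set" where
  "hom_coboundaries D X Y p = ddiff D X Y (p - 1) ` qhom D X Y (p - 1)"

definition hom_class ::
    "('k, 'o, 'm::ab_group_add) dgcat \<Rightarrow> 'o \<Rightarrow> 'o \<Rightarrow> int \<Rightarrow> 'm \<Rightarrow> 'm set" where
  "hom_class D X Y p f = {g \<in> hom_cocycles D X Y p. g - f \<in> hom_coboundaries D X Y p}"

definition hom_cohomology ::
    "('k, 'o, 'm::ab_group_add) dgcat \<Rightarrow> 'o \<Rightarrow> 'o \<Rightarrow> int \<Rightarrow> 'm set set" where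
  "hom_cohomology D X Y p = hom_class D X Y p ` hom_cocycles D X Y p"

text \<open>A linear category as a dg category concentrated in degree \<open>0\<close>.\<close>

definition lin_dg :: "('k, 'o, 'm::ab_group_add) lincat \<Rightarrow> ('k, 'o, 'm) dgcat" where
  "lin_dg C = \<lparr>qobj = Obj C, qhom = (\<lambda>X Y p. if p = 0 then Hom C X Y else {0}),
     qscale = Scale C, dcomp = (\<lambda>X Y Z p q. Cmp C X Y Z), ddiff = (\<lambda>X Y p f. 0)\<rparr>"

text \<open>The Hochschild cochain given by a family \<open>\<phi> X Y Z g f\<close> of bilinear maps on a linear category.\<close>

definition two_cochain ::
    "('k, 'o, 'm::ab_group_add) lincat \<Rightarrow> ('o \<Rightarrow> 'o \<Rightarrow> 'o \<Rightarrow> 'm \<Rightarrow> 'm \<Rightarrow> 'm) \<Rightarrow>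
      ('o, 'm) cochain" where
  "two_cochain C \<phi> = to_br (lin_dg C) 2 (arity2 (\<lambda>X Y Z p q. \<phi> X Y Z))"


section \<open>The derived category and the characteristic morphism\<close>

type_synonym ('o, 'm) cplx = "(int \<Rightarrow> 'o) \<times> (int \<Rightarrow> 'm)"

definition is_complex :: "('r, 'o, 'm::zero) lincat \<Rightarrow> ('o, 'm) cplx \<Rightarrow> bool" where
  "is_complex C M \<longleftrightarrow> (\<forall>i. fst M i \<in> Obj C) \<and> (\<forall>i. snd M i \<in> Hom C (fst M i) (fst M (i + 1))) \<and>
     (\<forall>i. Cmp C (fst M i) (fst M (i + 1)) (fst M (i + 2)) (snd M (i + 1)) (snd M i) = 0)"

text \<open>\<open>p : K \<rightarrow> H\<close> exhibits \<open>H\<close> as the cohomology of \<open>X \<rightarrow> Y \<rightarrow> Z\<close> at \<open>Y\<close>, where \<open>i : K \<rightarrow> Y\<close> is a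
  kernel of \<open>Y \<rightarrow> Z\<close>.\<close>

definition is_cohomology ::
    "('r, 'o, 'm::zero) lincat \<Rightarrow> 'o \<Rightarrow> 'o \<Rightarrow> 'o \<Rightarrow> 'm \<Rightarrow> 'm \<Rightarrow> 'o \<Rightarrow> 'm \<Rightarrow> 'o \<Rightarrow> 'm \<Rightarrow> bool" where
  "is_cohomology C X Y Z f g K i H p \<longleftrightarrow> is_kernel C Y Z g K i \<and>
     (\<exists>e\<in>Hom C X K. Cmp C X K Y i e = f \<and> is_cokernel C X K e H p)"

definition cohomology_vanishes :: "('r, 'o, 'm::zero) lincat \<Rightarrow> ('o, 'm) cplx \<Rightarrow> int \<Rightarrow> bool" where
  "cohomology_vanishes C M n \<longleftrightarrow> (\<exists>K i H p.
     is_cohomology C (fst M (n - 1)) (fst M n) (fst M (n + 1)) (snd M (n - 1)) (snd M n) K i H p \<and>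
     zero_object C H)"

definition Db_objects :: "('r, 'o, 'm::zero) lincat \<Rightarrow> ('o, 'm) cplx set" where
  "Db_objects C = {M. is_complex C M \<and> (\<forall>i. injective C (fst M i)) \<and>
     (\<exists>n. \<forall>i<n. zero_object C (fst M i)) \<and>
     (\<exists>n. \<forall>i. \<bar>i\<bar> > n \<longrightarrow> cohomology_vanishes C M i)}"

text \<open>Componentwise application \<open>(g, f) \<mapsto> (u(g\<^bsub>i+|f|\<^esub>, f\<^sub>i))\<^sub>i\<close> of a binary operation on morphisms
  to graded maps between complexes.\<close>

definition componentwise ::
    "('o \<Rightarrow> 'o \<Rightarrow> 'o \<Rightarrow> 'm \<Rightarrow> 'm \<Rightarrow> 'm) \<Rightarrow>
      ('o, 'm) cplx \<Rightarrow> ('o, 'm) cplx \<Rightarrow> ('o, 'm) cplx \<Rightarrow> int \<Rightarrow> int \<Rightarrow>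
      (int \<Rightarrow> 'm) \<Rightarrow> (int \<Rightarrow> 'm) \<Rightarrow> (int \<Rightarrow> 'm)" where
  "componentwise u L M N p q g f =
     (\<lambda>i. u (fst L i) (fst M (i + q)) (fst N (i + q + p)) (g (i + q)) (f i))"

definition Db_dg ::
    "('k, 'o, 'm::ab_group_add) lincat \<Rightarrow> ('k, ('o, 'm) cplx, int \<Rightarrow> 'm) dgcat" where
  "Db_dg C = \<lparr>qobj = Db_objects C,
     qhom = (\<lambda>M N p. {f. \<forall>i. f i \<in> Hom C (fst M i) (fst N (i + p))}),
     qscale = (\<lambda>a f i. Scale C a (f i)),
     dcomp = componentwise (Cmp C),
     ddiff = (\<lambda>M N p f.
       componentwise (Cmp C) M N N 1 p (snd N) f
         - sgn_act p (componentwise (Cmp C) M M N p 1 f (snd M)))\<rparr>"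

definition Ext :: "('k, 'o, 'm::ab_group_add) lincat \<Rightarrow> int \<Rightarrow> ('o, 'm) cplx \<Rightarrow> ('o, 'm) cplx \<Rightarrow>
    (int \<Rightarrow> 'm) set set" where
  "Ext C n M N = hom_cohomology (Db_dg C) M N n"

definition ext_class :: "('k, 'o, 'm::ab_group_add) lincat \<Rightarrow> int \<Rightarrow> ('o, 'm) cplx \<Rightarrow> ('o, 'm) cplx \<Rightarrow>
    (int \<Rightarrow> 'm) \<Rightarrow> (int \<Rightarrow> 'm) set" where
  "ext_class C n M N f = hom_class (Db_dg C) M N n f"

text \<open>Isomorphism in \<open>D\<^sup>b\<close>, which is \<open>H\<^sup>0\<close> of the dg category above.\<close>

definition Db_iso ::
    "('k, 'o, 'm::ab_group_add) lincat \<Rightarrow> ('o, 'm) cplx \<Rightarrow> ('o, 'm) cplx \<Rightarrow> bool" where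
  "Db_iso C M N \<longleftrightarrow> (\<exists>f\<in>hom_cocycles (Db_dg C) M N 0. \<exists>g\<in>hom_cocycles (Db_dg C) N M 0.
     dcomp (Db_dg C) M N M 0 0 g f - (\<lambda>i. Idn C (fst M i)) \<in> hom_coboundaries (Db_dg C) M M 0 \<and>
     dcomp (Db_dg C) N M N 0 0 f g - (\<lambda>i. Idn C (fst N i)) \<in> hom_coboundaries (Db_dg C) N N 0)"

definition HH_ex ::
    "('k, 'o, 'm::ab_group_add) lincat \<Rightarrow> int \<Rightarrow> (('o, 'm) cplx, int \<Rightarrow> 'm) cochain set set" where
  "HH_ex C n = HH (Db_dg C) n"

text \<open>Projection to the arity zero part. The union is over the equal classes obtained from the
  representatives of \<open>c\<close>.\<close>

definition char_mor :: "('k, 'o, 'm::ab_group_add) lincat \<Rightarrow> int \<Rightarrow>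
    (('o, 'm) cplx, int \<Rightarrow> 'm) cochain set \<Rightarrow> ('o, 'm) cplx \<Rightarrow> (int \<Rightarrow> 'm) set" where
  "char_mor C n c M = (\<Union>\<psi>\<in>c. ext_class C n M M (\<psi> [M] [] []))"

definition conc :: "'m::zero \<Rightarrow> int \<Rightarrow> 'm" where
  "conc f = (\<lambda>i. if i = 0 then f else 0)"

definition stalk :: "('r, 'o, 'm::zero) lincat \<Rightarrow> 'o \<Rightarrow> ('o, 'm) cplx" where
  "stalk C E = ((\<lambda>i. if i = 0 then E else (SOME Z. zero_object C Z)), (\<lambda>i. 0))"

text \<open>Restriction of cochains along \<open>Inj \<subset> D\<^sup>b_dg\<close>, and the induced map on cohomology.\<close>

definition restrict_cochain :: "('k, 'o, 'm::ab_group_add) lincat \<Rightarrow>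
    (('o, 'm) cplx, int \<Rightarrow> 'm) cochain \<Rightarrow> ('o, 'm) cochain" where
  "restrict_cochain C \<psi> = (\<lambda>As ds fs.
     if composable (lin_dg (Inj C)) As ds fs then \<psi> (map (stalk C) As) ds (map conc fs) 0 else 0)"

definition restrict_class :: "('k, 'o, 'm::ab_group_add) lincat \<Rightarrow> int \<Rightarrow>
    (('o, 'm) cplx, int \<Rightarrow> 'm) cochain set \<Rightarrow> ('o, 'm) cochain set" where
  "restrict_class C n c = (\<Union>\<psi>\<in>c. HH_class (lin_dg (Inj C)) n (restrict_cochain C \<psi>))"


section \<open>Deformations\<close>

text \<open>\<open>\<epsilon>\<close> as an endomorphism of \<open>X\<close>.\<close>

definition eps_end :: "('k::comm_ring_1 dualnum, 'o, 'm) lincat \<Rightarrow> 'o \<Rightarrow> 'm" where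
  "eps_end B X = Scale B eps (Idn B X)"

text \<open>\<open>p : K \<rightarrow> H\<close> exhibits \<open>H\<close> as \<open>Ext\<^sup>1(k, X)\<close> over \<open>k[\<epsilon>]\<close>, with \<open>i : K \<rightarrow> X\<close> a kernel of \<open>\<epsilon>\<close>:
  the periodic resolution of \<open>k\<close> by \<open>k[\<epsilon>]\<close> identifies this object with the cohomology of
  \<open>\<epsilon>, \<epsilon> : X \<rightarrow> X \<rightarrow> X\<close>.\<close>

definition is_Ext1 ::
    "('k::comm_ring_1 dualnum, 'o, 'm::zero) lincat \<Rightarrow> 'o \<Rightarrow> 'o \<Rightarrow> 'm \<Rightarrow> 'o \<Rightarrow> 'm \<Rightarrow> bool" where
  "is_Ext1 B X K i H p \<longleftrightarrow> is_cohomology B X X X (eps_end B X) (eps_end B X) K i H p"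

text \<open>Flatness in the sense of Lowen and Van den Bergh: \<open>Ext\<^sup>1(V, -)\<close> is effaceable for every finitely
  presented \<open>k[\<epsilon>]\<close>-module \<open>V\<close>. Over a field \<open>k\<close> such a \<open>V\<close> is a finite direct sum of copies of \<open>k\<close> and
  \<open>k[\<epsilon>]\<close>, and \<open>Ext\<^sup>1(k[\<epsilon>], -) = 0\<close>, so that only \<open>V = k\<close> matters.\<close>

definition flat_category :: "('k::comm_ring_1 dualnum, 'o, 'm::zero) lincat \<Rightarrow> bool" where
  "flat_category B \<longleftrightarrow> (\<forall>X\<in>Obj B. \<exists>Y u. is_mono B X Y u \<and>
     (\<forall>K i H p K' i' H' p' w v.
        is_Ext1 B X K i H p \<longrightarrow> is_Ext1 B Y K' i' H' p' \<longrightarrow>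
        w \<in> Hom B K K' \<longrightarrow> Cmp B K K' Y i' w = Cmp B K X Y u i \<longrightarrow>
        v \<in> Hom B H H' \<longrightarrow> Cmp B K H H' v p = Cmp B K K' H' p' w \<longrightarrow> v = 0))"

definition eps_zero_objects :: "('k::comm_ring_1 dualnum, 'o, 'm::zero) lincat \<Rightarrow> 'o set" where
  "eps_zero_objects B = {X \<in> Obj B. eps_end B X = 0}"

text \<open>The functor \<open>(Fo, Fm)\<close> is the equivalence of \<open>A\<close> with \<open>Hom(k, B)\<close>.\<close>

definition abelian_deformation ::
    "('k::comm_ring_1, 'o, 'm::ab_group_add) lincat \<Rightarrow> ('k dualnum, 'p, 'q::ab_group_add) lincat \<Rightarrow>
      ('o \<Rightarrow> 'p) \<Rightarrow> ('o \<Rightarrow> 'o \<Rightarrow> 'm \<Rightarrow> 'q) \<Rightarrow> bool" where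
  "abelian_deformation A B Fo Fm \<longleftrightarrow> abelian_category B \<and> flat_category B \<and>
     linear_equivalence (\<lambda>a. Dual a 0) A (full_sub B (eps_zero_objects B)) Fo Fm"

text \<open>The category \<open>\<aa>\<^sub>\<phi>[\<epsilon>]\<close>; the pair \<open>(f, f')\<close> is \<open>f + \<epsilon>f'\<close>. Since \<open>\<phi>\<close> need not be normalised, the
  identity is \<open>1 - \<epsilon>\<phi>(1, 1)\<close>.\<close>

definition lin_deformation ::
    "('k::comm_ring_1, 'o, 'm::ab_group_add) lincat \<Rightarrow> ('o \<Rightarrow> 'o \<Rightarrow> 'o \<Rightarrow> 'm \<Rightarrow> 'm \<Rightarrow> 'm) \<Rightarrow>
      ('k dualnum, 'o, 'm \<times> 'm) lincat" where
  "lin_deformation C \<phi> = \<lparr>Obj = Obj C, Hom = (\<lambda>X Y. Hom C X Y \<times> Hom C X Y),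
     Scale = (\<lambda>a f. (Scale C (dre a) (fst f), Scale C (dre a) (snd f) + Scale C (deps a) (fst f))),
     Cmp = (\<lambda>X Y Z g f. (Cmp C X Y Z (fst g) (fst f),
       Cmp C X Y Z (fst g) (snd f) + Cmp C X Y Z (snd g) (fst f) + \<phi> X Y Z (fst g) (fst f))),
     Idn = (\<lambda>X. (Idn C X, - \<phi> X X X (Idn C X) (Idn C X)))\<rparr>"

text \<open>\<open>B\<close> is the abelian deformation of \<open>A\<close> determined by \<open>\<phi>\<close>: \<open>(Go, Gm)\<close> is an equivalence
  \<open>Inj(A)\<^sub>\<phi>[\<epsilon>] \<rightarrow> Inj(B)\<close>, and \<open>\<kappa> E : Fo E \<rightarrow> Go E\<close> identifies \<open>Fo E\<close> with
  \<open>Hom(k, Go E) = ker \<epsilon>\<close> naturally, so that \<open>Hom(k, -)\<close> corresponds to reduction modulo \<open>\<epsilon>\<close>.\<close>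

definition deformation_of_class ::
    "('k::comm_ring_1, 'o, 'm::ab_group_add) lincat \<Rightarrow> ('o \<Rightarrow> 'o \<Rightarrow> 'o \<Rightarrow> 'm \<Rightarrow> 'm \<Rightarrow> 'm) \<Rightarrow>
      ('k dualnum, 'p, 'q::ab_group_add) lincat \<Rightarrow>
      ('o \<Rightarrow> 'p) \<Rightarrow> ('o \<Rightarrow> 'o \<Rightarrow> 'm \<Rightarrow> 'q) \<Rightarrow>
      ('o \<Rightarrow> 'p) \<Rightarrow> ('o \<Rightarrow> 'o \<Rightarrow> 'm \<times> 'm \<Rightarrow> 'q) \<Rightarrow> ('o \<Rightarrow> 'q) \<Rightarrow> bool" where
  "deformation_of_class A \<phi> B Fo Fm Go Gm \<kappa> \<longleftrightarrow>
     abelian_deformation A B Fo Fm \<and>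
     linear_equivalence id (lin_deformation (Inj A) \<phi>) (Inj B) Go Gm \<and>
     (\<forall>E\<in>Obj (Inj A). is_kernel B (Go E) (Go E) (eps_end B (Go E)) (Fo E) (\<kappa> E)) \<and>
     (\<forall>E\<in>Obj (Inj A). \<forall>E'\<in>Obj (Inj A). \<forall>f\<in>Hom (Inj A) E E'. \<forall>f'\<in>Hom (Inj A) E E'.
        Cmp B (Fo E) (Go E) (Go E') (Gm E E' (f, f')) (\<kappa> E) =
        Cmp B (Fo E) (Fo E') (Go E') (\<kappa> E') (Fm E E' f))"

text \<open>\<open>M\<close> deforms to an object \<open>L\<close> of \<open>D\<^sup>b(B)\<close>. As \<open>L\<close> is a complex of injectives,
  \<open>RHom(k, L)\<close> is computed componentwise by \<open>Hom(k, -) = ker \<epsilon>\<close>; \<open>N\<close> is the corresponding complex in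
  \<open>A\<close>, with \<open>\<iota> i\<close> the inclusion of the kernel.\<close>

definition has_deformation ::
    "('k::comm_ring_1, 'o, 'm::ab_group_add) lincat \<Rightarrow> ('k dualnum, 'p, 'q::ab_group_add) lincat \<Rightarrow>
      ('o \<Rightarrow> 'p) \<Rightarrow> ('o \<Rightarrow> 'o \<Rightarrow> 'm \<Rightarrow> 'q) \<Rightarrow> ('o, 'm) cplx \<Rightarrow> bool" where
  "has_deformation A B Fo Fm M \<longleftrightarrow> (\<exists>L\<in>Db_objects B. \<exists>N\<in>Db_objects A. \<exists>\<iota>.
     (\<forall>i. is_kernel B (fst L i) (fst L i) (eps_end B (fst L i)) (Fo (fst N i)) (\<iota> i)) \<and>
     (\<forall>i. Cmp B (Fo (fst N i)) (fst L i) (fst L (i + 1)) (snd L i) (\<iota> i) =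
          Cmp B (Fo (fst N i)) (Fo (fst N (i + 1))) (fst L (i + 1))
            (\<iota> (i + 1)) (Fm (fst N i) (fst N (i + 1)) (snd N i))) \<and>
     Db_iso A N M)"

text \<open>The obstruction class \<open>[\<phi>(\<delta>, \<delta>)]\<close>. The cochain \<open>\<phi>\<close> is extended componentwise to complexes and
  then applied, as an element of \<open>C_br\<close>, to \<open>(\<sigma>\<delta>, \<sigma>\<delta>)\<close>. The correspondence between unshifted
  cochains and \<open>C_br\<close> thus contributes the sign \<open>(-1)\<close> to the power \<open>|\<delta>|\<close>, so the representing
  cocycle has components \<open>- \<phi>(\<delta>\<^bsub>i+1\<^esub>, \<delta>\<^sub>i)\<close>. This is the sign compatible with projecting to the
  arity zero part without a sign.\<close>

definition obstruction :: "('k, 'o, 'm::ab_group_add) lincat \<Rightarrow>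
    ('o \<Rightarrow> 'o \<Rightarrow> 'o \<Rightarrow> 'm \<Rightarrow> 'm \<Rightarrow> 'm) \<Rightarrow> ('o, 'm) cplx \<Rightarrow> (int \<Rightarrow> 'm) set" where
  "obstruction C \<phi> M = ext_class C 2 M M
     (to_br (Db_dg C) 2 (arity2 (componentwise \<phi>)) [M, M, M] [1, 1] [snd M, snd M])"

end

theory Submission
  imports Defs
begin

text \<open>Let \<open>\<psi>\<close> be a Hochschild 2-cocycle of the dg category representing \<open>c\<close>, and \<open>M = (I, \<delta>)\<close>. Write
  \<open>v\<^sub>i : M \<rightarrow> I\<^sup>i\<close> for the projections, of degree \<open>- i\<close>, and \<open>a\<^sub>j = (-1)\<^sup>j \<delta>\<^sub>j\<close>. The dg structure sends \<open>v\<^sub>i\<close> and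
  \<open>(a\<^bsub>i-1\<^esub>, v\<^bsub>i-1\<^esub>)\<close> to opposite elements, so adding up the cocycle equations of \<open>\<psi>\<close> at
  \<open>(a\<^bsub>i-1\<^esub>, \<dots>, a\<^bsub>i-n\<^esub>, v\<^bsub>i-n\<^esub>)\<close> over \<open>n \<ge> 0\<close> telescopes; the sum is finite because \<open>M\<close> is bounded below. For
  degree reasons the only surviving value of \<open>\<psi>\<close> on arguments without \<open>v\<close> is \<open>\<psi>(a\<^bsub>i-1\<^esub>, a\<^bsub>i-2\<^esub>) = - \<psi>(\<delta>\<^bsub>i-1\<^esub>, \<delta>\<^bsub>i-2\<^esub>)\<close>, and the
  result says that \<open>\<psi>\<^sub>0(M)\<close> and the obstruction cocycle differ by a coboundary.

  A homotopy \<open>h\<close> with \<open>\<delta>h + h\<delta> + \<phi>(\<delta>, \<delta>) = 0\<close> is the same as a differential \<open>\<delta> + \<epsilon>h\<close> on \<open>I\<close> over the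
  deformed category of injectives. Conversely, injectives of the deformation are determined by
  their kernel of \<open>\<epsilon>\<close>, so a lift of a complex \<open>N\<close> isomorphic to \<open>M\<close> is, up to isomorphism, of this
  form; the vanishing then passes from \<open>N\<close> to \<open>M\<close> because \<open>\<psi>\<^sub>0\<close> is central up to coboundaries.\<close>

section \<open>Linear and abelian categories\<close>

text \<open>The difficulty is that \<open>\<psi>\<close> is tied to \<open>\<phi>\<close> only on
  injectives in degree 0, whereas its arity zero value at \<open>M\<close> concerns a whole complex.
  The projections \<open>v\<^sub>i\<close> mediate: composing the arity zero value with
  \<open>v\<^sub>i\<close> reads off its component into \<open>I\<^sup>i\<close>, and this composite
  occurs in the cocycle equation at the single argument \<open>v\<^sub>i\<close>. That equation also
  contains \<open>\<psi>\<close> at the differential of \<open>v\<^sub>i\<close>, a value over which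
  there is no control; the longer tuples serve to cancel it. The sign of \<open>a\<^sub>j\<close> is
  forced by this: \<open>v\<^sub>j\<close> has degree \<open>- j\<close>, so its differential
  carries \<open>(-1)\<^sup>j\<close>. For the lifted complex the delicate point is that its
  cohomology is bounded. Kernels in the deformed category are not described by
  \<open>\<phi>\<close>, so exactness is recast as an extension property of maps into a cogenerating
  family of injectives; such maps are pairs of maps of the original category.\<close>

context linear_category
begin

lemma Hom_zero: "\<lbrakk>X \<in> Obj C; Y \<in> Obj C\<rbrakk> \<Longrightarrow> 0 \<in> Hom C X Y"
  using subspace_Hom subspace_0 by blast

lemma Hom_add: "\<lbrakk>X \<in> Obj C; Y \<in> Obj C; f \<in> Hom C X Y; g \<in> Hom C X Y\<rbrakk> \<Longrightarrow> f + g \<in> Hom C X Y"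
  using subspace_Hom subspace_add by blast

lemma Hom_scale: "\<lbrakk>X \<in> Obj C; Y \<in> Obj C; f \<in> Hom C X Y\<rbrakk> \<Longrightarrow> Scale C a f \<in> Hom C X Y"
  using subspace_Hom subspace_scale by blast

lemma Hom_uminus: "\<lbrakk>X \<in> Obj C; Y \<in> Obj C; f \<in> Hom C X Y\<rbrakk> \<Longrightarrow> - f \<in> Hom C X Y"
  using subspace_Hom subspace_neg by blast

lemma Hom_diff: "\<lbrakk>X \<in> Obj C; Y \<in> Obj C; f \<in> Hom C X Y; g \<in> Hom C X Y\<rbrakk> \<Longrightarrow> f - g \<in> Hom C X Y"
  using subspace_Hom subspace_diff by blast

lemma Hom_sum:
  "\<lbrakk>X \<in> Obj C; Y \<in> Obj C; \<And>j. j \<in> J \<Longrightarrow> f j \<in> Hom C X Y\<rbrakk> \<Longrightarrow> sum f J \<in> Hom C X Y"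
  using subspace_Hom subspace_sum by blast

lemma Hom_sgn_act: "\<lbrakk>X \<in> Obj C; Y \<in> Obj C; f \<in> Hom C X Y\<rbrakk> \<Longrightarrow> sgn_act n f \<in> Hom C X Y"
  by (simp add: sgn_act_def Hom_uminus)

lemma Cmp_add_left:
  "\<lbrakk>X \<in> Obj C; Y \<in> Obj C; Z \<in> Obj C; f \<in> Hom C X Y; g \<in> Hom C Y Z; g' \<in> Hom C Y Z\<rbrakk>
    \<Longrightarrow> Cmp C X Y Z (g + g') f = Cmp C X Y Z g f + Cmp C X Y Z g' f"
  using Cmp_linear_left[of X Y Z f g g' 1] by simp

lemma Cmp_add_right:
  "\<lbrakk>X \<in> Obj C; Y \<in> Obj C; Z \<in> Obj C; f \<in> Hom C X Y; f' \<in> Hom C X Y; g \<in> Hom C Y Z\<rbrakk>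
    \<Longrightarrow> Cmp C X Y Z g (f + f') = Cmp C X Y Z g f + Cmp C X Y Z g f'"
  using Cmp_linear_right[of X Y Z f f' g 1] by simp

lemma Cmp_zero_left: "\<lbrakk>X \<in> Obj C; Y \<in> Obj C; Z \<in> Obj C; f \<in> Hom C X Y\<rbrakk> \<Longrightarrow> Cmp C X Y Z 0 f = 0"
  using Cmp_add_left[of X Y Z f 0 0] Hom_zero by simp

lemma Cmp_zero_right: "\<lbrakk>X \<in> Obj C; Y \<in> Obj C; Z \<in> Obj C; g \<in> Hom C Y Z\<rbrakk> \<Longrightarrow> Cmp C X Y Z g 0 = 0"
  using Cmp_add_right[of X Y Z 0 0 g] Hom_zero by simp

lemma Cmp_scale_left:
  "\<lbrakk>X \<in> Obj C; Y \<in> Obj C; Z \<in> Obj C; f \<in> Hom C X Y; g \<in> Hom C Y Z\<rbrakk>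
    \<Longrightarrow> Cmp C X Y Z (Scale C a g) f = Scale C a (Cmp C X Y Z g f)"
  using Cmp_linear_left[of X Y Z f g 0 a] by (simp add: Hom_zero Cmp_zero_left)

lemma Cmp_scale_right:
  "\<lbrakk>X \<in> Obj C; Y \<in> Obj C; Z \<in> Obj C; f \<in> Hom C X Y; g \<in> Hom C Y Z\<rbrakk>
    \<Longrightarrow> Cmp C X Y Z g (Scale C a f) = Scale C a (Cmp C X Y Z g f)"
  using Cmp_linear_right[of X Y Z f 0 g a] by (simp add: Hom_zero Cmp_zero_right)

lemma Cmp_uminus_left:
  "\<lbrakk>X \<in> Obj C; Y \<in> Obj C; Z \<in> Obj C; f \<in> Hom C X Y; g \<in> Hom C Y Z\<rbrakk>
    \<Longrightarrow> Cmp C X Y Z (- g) f = - Cmp C X Y Z g f"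
  using Cmp_add_left[of X Y Z f g "- g"] by (simp add: Hom_zero Hom_uminus Cmp_zero_left add_eq_0_iff)

lemma Cmp_uminus_right:
  "\<lbrakk>X \<in> Obj C; Y \<in> Obj C; Z \<in> Obj C; f \<in> Hom C X Y; g \<in> Hom C Y Z\<rbrakk>
    \<Longrightarrow> Cmp C X Y Z g (- f) = - Cmp C X Y Z g f"
  using Cmp_add_right[of X Y Z f "- f" g] by (simp add: Hom_zero Hom_uminus Cmp_zero_right add_eq_0_iff)

lemma Cmp_diff_left:
  "\<lbrakk>X \<in> Obj C; Y \<in> Obj C; Z \<in> Obj C; f \<in> Hom C X Y; g \<in> Hom C Y Z; g' \<in> Hom C Y Z\<rbrakk>
    \<Longrightarrow> Cmp C X Y Z (g - g') f = Cmp C X Y Z g f - Cmp C X Y Z g' f"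
  using Cmp_add_left[of X Y Z f g "- g'"] by (simp add: Hom_uminus Cmp_uminus_left)

lemma Cmp_diff_right:
  "\<lbrakk>X \<in> Obj C; Y \<in> Obj C; Z \<in> Obj C; f \<in> Hom C X Y; f' \<in> Hom C X Y; g \<in> Hom C Y Z\<rbrakk>
    \<Longrightarrow> Cmp C X Y Z g (f - f') = Cmp C X Y Z g f - Cmp C X Y Z g f'"
  using Cmp_add_right[of X Y Z f "- f'" g] by (simp add: Hom_uminus Cmp_uminus_right)

lemma Cmp_sgn_act_left:
  "\<lbrakk>X \<in> Obj C; Y \<in> Obj C; Z \<in> Obj C; f \<in> Hom C X Y; g \<in> Hom C Y Z\<rbrakk>
    \<Longrightarrow> Cmp C X Y Z (sgn_act n g) f = sgn_act n (Cmp C X Y Z g f)"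
  by (simp add: sgn_act_def Cmp_uminus_left)

lemma Cmp_sgn_act_right:
  "\<lbrakk>X \<in> Obj C; Y \<in> Obj C; Z \<in> Obj C; f \<in> Hom C X Y; g \<in> Hom C Y Z\<rbrakk>
    \<Longrightarrow> Cmp C X Y Z g (sgn_act n f) = sgn_act n (Cmp C X Y Z g f)"
  by (simp add: sgn_act_def Cmp_uminus_right)

lemma Cmp_sum_left:
  assumes "X \<in> Obj C" "Y \<in> Obj C" "Z \<in> Obj C" "f \<in> Hom C X Y" "finite J"
    and "\<And>j. j \<in> J \<Longrightarrow> g j \<in> Hom C Y Z"
  shows "Cmp C X Y Z (\<Sum>j\<in>J. g j) f = (\<Sum>j\<in>J. Cmp C X Y Z (g j) f)"
  using assms(5,6)
proof (induction J rule: finite_induct)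
  case empty
  then show ?case using assms(1-4) by (simp add: Cmp_zero_left)
next
  case (insert j J)
  have "g j \<in> Hom C Y Z" "sum g J \<in> Hom C Y Z" using insert.prems assms(1-3) by (auto intro: Hom_sum)
  then show ?case using insert assms(1-4) by (simp add: Cmp_add_left)
qed

lemma Cmp_sum_right:
  assumes "X \<in> Obj C" "Y \<in> Obj C" "Z \<in> Obj C" "g \<in> Hom C Y Z" "finite J"
    and "\<And>j. j \<in> J \<Longrightarrow> f j \<in> Hom C X Y"
  shows "Cmp C X Y Z g (\<Sum>j\<in>J. f j) = (\<Sum>j\<in>J. Cmp C X Y Z g (f j))"
  using assms(5,6)
proof (induction J rule: finite_induct)
  case empty
  then show ?case using assms(1-4) by (simp add: Cmp_zero_right)
next
  case (insert j J)
  have "f j \<in> Hom C X Y" "sum f J \<in> Hom C X Y" using insert.prems assms(1-3) by (auto intro: Hom_sum)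
  then show ?case using insert assms(1-4) by (simp add: Cmp_add_right)
qed

section \<open>Monomorphisms, epimorphisms, kernels and cokernels\<close>

lemma is_monoI:
  assumes "X \<in> Obj C" "Y \<in> Obj C" "f \<in> Hom C X Y"
    and "\<And>W g. \<lbrakk>W \<in> Obj C; g \<in> Hom C W X; Cmp C W X Y f g = 0\<rbrakk> \<Longrightarrow> g = 0"
  shows "is_mono C X Y f"
  unfolding is_mono_def
proof (intro conjI assms(1-3) ballI impI)
  fix W g h assume "W \<in> Obj C" "g \<in> Hom C W X" "h \<in> Hom C W X" "Cmp C W X Y f g = Cmp C W X Y f h"
  then have "g - h = 0"
    using assms(1-3) by (intro assms(4)[of W "g - h"]) (simp_all add: Hom_diff Cmp_diff_right)
  then show "g = h" by simp
qed

lemma is_mono_zero: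
  assumes "is_mono C X Y f" "W \<in> Obj C" "g \<in> Hom C W X" "Cmp C W X Y f g = 0"
  shows "g = 0"
proof -
  have "Cmp C W X Y f 0 = 0" using assms unfolding is_mono_def by (simp add: Cmp_zero_right)
  then show ?thesis using assms unfolding is_mono_def by (metis Hom_zero)
qed

lemma is_epi_zero:
  assumes "is_epi C X Y f" "W \<in> Obj C" "g \<in> Hom C Y W" "Cmp C X Y W g f = 0"
  shows "g = 0"
proof -
  have "Cmp C X Y W 0 f = 0" using assms unfolding is_epi_def by (simp add: Cmp_zero_left)
  then show ?thesis using assms unfolding is_epi_def by (metis Hom_zero)
qed

lemma is_epiI:
  assumes "X \<in> Obj C" "Y \<in> Obj C" "f \<in> Hom C X Y"
    and "\<And>W g. \<lbrakk>W \<in> Obj C; g \<in> Hom C Y W; Cmp C X Y W g f = 0\<rbrakk> \<Longrightarrow> g = 0"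
  shows "is_epi C X Y f"
  unfolding is_epi_def
proof (intro conjI assms(1-3) ballI impI)
  fix W g h assume "W \<in> Obj C" "g \<in> Hom C Y W" "h \<in> Hom C Y W" "Cmp C X Y W g f = Cmp C X Y W h f"
  then have "g - h = 0"
    using assms(1-3) by (intro assms(4)[of W "g - h"]) (simp_all add: Hom_diff Cmp_diff_left)
  then show "g = h" by simp
qed

lemma kernel_is_mono:
  assumes "is_kernel C X Y f K i"
  shows "is_mono C K X i"
proof (rule is_monoI)
  fix W g assume W: "W \<in> Obj C" "g \<in> Hom C W K" "Cmp C W K X i g = 0"
  have "Cmp C W X Y f 0 = 0" "0 \<in> Hom C W X" "0 \<in> Hom C W K" "Cmp C W K X i 0 = 0"
    using assms W unfolding is_kernel_def by (simp_all add: Hom_zero Cmp_zero_right)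
  then show "g = 0" using assms W unfolding is_kernel_def by metis
qed (use assms in \<open>auto simp: is_kernel_def\<close>)

lemma kernel_lift:
  assumes "is_kernel C X Y f K i" "W \<in> Obj C" "g \<in> Hom C W X" "Cmp C W X Y f g = 0"
  obtains h where "h \<in> Hom C W K" "Cmp C W K X i h = g"
  using assms unfolding is_kernel_def by blast

lemma cokernel_is_epi:
  assumes "is_cokernel C X Y f Q p"
  shows "is_epi C Y Q p"
proof (rule is_epiI)
  fix W g assume W: "W \<in> Obj C" "g \<in> Hom C Q W" "Cmp C Y Q W g p = 0"
  have "Cmp C X Y W 0 f = 0" "0 \<in> Hom C Y W" "0 \<in> Hom C Q W" "Cmp C Y Q W 0 p = 0"
    using assms W unfolding is_cokernel_def by (simp_all add: Hom_zero Cmp_zero_left)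
  then show "g = 0" using assms W unfolding is_cokernel_def by metis
qed (use assms in \<open>auto simp: is_cokernel_def\<close>)

lemma cokernel_desc:
  assumes "is_cokernel C X Y f Q p" "W \<in> Obj C" "g \<in> Hom C Y W" "Cmp C X Y W g f = 0"
  obtains h where "h \<in> Hom C Q W" "Cmp C Y Q W h p = g"
  using assms unfolding is_cokernel_def by blast

lemma zero_objectI:
  assumes "X \<in> Obj C" "Idn C X = 0"
  shows "zero_object C X"
  unfolding zero_object_def
proof (intro conjI assms(1) ballI)
  fix Y assume Y: "Y \<in> Obj C"
  show "Hom C Y X = {0}"
    using Cmp_Idn_left[OF Y assms(1)] Cmp_zero_left[OF Y assms(1) assms(1)] Hom_zero[OF Y assms(1)]
    unfolding assms(2) by force
  show "Hom C X Y = {0}"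
    using Cmp_Idn_right[OF assms(1) Y] Cmp_zero_right[OF assms(1) assms(1) Y] Hom_zero[OF assms(1) Y]
    unfolding assms(2) by force
qed

lemma injective_extend:
  assumes "injective C E" "is_mono C X Y m" "f \<in> Hom C X E"
  obtains g where "g \<in> Hom C Y E" "Cmp C X Y E g m = f"
  using assms unfolding injective_def by blast

text \<open>Puts stalk complexes, which are zero objects away from degree 0, among the complexes of
  injectives.\<close>

lemma injective_zero_object: "zero_object C Z \<Longrightarrow> injective C Z"
  unfolding injective_def
proof (intro conjI allI impI)
  fix X Y m f
  assume Z: "zero_object C Z" and m: "is_mono C X Y m" and f: "f \<in> Hom C X Z"
  have O: "X \<in> Obj C" "Y \<in> Obj C" "Z \<in> Obj C" "m \<in> Hom C X Y" using Z m by
      (auto simp: zero_object_def is_mono_def)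
  then have "f = 0" using Z f by (auto simp: zero_object_def)
  then show "\<exists>g\<in>Hom C Y Z. Cmp C X Y Z g m = f"
    using O by (intro bexI[of _ 0]) (simp_all add: Cmp_zero_left Hom_zero)
qed (simp add: zero_object_def)

end

section \<open>Exactness and maps into injectives\<close>

context abelian_category
begin

text \<open>If \<open>m x = 0\<close>, then \<open>m\<close> factors through the cokernel
  \<open>r\<close> of \<open>x\<close>, so whatever \<open>r q\<close> kills lies in the kernel of
  \<open>g\<close> and is killed by \<open>q\<close>. As the epimorphism \<open>r q\<close> is a
  cokernel, \<open>q\<close> factors through it; this splits \<open>r\<close> and forces
  \<open>x = 0\<close>.\<close>

lemma coimage_is_mono:
  assumes k: "is_kernel C Y Z g K i" and c: "is_cokernel C K Y i Q q"
    and m: "m \<in> Hom C Q Z" "Cmp C Y Q Z m q = g"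
  shows "is_mono C Q Z m"
proof (rule is_monoI)
  have O: "Y \<in> Obj C" "Z \<in> Obj C" "K \<in> Obj C" "Q \<in> Obj C"
    and h: "g \<in> Hom C Y Z" "i \<in> Hom C K Y" "q \<in> Hom C Y Q" "Cmp C K Y Q q i = 0"
    using k c by (auto simp: is_kernel_def is_cokernel_def)
  then show "Q \<in> Obj C" "Z \<in> Obj C" "m \<in> Hom C Q Z" using m by simp_all
  fix W x assume x: "W \<in> Obj C" "x \<in> Hom C W Q" "Cmp C W Q Z m x = 0"
  obtain D r where r: "is_cokernel C W Q x D r" using ex_cokernel x O by blast
  then have D: "D \<in> Obj C" "r \<in> Hom C Q D" "Cmp C W Q D r x = 0" by (auto simp: is_cokernel_def)
  obtain m' where m': "m' \<in> Hom C D Z" "Cmp C Q D Z m' r = m"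
    using cokernel_desc[OF r] O m x by metis
  have "is_epi C Y D (Cmp C Y Q D r q)"
  proof (rule is_epiI)
    fix V y assume y: "V \<in> Obj C" "y \<in> Hom C D V" "Cmp C Y D V y (Cmp C Y Q D r q) = 0"
    then have "Cmp C Y Q V (Cmp C Q D V y r) q = 0" using O D h by (simp add: Cmp_assoc)
    then have "Cmp C Q D V y r = 0" 
      using is_epi_zero[OF cokernel_is_epi[OF c]] y O D by (meson Cmp_in)
    then show "y = 0" using is_epi_zero[OF cokernel_is_epi[OF r]] y by blast
  qed (use O D h in \<open>simp_all add: Cmp_in\<close>)
  then obtain V s where s: "is_cokernel C V Y s D (Cmp C Y Q D r q)" using epi_is_cokernel by blast
  then have V: "V \<in> Obj C" "s \<in> Hom C V Y" "Cmp C V Y D (Cmp C Y Q D r q) s = 0" by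
      (auto simp: is_cokernel_def)
  have "Cmp C V Y Z g s = Cmp C V D Z m' (Cmp C V Y D (Cmp C Y Q D r q) s)"
    using O D h V m m' by (metis Cmp_assoc Cmp_in)
  also have "\<dots> = 0" using V m' D O by (simp add: Cmp_zero_right)
  finally obtain s' where s': "s' \<in> Hom C V K" "Cmp C V K Y i s' = s" using kernel_lift[OF k] V by metis
  have "Cmp C V Y Q q s = Cmp C V K Q (Cmp C K Y Q q i) s'" using O h V s' by (metis Cmp_assoc)
  then have "Cmp C V Y Q q s = 0" using O h V s' by (simp add: Cmp_zero_left)
  then obtain t where t: "t \<in> Hom C D Q" "Cmp C Y D Q t (Cmp C Y Q D r q) = q"
    using cokernel_desc[OF s] O h by metis
  have "Cmp C Y Q Q (Cmp C Q D Q t r) q = Cmp C Y Q Q (Idn C Q) q"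
    using O D h t by (simp add: Cmp_assoc Cmp_Idn_left)
  then have tr: "Cmp C Q D Q t r = Idn C Q"
    using cokernel_is_epi[OF c] O D t unfolding is_epi_def by (meson Cmp_in Idn_in)
  have "x = Cmp C W Q Q (Cmp C Q D Q t r) x" using tr x O by (simp add: Cmp_Idn_left)
  also have "\<dots> = Cmp C W D Q t (Cmp C W Q D r x)" using O D x t by (simp add: Cmp_assoc)
  also have "\<dots> = 0" using D x O t by (simp add: Cmp_zero_right)
  finally show "x = 0" .
qed

text \<open>Maps into an injective are exact: as \<open>H\<close> is zero, \<open>u\<close> vanishes
  on the kernel of \<open>g\<close>, descends to the coimage, and extends from there because the
  coimage embeds in \<open>Z\<close>.\<close>

lemma exact_extend:
  assumes v: "is_cohomology C X Y Z f g K i H p" "zero_object C H" 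
    and O: "X \<in> Obj C" "f \<in> Hom C X Y"
    and E: "injective C E" and u: "u \<in> Hom C Y E" "Cmp C X Y E u f = 0"
  obtains w where "w \<in> Hom C Z E" "Cmp C Y Z E w g = u"
proof -
  have k: "is_kernel C Y Z g K i" using v by (simp add: is_cohomology_def)
  obtain e where e: "e \<in> Hom C X K" "Cmp C X K Y i e = f" "is_cokernel C X K e H p"
    using v by (auto simp: is_cohomology_def)
  have O: "X \<in> Obj C" "Y \<in> Obj C" "Z \<in> Obj C" "K \<in> Obj C" "H \<in> Obj C" "E \<in> Obj C"
    and h: "g \<in> Hom C Y Z" "i \<in> Hom C K Y" "p \<in> Hom C K H" "Cmp C K Y Z g i = 0"
    using k e E O by (auto simp: is_kernel_def is_cokernel_def injective_def)
  have "Cmp C X K E (Cmp C K Y E u i) e = 0" using O h u e by (simp add: Cmp_assoc)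
  then obtain t where t: "t \<in> Hom C H E" "Cmp C K H E t p = Cmp C K Y E u i"
    using cokernel_desc[OF e(3)] O h u Cmp_in by metis
  have "t = 0" using t v(2) O by (auto simp: zero_object_def)
  then have ui: "Cmp C K Y E u i = 0" using t O h by (simp add: Cmp_zero_left)
  obtain Q q where q: "is_cokernel C K Y i Q q" using ex_cokernel O h by blast
  then have Q: "Q \<in> Obj C" "q \<in> Hom C Y Q" by (auto simp: is_cokernel_def)
  obtain m where m: "m \<in> Hom C Q Z" "Cmp C Y Q Z m q = g" using cokernel_desc[OF q] O h by metis
  obtain u' where u': "u' \<in> Hom C Q E" "Cmp C Y Q E u' q = u" using cokernel_desc[OF q] O u ui by metis
  obtain w where w: "w \<in> Hom C Z E" "Cmp C Q Z E w m = u'"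
    using injective_extend[OF E coimage_is_mono[OF k q m]] u' by metis
  have "Cmp C Y Z E w g = u" using O Q m w u' by (metis Cmp_assoc)
  then show thesis using that w by blast
qed

text \<open>Converse of \<open>exact_extend\<close>. Embedding the cohomology \<open>H\<close> into
  a member of \<open>S\<close> yields a map \<open>u\<close> on \<open>Y\<close> that kills
  \<open>f\<close>; written as \<open>w g\<close> it vanishes on the kernel of \<open>g\<close>, so
  \<open>p = 0\<close>. A family \<open>S\<close> is allowed because in the deformation it will
  consist of the objects \<open>Go E\<close>.\<close>

lemma exactI:
  assumes O: "X \<in> Obj C" "Y \<in> Obj C" "Z \<in> Obj C" and f: "f \<in> Hom C X Y" "g \<in> Hom C Y Z" "Cmp C X Y Z
      g f = 0"
    and emb: "\<And>X. X \<in> Obj C \<Longrightarrow> \<exists>E\<in>S. \<exists>m. is_mono C X E m"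
    and inj: "\<And>E. E \<in> S \<Longrightarrow> injective C E"
    and ext: "\<And>E u. \<lbrakk>E \<in> S; u \<in> Hom C Y E; Cmp C X Y E u f = 0\<rbrakk> \<Longrightarrow> \<exists>w\<in>Hom C Z E. Cmp C Y Z E w g = u"
  shows "\<exists>K i H p. is_cohomology C X Y Z f g K i H p \<and> zero_object C H"
proof -
  obtain K i where k: "is_kernel C Y Z g K i" using ex_kernel O f by blast
  then have K: "K \<in> Obj C" "i \<in> Hom C K Y" "Cmp C K Y Z g i = 0" by (auto simp: is_kernel_def)
  obtain e where e: "e \<in> Hom C X K" "Cmp C X K Y i e = f" using kernel_lift[OF k] O f by metis
  obtain H p where p: "is_cokernel C X K e H p" using ex_cokernel O K e by blast
  then have H: "H \<in> Obj C" "p \<in> Hom C K H" "Cmp C X K H p e = 0" by (auto simp: is_cokernel_def)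
  obtain E m where E: "E \<in> S" "is_mono C H E m" using emb H by blast
  then have E': "E \<in> Obj C" "m \<in> Hom C H E" by (auto simp: is_mono_def)
  obtain u where u: "u \<in> Hom C Y E" "Cmp C K Y E u i = Cmp C K H E m p"
    using injective_extend[OF inj[OF E(1)] kernel_is_mono[OF k]] K H E' by (metis Cmp_in)
  have "Cmp C X Y E u f = Cmp C X K E (Cmp C K Y E u i) e" using O K u e E' by (metis Cmp_assoc)
  also have "\<dots> = Cmp C X H E m (Cmp C X K H p e)" using O K e E' H u by (simp add: Cmp_assoc)
  also have "\<dots> = 0" using O H E' by (simp add: Cmp_zero_right)
  finally obtain w where w: "w \<in> Hom C Z E" "Cmp C Y Z E w g = u" using ext E u by blast
  have "Cmp C K H E m p = Cmp C K Z E w (Cmp C K Y Z g i)" using O K u w E' f by (metis Cmp_assoc)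
  also have "\<dots> = 0" using O K E' w by (simp add: Cmp_zero_right)
  finally have "p = 0" using is_mono_zero[OF E(2)] K H by blast
  then have "Cmp C K H H (Idn C H) p = 0" using H K by (simp add: Cmp_Idn_left)
  then have "Idn C H = 0" using is_epi_zero[OF cokernel_is_epi[OF p]] H Idn_in by blast
  then show ?thesis using zero_objectI H k e p unfolding is_cohomology_def by blast
qed

end

section \<open>Braces with a dg structure\<close>

lemma sgn_act_zero [simp]: "sgn_act n 0 = 0"
  by (simp add: sgn_act_def)

lemma sgn_act_odd: "odd n \<Longrightarrow> sgn_act n v = - v"
  by (simp add: sgn_act_def)

lemma sgn_act_apply: "sgn_act n f i = sgn_act n (f i)"
  by (simp add: sgn_act_def)

lemma shifted_deg_simps [simp]:
  "shifted_deg [] = 0" "shifted_deg (d # ds) = d - 1 + shifted_deg ds"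
  "shifted_deg (ds @ es) = shifted_deg ds + shifted_deg es"
  by (simp_all add: shifted_deg_def)

lemma shifted_deg_replicate [simp]: "shifted_deg (replicate n d) = int n * (d - 1)"
  by (simp add: shifted_deg_def sum_list_replicate)

lemma brace_arity_zero:
  "composable Q [X] [] [] \<Longrightarrow> brace Q q x y [X] [] [] = x [X, X] [q + 1] [y [X] [] []]"
  by (simp add: brace_def sgn_act_def)

text \<open>Inserting a value of arity \<open>l\<close> into \<open>n\<close> arguments leaves
  \<open>n - l + 1\<close> of them, so only \<open>l = n\<close> and \<open>l = n - 1\<close>
  survive, the latter in two positions. For \<open>n = 0\<close> truncated subtraction would merge
  terms; that case is \<open>brace_arity_zero\<close>.\<close>

lemma brace_outer_binary:
  fixes x :: "('o, 'm::ab_group_add) cochain"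
  assumes comp: "composable Q As ds fs" and ne: "fs \<noteq> []"
    and x: "\<And>As ds fs. length fs \<noteq> 1 \<Longrightarrow> length fs \<noteq> 2 \<Longrightarrow> x As ds fs = 0"
  shows "brace Q q x y As ds fs =
    x [hd As, last As] [q + 1 + shifted_deg ds] [y As ds fs]
    + x [hd As, As ! (length fs - 1), last As] [q + 1 + shifted_deg (butlast ds), last ds]
        [y (butlast As) (butlast ds) (butlast fs), last fs]
    + sgn_act (q * (hd ds - 1))
        (x [hd As, As ! 1, last As] [hd ds, q + 1 + shifted_deg (tl ds)]
          [hd fs, y (tl As) (tl ds) (tl fs)])"
proof -
  define n where "n = length fs"
  have L: "length As = Suc n" "length ds = n" "length fs = n" "n \<noteq> 0"
    using comp ne by (auto simp: composable_def n_def)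
  define T where "T i l = sgn_act (q * shifted_deg (take i ds))
            (x (take (Suc i) As @ drop (i + l) As)
               (take i ds @ [q + 1 + shifted_deg (take l (drop i ds))] @ drop (i + l) ds)
               (take i fs @ [y (take (Suc l) (drop i As)) (take l (drop i ds)) (take l (drop i fs))]
                 @ drop (i + l) fs))" for i l
  have "brace Q q x y As ds fs = (\<Sum>i\<in>{..n}. \<Sum>l\<in>{..n - i}. T i l)"
    using comp by (simp add: brace_def T_def n_def)
  also have "\<dots> = (\<Sum>(i, l)\<in>Sigma {..n} (\<lambda>i. {..n - i}). T i l)"
    by (simp add: sum.Sigma)
  also have "\<dots> = (\<Sum>(i, l)\<in>{(0, n), (0, n - 1), (1, n - 1)}. T i l)"
  proof (rule sum.mono_neutral_right)
    show "\<forall>p\<in>Sigma {..n} (\<lambda>i. {..n - i}) - {(0, n), (0, n - 1), (1, n - 1)}.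
        (case p of (i, l) \<Rightarrow> T i l) = 0"
    proof
      fix p assume p: "p \<in> Sigma {..n} (\<lambda>i. {..n - i}) - {(0, n), (0, n - 1), (1, n - 1)}"
      obtain i l where il: "p = (i, l)" by fastforce
      then have A: "(i, l) \<notin> {(0, n), (0, n - 1), (1, n - 1)}" "i \<in> {..n}" "l \<in> {..n - i}"
        using p by simp_all
      then have *: "length (take i fs @ [y (take (Suc l) (drop i As)) (take l (drop i ds))
          (take l (drop i fs))] @ drop (i + l) fs) \<noteq> 1"
        "length (take i fs @ [y (take (Suc l) (drop i As)) (take l (drop i ds))
            (take l (drop i fs))] @ drop (i + l) fs) \<noteq> 2"
        using L by auto
      show "(case p of (i, l) \<Rightarrow> T i l) = 0" unfolding il prod.case T_def x[OF *] by simp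
    qed
  qed (use L in auto)
  also have "\<dots> = T 0 n + T 0 (n - 1) + T 1 (n - 1)"
    using L by (simp add: add.assoc)
  also have "T 0 n = x [hd As, last As] [q + 1 + shifted_deg ds] [y As ds fs]"
  proof -
    have "take (Suc 0) As @ drop n As = [hd As, last As]"
      using L by (cases As) (auto simp: last_conv_nth Cons_nth_drop_Suc[symmetric] drop_Cons'
          hd_conv_nth)
    then show ?thesis using L by (simp add: T_def sgn_act_def)
  qed
  also have "T 0 (n - 1) = x [hd As, As ! (length fs - 1), last As]
      [q + 1 + shifted_deg (butlast ds), last ds]
        [y (butlast As) (butlast ds) (butlast fs), last fs]"
  proof -
    have "drop (n - 1) As = [As ! (n - 1), As ! n]" using L
      by (metis Cons_nth_drop_Suc Suc_pred' drop_all lessI less_Suc_eq_le less_or_eq_imp_le not_gr_zero)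
    then have "take (Suc 0) As @ drop (n - 1) As = [hd As, As ! (n - 1), last As]"
      using L by (cases As) (auto simp: last_conv_nth)
    moreover have "drop (n - 1) ds = [last ds]" "drop (n - 1) fs = [last fs]"
      using L by (metis append_butlast_last_id append_eq_conv_conj length_butlast list.size(3))+
    ultimately show ?thesis using L by (simp add: T_def sgn_act_def butlast_conv_take)
  qed
  also have "T 1 (n - 1) = sgn_act (q * (hd ds - 1))
        (x [hd As, As ! 1, last As] [hd ds, q + 1 + shifted_deg (tl ds)]
          [hd fs, y (tl As) (tl ds) (tl fs)])"
  proof -
    have "take (Suc 1) As @ drop n As = [hd As, As ! 1, last As]"
      using L by (cases As; cases "tl As") (auto simp: last_conv_nth Cons_nth_drop_Suc[symmetric]
          drop_Cons' hd_conv_nth)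
    moreover have "take 1 ds = [hd ds]" "take 1 fs = [hd fs]"
      using L by (cases ds; cases fs; simp)+
    ultimately show ?thesis using L by (simp add: T_def drop_Suc)
  qed
  finally show ?thesis .
qed

text \<open>Shaped for towers: the inner cochain vanishes on every run of arguments that avoids the
  last one, so it survives only on the last argument and on the last pair.\<close>

lemma brace_inner_binary:
  fixes x :: "('o, 'm::ab_group_add) cochain"
  assumes comp: "composable Q As ds fs" and n: "length fs = Suc n"
    and y: "\<And>As ds fs. length fs \<noteq> 1 \<Longrightarrow> length fs \<noteq> 2 \<Longrightarrow> y As ds fs = 0"
    and x: "\<And>As ds fs. 0 \<in> set fs \<Longrightarrow> x As ds fs = 0"
    and y1: "\<And>i. i < n \<Longrightarrow> y [As ! i, As ! Suc i] [ds ! i] [fs ! i] = 0"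
    and y2: "\<And>i. Suc i < n \<Longrightarrow> y [As ! i, As ! Suc i, As ! Suc (Suc i)] [ds ! i, ds ! Suc i]
        [fs ! i, fs ! Suc i] = 0"
  shows "brace Q q x y As ds fs =
    sgn_act (q * shifted_deg (take n ds))
      (x As (take n ds @ [q + ds ! n]) (take n fs @ [y [As ! n, As ! Suc n] [ds ! n] [fs ! n]]))
    + (if n = 0 then 0 else sgn_act (q * shifted_deg (take (n - 1) ds))
      (x (take n As @ [As ! Suc n]) (take (n - 1) ds @ [q + ds ! (n - 1) + ds ! n - 1])
        (take (n - 1) fs @ [y [As ! (n - 1), As ! n, As ! Suc n] [ds ! (n - 1), ds ! n]
            [fs ! (n - 1), fs ! n]])))"
proof -
  have L: "length As = Suc (Suc n)" "length ds = Suc n" "length fs = Suc n"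
    using comp n by (auto simp: composable_def)
  define T where "T i l = sgn_act (q * shifted_deg (take i ds))
            (x (take (Suc i) As @ drop (i + l) As)
               (take i ds @ [q + 1 + shifted_deg (take l (drop i ds))] @ drop (i + l) ds)
               (take i fs @ [y (take (Suc l) (drop i As)) (take l (drop i ds)) (take l (drop i fs))]
                 @ drop (i + l) fs))" for i l
  have tk1: "take 1 (drop i zs) = [zs ! i]" if "i < length zs" for i and zs :: "'z list"
    using that by (simp add: Cons_nth_drop_Suc[symmetric])
  have tk2: "take 2 (drop i zs) = [zs ! i, zs ! Suc i]" if "Suc i < length zs" for i and zs :: "'z list"
    using that by (simp add: Cons_nth_drop_Suc[symmetric])
  have tk3: "take 3 (drop i zs) = [zs ! i, zs ! Suc i, zs ! Suc (Suc i)]" if "Suc (Suc i) < length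
      zs" for i and zs :: "'z list"
    using that by (simp add: Cons_nth_drop_Suc[symmetric])
  let ?S = "insert (n, 1) (if n = 0 then {} else {(n - 1, 2)})"
  have "brace Q q x y As ds fs = (\<Sum>i\<in>{..Suc n}. \<Sum>l\<in>{..Suc n - i}. T i l)"
    using comp n unfolding brace_def T_def by (simp only: if_True)
  also have "\<dots> = (\<Sum>(i, l)\<in>Sigma {..Suc n} (\<lambda>i. {..Suc n - i}). T i l)"
    by (rule sum.Sigma) auto
  also have "\<dots> = (\<Sum>(i, l)\<in>?S. T i l)"
  proof (rule sum.mono_neutral_right)
    show "\<forall>p\<in>Sigma {..Suc n} (\<lambda>i. {..Suc n - i}) - ?S. (case p of (i, l) \<Rightarrow> T i l) = 0"
    proof
      fix p assume p: "p \<in> Sigma {..Suc n} (\<lambda>i. {..Suc n - i}) - ?S"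
      obtain i l where il: "p = (i, l)" by fastforce
      then have A: "(i, l) \<notin> ?S" "i \<in> {..Suc n}" "l \<in> {..Suc n - i}"
        using p by simp_all
      have "y (take (Suc l) (drop i As)) (take l (drop i ds)) (take l (drop i fs)) = 0"
      proof (cases "l = 1 \<or> l = 2")
        case False
        then show ?thesis using A L by (intro y) auto
      next
        case True
        then consider "l = 1" "i < n" | "l = 2" "Suc i < n"
          using A by (fastforce split: if_splits)
        then show ?thesis
        proof cases
          case 1
          then have "Suc l = 2" by simp
          then show ?thesis using 1 L by (simp only: tk1 tk2 y1)
        next
          case 2
          then have "Suc l = 3" by simp
          then show ?thesis using 2 L by (simp only: tk2 tk3 y2)
        qed
      qed
      then show "(case p of (i, l) \<Rightarrow> T i l) = 0" unfolding il prod.case T_def by (simp add: x)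
    qed
  qed auto
  also have "\<dots> = T n 1 + (if n = 0 then 0 else T (n - 1) 2)"
    by simp
  also have "T n 1 = sgn_act (q * shifted_deg (take n ds))
      (x As (take n ds @ [q + ds ! n]) (take n fs @ [y [As ! n, As ! Suc n] [ds ! n] [fs ! n]]))"
  proof -
    have "Suc 1 = 2" "take (Suc n) As @ drop (n + 1) As = As"
      using append_take_drop_id[of "n + 1" As] by simp_all
    then show ?thesis
      unfolding T_def using L tk1[of n ds] tk1[of n fs] tk2[of n As] by (simp del: One_nat_def)
  qed
  also have "(if n = 0 then 0 else T (n - 1) 2) =
      (if n = 0 then 0 else sgn_act (q * shifted_deg (take (n - 1) ds))
      (x (take n As @ [As ! Suc n]) (take (n - 1) ds @ [q + ds ! (n - 1) + ds ! n - 1])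
        (take (n - 1) fs @ [y [As ! (n - 1), As ! n, As ! Suc n] [ds ! (n - 1), ds ! n]
            [fs ! (n - 1), fs ! n]])))"
  proof (cases n)
    case (Suc m)
    have "Suc 2 = 3" by simp
    moreover have "drop (Suc n) As = [As ! Suc n]" using L by (simp add: Cons_nth_drop_Suc[symmetric])
    ultimately show ?thesis
      unfolding T_def using Suc L tk2[of m ds] tk2[of m fs] tk3[of m As] by (simp add: algebra_simps)
  qed simp
  finally show ?thesis .
qed

section \<open>Multilinearity of cochains and the values of the dg structure\<close>

lemma C_br_linear:
  "\<lbrakk>x \<in> C_br Q p; j < length fs; composable Q As ds (fs[j := f]); composable Q As ds (fs[j := g])\<rbrakk>
    \<Longrightarrow> x As ds (fs[j := qscale Q a f + g]) = qscale Q a (x As ds (fs[j := f])) + x As ds (fs[j := g])"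
  by (simp add: C_br_def)

text \<open>A quiver record carries no module axioms; additivity is extracted from linearity at a
  scalar \<open>a\<close> known to act as the identity.\<close>

lemma C_br_zero:
  assumes x: "x \<in> C_br Q p" and lin: "\<And>v. qscale Q a v = v"
    and 0: "0 \<in> set fs"
  shows "x As ds fs = 0"
proof (cases "composable Q As ds fs")
  case True
  obtain j where j: "j < length fs" "fs ! j = 0" using 0 by (auto simp: in_set_conv_nth)
  then have u: "fs[j := 0] = fs" by (metis list_update_id)
  have "x As ds (fs[j := qscale Q a 0 + 0]) = qscale Q a (x As ds (fs[j := 0])) + x As ds (fs[j := 0])"
    using x j True u by (intro C_br_linear) simp_all
  then show ?thesis by (simp add: lin u)
next
  case False
  then show ?thesis using x by (auto simp: C_br_def)
qed

lemma C_br_uminus: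
  assumes x: "x \<in> C_br Q p" and lin: "\<And>v. qscale Q a v = v"
    and j: "j < length fs" and c: "composable Q As ds fs" "composable Q As ds (fs[j := - (fs ! j)])"
  shows "x As ds (fs[j := - (fs ! j)]) = - x As ds fs"
proof -
  have "x As ds (fs[j := qscale Q a (fs ! j) + - (fs ! j)]) =
      qscale Q a (x As ds (fs[j := fs ! j])) + x As ds (fs[j := - (fs ! j)])"
    using x j c by (intro C_br_linear) simp_all
  moreover have "x As ds (fs[j := 0]) = 0"
    by (rule C_br_zero[OF x lin]) (use j in \<open>auto simp: lin set_update_memI\<close>)
  ultimately show ?thesis by (simp add: lin eq_neg_iff_add_eq_0 add.commute)
qed

lemma C_br_mem:
  "x \<in> C_br Q p \<Longrightarrow> composable Q As ds fs \<Longrightarrow>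
    x As ds fs \<in> qhom Q (last As) (hd As) (p + 1 + shifted_deg ds)"
  by (simp add: C_br_def)

lemma dg_structure_local:
  "length fs \<noteq> 1 \<Longrightarrow> length fs \<noteq> 2 \<Longrightarrow> dg_structure D As ds fs = 0"
  by (cases fs rule: remdups_adj.cases)
    (auto simp: dg_structure_def to_br_def arity1_def arity2_def sgn_act_def Let_def split: list.splits)

lemma dg_structure_unary:
  "composable D [Y, X] [p] [f] \<Longrightarrow> dg_structure D [Y, X] [p] [f] = - ddiff D X Y p f"
  by (simp add: dg_structure_def to_br_def arity1_def arity2_def sgn_act_def)

lemma dg_structure_binary:
  "composable D [Z, Y, X] [p, q] [g, f]
    \<Longrightarrow> dg_structure D [Z, Y, X] [p, q] [g, f] = sgn_act p (dcomp D X Y Z p q g f)"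
  by (simp add: dg_structure_def to_br_def arity1_def arity2_def numeral_2_eq_2)

text \<open>Only \<open>b\<close> applied to the arity zero value remains: the other brace inserts
  the arity zero component of \<open>b\<close>, which is 0. The sign is the one of \<open>b\<close>
  in arity 1.\<close>

lemma hoch_diff_arity_zero:
  assumes "\<And>As ds fs. 0 \<in> set fs \<Longrightarrow> x As ds fs = 0" and X: "X \<in> qobj D"
    and x: "x [X] [] [] \<in> qhom D X X n"
  shows "hoch_diff D n x [X] [] [] = - ddiff D X X n (x [X] [] [])"
proof -
  have c: "composable D [X] [] []" "composable D [X, X] [n] [x [X] [] []]"
    using X x by (simp_all add: composable_def)
  then show ?thesis
    by (simp add: hoch_diff_def br_bracket_def brace_arity_zero dg_structure_unary
        dg_structure_local assms(1))
qed

lemma HZ_2_eq: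
  "x \<in> HZ D 2 \<Longrightarrow> brace D 1 (dg_structure D) x As ds fs + brace D 1 x (dg_structure D) As ds fs = 0"
  by (auto simp: HZ_def hoch_diff_def br_bracket_def sgn_act_def fun_eq_iff)

section \<open>Graded maps between complexes\<close>

lemma Db_dg_simps:
  "qobj (Db_dg C) = Db_objects C"
  "f \<in> qhom (Db_dg C) M N p \<longleftrightarrow> (\<forall>i. f i \<in> Hom C (fst M i) (fst N (i + p)))"
  "qscale (Db_dg C) a f = (\<lambda>i. Scale C a (f i))"
  by (simp_all add: Db_dg_def)

lemma dcomp_Db_dg:
  "dcomp (Db_dg C) L M N p q g f i =
    Cmp C (fst L i) (fst M (i + q)) (fst N (i + q + p)) (g (i + q)) (f i)"
  by (simp add: Db_dg_def componentwise_def)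

lemma ddiff_Db_dg:
  "ddiff (Db_dg C) M N p f i =
    Cmp C (fst M i) (fst N (i + p)) (fst N (i + p + 1)) (snd N (i + p)) (f i)
    - sgn_act p (Cmp C (fst M i) (fst M (i + 1)) (fst N (i + 1 + p)) (f (i + 1)) (snd M i))"
  by (simp add: Db_dg_def componentwise_def sgn_act_apply)

lemma Db_objectsD:
  assumes "M \<in> Db_objects C"
  shows "fst M i \<in> Obj C" "snd M i \<in> Hom C (fst M i) (fst M (i + 1))" "injective C (fst M i)"
    "Cmp C (fst M i) (fst M (i + 1)) (fst M (i + 2)) (snd M (i + 1)) (snd M i) = 0"
  using assms by (auto simp: Db_objects_def is_complex_def)

context linear_category
begin

lemma Db_scale_one: "qscale (Db_dg C) 1 v = v"
  by (simp add: Db_dg_simps)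

lemma Db_ddiff_closed:
  assumes "M \<in> Db_objects C" "N \<in> Db_objects C" "f \<in> qhom (Db_dg C) M N p"
  shows "ddiff (Db_dg C) M N p f \<in> qhom (Db_dg C) M N (p + 1)"
  unfolding Db_dg_simps
proof
  fix i
  have f: "f j \<in> Hom C (fst M j) (fst N (j + p))" for j using assms(3) by (simp add: Db_dg_simps)
  note O = Db_objectsD[OF assms(1)] Db_objectsD[OF assms(2)]
  have "Cmp C (fst M i) (fst N (i + p)) (fst N (i + p + 1)) (snd N (i + p)) (f i) \<in> Hom C (fst M i)
      (fst N (i + p + 1))"
    using O f by (intro Cmp_in)
  moreover have "Cmp C (fst M i) (fst M (i + 1)) (fst N (i + 1 + p)) (f (i + 1)) (snd M i) \<in> Hom C
      (fst M i) (fst N (i + 1 + p))"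
    using O f by (intro Cmp_in)
  moreover have e: "i + 1 + p = i + (p + 1)" "i + p + 1 = i + (p + 1)" by simp_all
  ultimately show "ddiff (Db_dg C) M N p f i \<in> Hom C (fst M i) (fst N (i + (p + 1)))"
    unfolding ddiff_Db_dg e using O by (intro Hom_diff Hom_sgn_act) simp_all
qed

lemma Db_dcomp_closed:
  assumes "L \<in> Db_objects C" "M \<in> Db_objects C" "N \<in> Db_objects C"
    "f \<in> qhom (Db_dg C) L M q" "g \<in> qhom (Db_dg C) M N p"
  shows "dcomp (Db_dg C) L M N p q g f \<in> qhom (Db_dg C) L N (q + p)"
  using assms by (auto simp: Db_dg_simps dcomp_Db_dg simp flip: add.assoc intro!: Cmp_in Db_objectsD(1))

lemma Db_ddiff_add:
  assumes "M \<in> Db_objects C" "N \<in> Db_objects C" "f \<in> qhom (Db_dg C) M N p" "g \<in> qhom (Db_dg C) M N p"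
  shows "ddiff (Db_dg C) M N p (f + g) = ddiff (Db_dg C) M N p f + ddiff (Db_dg C) M N p g"
proof
  fix i
  have f: "f j \<in> Hom C (fst M j) (fst N (j + p))" "g j \<in> Hom C (fst M j) (fst N (j + p))" for j
    using assms(3,4) by (simp_all add: Db_dg_simps)
  show "ddiff (Db_dg C) M N p (f + g) i = (ddiff (Db_dg C) M N p f + ddiff (Db_dg C) M N p g) i"
    using Db_objectsD[OF assms(1)] Db_objectsD[OF assms(2)] f
    by (simp add: ddiff_Db_dg Cmp_add_left Cmp_add_right sgn_act_def)
qed

lemma Db_qhom_closed:
  assumes "M \<in> Db_objects C" "N \<in> Db_objects C" "f \<in> qhom (Db_dg C) M N p" "g \<in> qhom (Db_dg C) M N p"
  shows "f + g \<in> qhom (Db_dg C) M N p" "- f \<in> qhom (Db_dg C) M N p" "f - g \<in> qhom (Db_dg C) M N p"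
  using assms by (auto simp: Db_dg_simps intro!: Hom_add Hom_uminus Hom_diff Db_objectsD(1))

lemma Db_zero_qhom: "M \<in> Db_objects C \<Longrightarrow> N \<in> Db_objects C \<Longrightarrow> 0 \<in> qhom (Db_dg C) M N p"
  by (auto simp: Db_dg_simps intro!: Hom_zero Db_objectsD(1))

lemma Db_ddiff_zero:
  assumes "M \<in> Db_objects C" "N \<in> Db_objects C"
  shows "ddiff (Db_dg C) M N p 0 = 0"
  using Db_ddiff_add[OF assms Db_zero_qhom[OF assms] Db_zero_qhom[OF assms], of p] by simp

lemma Db_ddiff_uminus:
  assumes "M \<in> Db_objects C" "N \<in> Db_objects C" "f \<in> qhom (Db_dg C) M N p"
  shows "ddiff (Db_dg C) M N p (- f) = - ddiff (Db_dg C) M N p f"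
  using Db_ddiff_add[OF assms(1,2,3), of "- f"] Db_qhom_closed[OF assms(1,2,3,3)]
  by (simp add: Db_ddiff_zero assms add_eq_0_iff)

lemma Db_coboundary_uminus:
  assumes "M \<in> Db_objects C" "N \<in> Db_objects C"
    and f: "f \<in> hom_coboundaries (Db_dg C) M N p"
  shows "- f \<in> hom_coboundaries (Db_dg C) M N p"
proof -
  obtain f' where *: "f' \<in> qhom (Db_dg C) M N (p - 1)" "f = ddiff (Db_dg C) M N (p - 1) f'"
    using f by (auto simp: hom_coboundaries_def)
  then show ?thesis
    unfolding hom_coboundaries_def using assms(1,2) Db_qhom_closed(2)[OF assms(1,2) *(1,1)]
    by (intro image_eqI[of _ _ "- f'"]) (simp_all add: Db_ddiff_uminus)
qed

lemma Db_coboundary_closed: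
  assumes "M \<in> Db_objects C" "N \<in> Db_objects C"
    and f: "f \<in> hom_coboundaries (Db_dg C) M N p" and g: "g \<in> hom_coboundaries (Db_dg C) M N p"
  shows "f + g \<in> hom_coboundaries (Db_dg C) M N p" "f - g \<in> hom_coboundaries (Db_dg C) M N p"
proof -
  obtain f' g' where *: "f' \<in> qhom (Db_dg C) M N (p - 1)" "g' \<in> qhom (Db_dg C) M N (p - 1)"
    "f = ddiff (Db_dg C) M N (p - 1) f'" "g = ddiff (Db_dg C) M N (p - 1) g'"
    using f g by (auto simp: hom_coboundaries_def)
  note c = Db_qhom_closed[OF assms(1,2) *(1,2)] Db_qhom_closed[OF assms(1,2) *(2,2)]
  show "f + g \<in> hom_coboundaries (Db_dg C) M N p"
    unfolding hom_coboundaries_def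
    by (rule image_eqI[of _ _ "f' + g'"]) (use * assms(1,2) c in \<open>simp_all add: Db_ddiff_add\<close>)
  have "ddiff (Db_dg C) M N (p - 1) (f' + - g') = f - g"
    using * assms(1,2) c by (subst Db_ddiff_add) (simp_all add: Db_ddiff_uminus)
  then show "f - g \<in> hom_coboundaries (Db_dg C) M N p"
    unfolding hom_coboundaries_def
    by (intro image_eqI[of _ _ "f' - g'"]) (use * c in simp_all)
qed

lemma Db_zero_coboundary:
  assumes "M \<in> Db_objects C" "N \<in> Db_objects C"
  shows "0 \<in> hom_coboundaries (Db_dg C) M N p"
  unfolding hom_coboundaries_def
  by (rule image_eqI[of _ _ 0]) (simp_all add: Db_ddiff_zero Db_zero_qhom assms)

text \<open>A class is the set of its representing cocycles, so the forward direction needs an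
  element of it: \<open>f\<close> itself. In the applications \<open>g\<close> is another cocycle,
  the obstruction cochain or 0.\<close>

lemma hom_class_eq_iff:
  assumes "M \<in> Db_objects C" "N \<in> Db_objects C" "f \<in> hom_cocycles (Db_dg C) M N p"
  shows "hom_class (Db_dg C) M N p f = hom_class (Db_dg C) M N p g
    \<longleftrightarrow> f - g \<in> hom_coboundaries (Db_dg C) M N p"
proof
  assume eq: "hom_class (Db_dg C) M N p f = hom_class (Db_dg C) M N p g"
  have "f \<in> hom_class (Db_dg C) M N p f"
    using assms(3) Db_zero_coboundary[OF assms(1,2), of p] by (simp add: hom_class_def)
  then have "f \<in> hom_class (Db_dg C) M N p g" by (simp only: eq)
  then show "f - g \<in> hom_coboundaries (Db_dg C) M N p" by (simp add: hom_class_def)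
next
  assume fg: "f - g \<in> hom_coboundaries (Db_dg C) M N p"
  have "h - f \<in> hom_coboundaries (Db_dg C) M N p \<longleftrightarrow> h - g \<in> hom_coboundaries (Db_dg C) M N p" for h
    using Db_coboundary_closed(1)[OF assms(1,2) _ fg, of "h - f"]
      Db_coboundary_closed(2)[OF assms(1,2) _ fg, of "h - g"] by auto
  then show "hom_class (Db_dg C) M N p f = hom_class (Db_dg C) M N p g"
    by (simp add: hom_class_def)
qed

lemma Db_leibniz:
  assumes O: "L \<in> Db_objects C" "M \<in> Db_objects C" "N \<in> Db_objects C"
    and f: "f \<in> qhom (Db_dg C) L M q" and g: "g \<in> qhom (Db_dg C) M N p"
  shows "ddiff (Db_dg C) L N (q + p) (dcomp (Db_dg C) L M N p q g f) =
    dcomp (Db_dg C) L M N (p + 1) q (ddiff (Db_dg C) M N p g) f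
    + sgn_act p (dcomp (Db_dg C) L M N p (q + 1) g (ddiff (Db_dg C) L M q f))"
proof
  fix i
  \<comment> \<open>Morphism modules depend on the index as it is written, so all positions are
    first brought to one normal form.\<close>
  have e: "i + (q + p) = i + q + p" "i + 1 + q = i + q + 1" "i + 1 + (q + p) = i + q + 1 + p"
    "i + (q + 1) = i + q + 1" "i + q + (p + 1) = i + q + p + 1" "i + q + p + 1 = i + q + 1 + p"
    by simp_all
  have f': "f i \<in> Hom C (fst L i) (fst M (i + q))" "f (i + 1) \<in> Hom C (fst L (i + 1))
      (fst M (i + q + 1))"
    using f e(2) by (simp add: Db_dg_simps, metis Db_dg_simps(2))
  have g': "g (i + q) \<in> Hom C (fst M (i + q)) (fst N (i + q + p))"
    "g (i + q + 1) \<in> Hom C (fst M (i + q + 1)) (fst N (i + q + 1 + p))"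
    using g by (simp_all add: Db_dg_simps)
  have d: "snd L i \<in> Hom C (fst L i) (fst L (i + 1))"
    "snd M (i + q) \<in> Hom C (fst M (i + q)) (fst M (i + q + 1))"
    "snd N (i + q + p) \<in> Hom C (fst N (i + q + p)) (fst N (i + q + 1 + p))"
    using Db_objectsD(2)[OF O(1), of i] Db_objectsD(2)[OF O(2), of "i + q"]
      Db_objectsD(2)[OF O(3), of "i + q + p"] unfolding e(6) by simp_all
  note Ob = Db_objectsD(1)[OF O(1)] Db_objectsD(1)[OF O(2)] Db_objectsD(1)[OF O(3)]
  show "ddiff (Db_dg C) L N (q + p) (dcomp (Db_dg C) L M N p q g f) i =
    (dcomp (Db_dg C) L M N (p + 1) q (ddiff (Db_dg C) M N p g) f
    + sgn_act p (dcomp (Db_dg C) L M N p (q + 1) g (ddiff (Db_dg C) L M q f))) i"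
    unfolding plus_fun_def sgn_act_apply ddiff_Db_dg dcomp_Db_dg e
    using Ob f' g' d
    by (simp add: Cmp_diff_left Cmp_diff_right Cmp_sgn_act_left Cmp_sgn_act_right Cmp_assoc Cmp_in
        Hom_sgn_act) (simp add: sgn_act_def)
qed

lemma Db_dcomp_assoc:
  assumes O: "K \<in> Db_objects C" "L \<in> Db_objects C" "M \<in> Db_objects C" "N \<in> Db_objects C"
    and f: "f \<in> qhom (Db_dg C) K L r" and g: "g \<in> qhom (Db_dg C) L M q" and h: "h \<in> qhom (Db_dg C) M
        N p"
  shows "dcomp (Db_dg C) K L N (q + p) r (dcomp (Db_dg C) L M N p q h g) f =
    dcomp (Db_dg C) K M N p (r + q) h (dcomp (Db_dg C) K L M q r g f)"
proof
  fix i
  have e: "i + r + (q + p) = i + r + q + p" "i + (r + q) = i + r + q" by simp_all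
  show "dcomp (Db_dg C) K L N (q + p) r (dcomp (Db_dg C) L M N p q h g) f i =
    dcomp (Db_dg C) K M N p (r + q) h (dcomp (Db_dg C) K L M q r g f) i"
    unfolding dcomp_Db_dg e
    using f g h O by (intro Cmp_assoc Db_objectsD(1)) (auto simp: Db_dg_simps)
qed

lemma Db_dcomp_coboundary_right:
  assumes O: "L \<in> Db_objects C" "M \<in> Db_objects C" "N \<in> Db_objects C"
    and f: "f \<in> hom_coboundaries (Db_dg C) L M q" and g: "g \<in> hom_cocycles (Db_dg C) M N 0"
  shows "dcomp (Db_dg C) L M N 0 q g f \<in> hom_coboundaries (Db_dg C) L N q"
proof -
  obtain u where u: "u \<in> qhom (Db_dg C) L M (q - 1)" "f = ddiff (Db_dg C) L M (q - 1) u"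
    using f by (auto simp: hom_coboundaries_def)
  have g': "g \<in> qhom (Db_dg C) M N 0" "ddiff (Db_dg C) M N 0 g = 0" using g by
      (auto simp: hom_cocycles_def)
  have "dcomp (Db_dg C) L M N 1 (q - 1) 0 u = 0"
    using u(1) O by (auto simp: fun_eq_iff dcomp_Db_dg Db_dg_simps intro!: Cmp_zero_left Db_objectsD(1))
  then have "ddiff (Db_dg C) L N (q - 1) (dcomp (Db_dg C) L M N 0 (q - 1) g u) = dcomp (Db_dg C) L M
      N 0 q g f"
    using Db_leibniz[OF O u(1) g'(1)] by (simp add: g' u(2) sgn_act_def)
  then show ?thesis
    using Db_dcomp_closed[OF O u(1) g'(1)] unfolding hom_coboundaries_def
    by (intro image_eqI[of _ _ "dcomp (Db_dg C) L M N 0 (q - 1) g u"]) simp_all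
qed

lemma Db_dcomp_coboundary_left:
  assumes O: "L \<in> Db_objects C" "M \<in> Db_objects C" "N \<in> Db_objects C"
    and g: "g \<in> hom_coboundaries (Db_dg C) M N p" and f: "f \<in> hom_cocycles (Db_dg C) L M q"
  shows "dcomp (Db_dg C) L M N p q g f \<in> hom_coboundaries (Db_dg C) L N (q + p)"
proof -
  obtain u where u: "u \<in> qhom (Db_dg C) M N (p - 1)" "g = ddiff (Db_dg C) M N (p - 1) u"
    using g by (auto simp: hom_coboundaries_def)
  have f': "f \<in> qhom (Db_dg C) L M q" "ddiff (Db_dg C) L M q f = 0" using f by
      (auto simp: hom_cocycles_def)
  have "dcomp (Db_dg C) L M N (p - 1) (q + 1) u 0 = 0"
  proof
    fix i
    have "u (i + (q + 1)) \<in> Hom C (fst M (i + (q + 1))) (fst N (i + (q + 1) + (p - 1)))"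
      using u(1) unfolding Db_dg_simps by blast
    then show "dcomp (Db_dg C) L M N (p - 1) (q + 1) u 0 i = 0 i"
      unfolding dcomp_Db_dg zero_fun_def using O by (intro Cmp_zero_right Db_objectsD(1))
  qed
  then have "ddiff (Db_dg C) L N (q + (p - 1)) (dcomp (Db_dg C) L M N (p - 1) q u f) = dcomp
      (Db_dg C) L M N p q g f"
    using Db_leibniz[OF O f'(1) u(1)] by (simp add: f' u(2))
  then show ?thesis
    using Db_dcomp_closed[OF O f'(1) u(1)] unfolding hom_coboundaries_def
    by (intro image_eqI[of _ _ "dcomp (Db_dg C) L M N (p - 1) q u f"]) (simp_all add: algebra_simps)
qed

section \<open>The arity zero part of Hochschild cocycles\<close>

lemma HZ_arity_zero:
  assumes x: "x \<in> HZ (Db_dg C) n" and M: "M \<in> Db_objects C"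
  shows "x [M] [] [] \<in> hom_cocycles (Db_dg C) M M n"
proof -
  have x': "x \<in> C_br (Db_dg C) (n - 1)" "hoch_diff (Db_dg C) n x = 0" using x by (auto simp: HZ_def)
  have "x [M] [] [] \<in> qhom (Db_dg C) M M n"
    using C_br_mem[OF x'(1), of "[M]" "[]" "[]"] M by (simp add: composable_def Db_dg_simps(1))
  then show ?thesis
    using hoch_diff_arity_zero[of x M "Db_dg C" n] C_br_zero[OF x'(1) Db_scale_one] M x'(2)
    by (auto simp: hom_cocycles_def Db_dg_simps(1))
qed

lemma HB_arity_zero:
  assumes x: "x \<in> HB (Db_dg C) n" and M: "M \<in> Db_objects C"
  shows "x [M] [] [] \<in> hom_coboundaries (Db_dg C) M M n"
proof -
  obtain y where y: "y \<in> C_br (Db_dg C) (n - 2)" "x = hoch_diff (Db_dg C) (n - 1) y"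
    using x by (auto simp: HB_def)
  have ym: "y [M] [] [] \<in> qhom (Db_dg C) M M (n - 1)"
    using C_br_mem[OF y(1), of "[M]" "[]" "[]"] M by (simp add: composable_def Db_dg_simps(1))
  then have "x [M] [] [] = - ddiff (Db_dg C) M M (n - 1) (y [M] [] [])"
    using hoch_diff_arity_zero[of y M "Db_dg C" "n - 1"] C_br_zero[OF y(1) Db_scale_one] M y(2)
    by (auto simp: Db_dg_simps(1))
  then show ?thesis
    using Db_coboundary_uminus[OF M M, of "ddiff (Db_dg C) M M (n - 1) (y [M] [] [])" n] ym
    by (simp add: hom_coboundaries_def)
qed

text \<open>This is the cocycle equation at the single argument \<open>f\<close>. Its outer terms
  are the two composites and the differential of \<open>x(f)\<close>, so \<open>x(f)\<close> is the
  homotopy; the inner brace vanishes because \<open>f\<close> is closed.\<close>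

lemma HZ_2_natural:
  assumes x: "x \<in> HZ (Db_dg C) 2" and O: "M \<in> Db_objects C" "N \<in> Db_objects C"
    and f: "f \<in> hom_cocycles (Db_dg C) M N 0"
  shows "dcomp (Db_dg C) M N N 2 0 (x [N] [] []) f - dcomp (Db_dg C) M M N 0 2 f (x [M] [] [])
    \<in> hom_coboundaries (Db_dg C) M N 2"
proof -
  let ?D = "Db_dg C"
  have f': "f \<in> qhom ?D M N 0" "ddiff ?D M N 0 f = 0" using f by (auto simp: hom_cocycles_def)
  have xc: "x \<in> C_br ?D 1" using x by (simp add: HZ_def)
  have cf: "composable ?D [N, M] [0] [f]" using f' O by (simp add: composable_def Db_dg_simps(1))
  define y where "y = x [N, M] [0] [f]"
  have y: "y \<in> qhom ?D M N 1" using C_br_mem[OF xc cf] by (simp add: y_def)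
  have xM: "x [X] [] [] \<in> qhom ?D X X 2" if "X \<in> Db_objects C" for X
    using HZ_arity_zero[OF x that] by (simp add: hom_cocycles_def)
  have c: "composable ?D [N, M] [1] [y]" "composable ?D [N, N, M] [2, 0] [x [N] [] [], f]"
    "composable ?D [N, M, M] [0, 2] [f, x [M] [] []]"
    using f' O y xM by (simp_all add: composable_def Db_dg_simps(1) All_less_Suc2)
  have "brace ?D 1 (dg_structure ?D) x [N, M] [0] [f] =
      - ddiff ?D M N 1 y + dcomp ?D M N N 2 0 (x [N] [] []) f - dcomp ?D M M N 0 2 f (x [M] [] [])"
    using c by (subst brace_outer_binary[OF cf])
      (simp_all add: dg_structure_local dg_structure_unary dg_structure_binary y_def[symmetric]
          sgn_act_def)
  moreover have "brace ?D 1 x (dg_structure ?D) [N, M] [0] [f] = 0"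
    using cf by (subst brace_inner_binary[OF cf, of 0])
      (simp_all add: dg_structure_local dg_structure_unary f' C_br_zero[OF xc Db_scale_one])
  ultimately have "dcomp ?D M N N 2 0 (x [N] [] []) f - dcomp ?D M M N 0 2 f (x [M] [] []) = ddiff
      ?D M N 1 y"
    using HZ_2_eq[OF x, of "[N, M]" "[0]" "[f]"] by (simp add: algebra_simps)
  then show ?thesis using y by (simp add: hom_coboundaries_def)
qed

text \<open>By naturality \<open>f\<close> after the value at \<open>M\<close> is cohomologous to
  the value at \<open>N\<close> after \<open>f\<close>, which is a coboundary. Composing with
  \<open>g\<close> and replacing \<open>g f\<close> by the homotopic identity recovers the value at
  \<open>M\<close>.\<close>

lemma Db_iso_coboundary:
  assumes x: "x \<in> HZ (Db_dg C) 2" and O: "M \<in> Db_objects C" "N \<in> Db_objects C"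
    and i: "Db_iso C N M" and N: "x [N] [] [] \<in> hom_coboundaries (Db_dg C) N N 2"
  shows "x [M] [] [] \<in> hom_coboundaries (Db_dg C) M M 2"
proof -
  let ?D = "Db_dg C"
  obtain f g where f: "f \<in> hom_cocycles ?D M N 0" and g: "g \<in> hom_cocycles ?D N M 0"
    and gf: "dcomp ?D M N M 0 0 g f - (\<lambda>i. Idn C (fst M i)) \<in> hom_coboundaries ?D M M 0"
    using i unfolding Db_iso_def by blast
  have q: "f \<in> qhom ?D M N 0" "g \<in> qhom ?D N M 0" using f g by (auto simp: hom_cocycles_def)
  have xM: "x [M] [] [] \<in> hom_cocycles ?D M M 2" "x [M] [] [] \<in> qhom ?D M M 2"
    using HZ_arity_zero[OF x O(1)] by (auto simp: hom_cocycles_def)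
  have "dcomp ?D M N N 2 0 (x [N] [] []) f \<in> hom_coboundaries ?D M N 2"
    using Db_dcomp_coboundary_left[OF O(1,2,2) N f] by simp
  from Db_coboundary_closed(2)[OF O this HZ_2_natural[OF x O f]]
  have "dcomp ?D M M N 0 2 f (x [M] [] []) \<in> hom_coboundaries ?D M N 2" by simp
  from Db_dcomp_coboundary_right[OF O(1,2,1) this g]
  have 1: "dcomp ?D M M M 0 2 (dcomp ?D M N M 0 0 g f) (x [M] [] []) \<in> hom_coboundaries ?D M M 2"
    using Db_dcomp_assoc[OF O(1,1,2,1) xM(2) q] by simp
  have 2: "dcomp ?D M M M 0 2 (dcomp ?D M N M 0 0 g f - (\<lambda>i. Idn C (fst M i))) (x [M] [] [])
    \<in> hom_coboundaries ?D M M 2"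
    using Db_dcomp_coboundary_left[OF O(1,1,1) gf xM(1)] by simp
  have "dcomp ?D M M M 0 2 (dcomp ?D M N M 0 0 g f) (x [M] [] [])
    - dcomp ?D M M M 0 2 (dcomp ?D M N M 0 0 g f - (\<lambda>i. Idn C (fst M i))) (x [M] [] []) = x [M] [] []"
  proof
    fix i
    have "dcomp ?D M N M 0 0 g f (i + 2) \<in> Hom C (fst M (i + 2)) (fst M (i + 2))"
      using Db_dcomp_closed[OF O(1,2,1) q] by (simp add: Db_dg_simps)
    moreover have "x [M] [] [] i \<in> Hom C (fst M i) (fst M (i + 2))" using xM(2) by
        (simp add: Db_dg_simps)
    ultimately show "(dcomp ?D M M M 0 2 (dcomp ?D M N M 0 0 g f) (x [M] [] [])
    - dcomp ?D M M M 0 2 (dcomp ?D M N M 0 0 g f - (\<lambda>i. Idn C (fst M i))) (x [M] [] [])) i = x [M]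
        [] [] i"
      using Db_objectsD(1)[OF O(1)]
      unfolding minus_apply dcomp_Db_dg[of C M M M 0 2] by (simp add: Cmp_diff_left Idn_in Cmp_Idn_left)
  qed
  then show ?thesis using Db_coboundary_closed(2)[OF O(1,1) 1 2] by simp
qed

lemma Db_iso_refl:
  assumes M: "M \<in> Db_objects C"
  shows "Db_iso C M M"
proof -
  let ?I = "\<lambda>i. Idn C (fst M i)"
  note O = Db_objectsD[OF M]
  have "ddiff (Db_dg C) M M 0 ?I = 0"
    using O by (simp add: fun_eq_iff ddiff_Db_dg sgn_act_def Cmp_Idn_left Cmp_Idn_right)
  then have "?I \<in> hom_cocycles (Db_dg C) M M 0"
    using O by (simp add: hom_cocycles_def Db_dg_simps Idn_in)
  moreover have "dcomp (Db_dg C) M M M 0 0 ?I ?I - ?I = 0"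
    using O by (simp add: fun_eq_iff dcomp_Db_dg Cmp_Idn_left Idn_in)
  ultimately show ?thesis
    unfolding Db_iso_def using Db_zero_coboundary[OF M M, of 0] by (metis (no_types, lifting))
qed

end

section \<open>Telescoping the cocycle equations\<close>

text \<open>The elements \<open>a\<^sub>j\<close>, \<open>v\<^sub>j\<close> and the common value of \<open>b(v\<^sub>j)\<close> and \<open>- b(a\<^bsub>j-1\<^esub>, v\<^bsub>j-1\<^esub>)\<close>, where \<open>b\<close> is the dg
  structure.\<close>

definition shifted_diff :: "('o, 'm::ab_group_add) cplx \<Rightarrow> int \<Rightarrow> int \<Rightarrow> 'm" where
  "shifted_diff M j = conc (sgn_act j (snd M j))"

definition comp_proj :: "('k, 'o, 'm::zero) lincat \<Rightarrow> ('o, 'm) cplx \<Rightarrow> int \<Rightarrow> int \<Rightarrow> 'm" where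
  "comp_proj C M j = (\<lambda>k. if k = j then Idn C (fst M j) else 0)"

definition comp_proj_diff :: "('o, 'm::ab_group_add) cplx \<Rightarrow> int \<Rightarrow> int \<Rightarrow> 'm" where
  "comp_proj_diff M j = (\<lambda>k. if k = j - 1 then sgn_act j (snd M (j - 1)) else 0)"

text \<open>Listed from the target downwards, as cochain arguments are; an arrow out of
  \<open>M\<close> is therefore appended at the end.\<close>

definition tower_objs :: "('k, 'o, 'm::zero) lincat \<Rightarrow> ('o, 'm) cplx \<Rightarrow> int \<Rightarrow> nat \<Rightarrow> ('o, 'm) cplx
    list" where
  "tower_objs C M i n = map (\<lambda>m. stalk C (fst M (i - int m))) [0..<Suc n]"

definition tower_arrs :: "('o, 'm::ab_group_add) cplx \<Rightarrow> int \<Rightarrow> nat \<Rightarrow> (int \<Rightarrow> 'm) list" where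
  "tower_arrs M i n = map (\<lambda>m. shifted_diff M (i - 1 - int m)) [0..<n]"

lemma length_tower [simp]:
  "length (tower_objs C M i n) = Suc n" "length (tower_arrs M i n) = n"
  by (simp_all add: tower_objs_def tower_arrs_def)

lemma nth_tower [simp]:
  "m \<le> n \<Longrightarrow> tower_objs C M i n ! m = stalk C (fst M (i - int m))"
  "m < n \<Longrightarrow> tower_arrs M i n ! m = shifted_diff M (i - 1 - int m)"
  by (simp_all add: tower_objs_def tower_arrs_def del: upt_Suc)

text \<open>Stripping the first arrow is how the outer brace relates \<open>i\<close> to
  \<open>i - 1\<close>; stripping the last one (\<open>tower_snoc\<close>) is how the inner brace
  relates length \<open>n\<close> to length \<open>n - 1\<close>.\<close>

lemma tower_Cons:
  "tower_objs C M i (Suc n) = stalk C (fst M i) # tower_objs C M (i - 1) n"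
  "tower_arrs M i (Suc n) = shifted_diff M (i - 1) # tower_arrs M (i - 1) n"
  by (simp_all add: tower_objs_def tower_arrs_def map_upt_Suc algebra_simps del: upt_Suc)

lemma tower_snoc:
  "tower_objs C M i (Suc n) = tower_objs C M i n @ [stalk C (fst M (i - int (Suc n)))]"
  "tower_arrs M i (Suc n) = tower_arrs M i n @ [shifted_diff M (i - 1 - int n)]"
  by (simp_all add: tower_objs_def tower_arrs_def)

lemma tower_zero:
  "tower_objs C M i 0 = [stalk C (fst M i)]" "tower_arrs M i 0 = []"
  by (simp_all add: tower_objs_def tower_arrs_def)

section \<open>Stalk complexes and the dg structure along a tower\<close>

context abelian_category
begin

lemma some_zero_object: "zero_object C (SOME Z. zero_object C Z)"
  using someI_ex[OF ex_zero_object] .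

lemma some_zero_Obj [simp]: "(SOME Z. zero_object C Z) \<in> Obj C"
  using some_zero_object unfolding zero_object_def by blast

lemma stalk_simps [simp]:
  "fst (stalk C E) 0 = E" "j \<noteq> 0 \<Longrightarrow> fst (stalk C E) j = (SOME Z. zero_object C Z)" "snd (stalk C E) j
      = 0"
  by (simp_all add: stalk_def)

lemma stalk_Obj: "E \<in> Obj C \<Longrightarrow> fst (stalk C E) j \<in> Obj C"
  using some_zero_object by (cases "j = 0") (auto simp: zero_object_def)

text \<open>Makes a stalk exact away from degree 0. Kernel and cokernel are the zero object itself,
  whose identity is the zero morphism.\<close>

lemma is_cohomology_zero_object:
  assumes "zero_object C Y" "X \<in> Obj C" "Z \<in> Obj C"
  shows "is_cohomology C X Y Z 0 0 Y (Idn C Y) Y (Idn C Y)"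
proof -
  have O: "Y \<in> Obj C" "\<And>W. W \<in> Obj C \<Longrightarrow> Hom C W Y = {0} \<and> Hom C Y W = {0}"
    using assms(1) by (auto simp: zero_object_def)
  have id: "Idn C Y = 0" using O(2)[OF O(1)] Idn_in[OF O(1)] by simp
  have "is_kernel C Y Z 0 Y (Idn C Y)"
    unfolding is_kernel_def using O assms by (auto simp: id Hom_zero Cmp_zero_left)
  moreover have "is_cokernel C X Y 0 Y (Idn C Y)"
    unfolding is_cokernel_def using O assms by (auto simp: id Hom_zero Cmp_zero_right)
  moreover have "0 \<in> Hom C X Y" "Cmp C X Y Y (Idn C Y) 0 = 0"
    using O assms by (auto simp: id Hom_zero Cmp_zero_right)
  ultimately show ?thesis unfolding is_cohomology_def by blast
qed

lemma stalk_Db_object: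
  assumes "injective C E"
  shows "stalk C E \<in> Db_objects C"
proof -
  have E: "E \<in> Obj C" using assms by (simp add: injective_def)
  have "is_complex C (stalk C E)"
    using E by (simp add: is_complex_def stalk_Obj Hom_zero Cmp_zero_left)
  moreover have "injective C (fst (stalk C E) i)" for i
    using assms some_zero_object injective_zero_object by (cases "i = 0") simp_all
  moreover have "\<forall>i<0. zero_object C (fst (stalk C E) i)"
    using some_zero_object by simp
  moreover have "cohomology_vanishes C (stalk C E) i" if "\<bar>i\<bar> > 0" for i
  proof -
    have "zero_object C (fst (stalk C E) i)" using that some_zero_object by simp
    then show ?thesis
      unfolding cohomology_vanishes_def
      using is_cohomology_zero_object[of "fst (stalk C E) i" "fst (stalk C E) (i - 1)" "fst
          (stalk C E) (i + 1)"] E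
      by (metis stalk_Obj stalk_simps(3))
  qed
  ultimately show ?thesis unfolding Db_objects_def by blast
qed

context
  fixes M assumes M: "M \<in> Db_objects C"
begin

lemma stalk_component: "stalk C (fst M j) \<in> Db_objects C"
  using stalk_Db_object Db_objectsD(3)[OF M] by blast

lemma conc_mem:
  assumes "X \<in> Obj C" "Y \<in> Obj C" "f \<in> Hom C X Y"
  shows "conc f \<in> qhom (Db_dg C) (stalk C X) (stalk C Y) 0"
  using assms by (auto simp: Db_dg_simps conc_def Hom_zero stalk_Obj)

text \<open>Indices and degrees enter through equations, here and below, because each use presents
  them in a different normal form.\<close>

lemma shifted_diff_mem:
  "k = j + 1 \<Longrightarrow> shifted_diff M j \<in> qhom (Db_dg C) (stalk C (fst M j)) (stalk C (fst M k)) 0"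
  unfolding shifted_diff_def using Db_objectsD[OF M] by (intro conc_mem Hom_sgn_act) simp_all

lemma comp_proj_mem: "d = - j \<Longrightarrow> comp_proj C M j \<in> qhom (Db_dg C) M (stalk C (fst M j)) d"
  using Db_objectsD[OF M] by (auto simp: Db_dg_simps comp_proj_def Idn_in intro!: Hom_zero stalk_Obj)

lemma comp_proj_diff_mem:
  "d = 1 - j \<Longrightarrow> comp_proj_diff M j \<in> qhom (Db_dg C) M (stalk C (fst M j)) d"
  using Db_objectsD[OF M] Db_objectsD(2)[OF M, of "j - 1"]
  by (auto simp: Db_dg_simps comp_proj_diff_def intro!: Hom_zero stalk_Obj Hom_sgn_act)

lemma composable_tower:
  "composable (Db_dg C) (tower_objs C M i n) (replicate n 0) (tower_arrs M i n)"
  unfolding composable_def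
proof (intro conjI allI impI)
  show "set (tower_objs C M i n) \<subseteq> qobj (Db_dg C)"
    unfolding tower_objs_def Db_dg_simps set_map using stalk_component by blast
  fix j assume "j < length (tower_arrs M i n)"
  moreover have e: "i - int (Suc j) = i - 1 - int j" by simp
  ultimately show "tower_arrs M i n ! j \<in> qhom (Db_dg C) (tower_objs C M i n ! Suc j)
      (tower_objs C M i n ! j) (replicate n 0 ! j)"
    using shifted_diff_mem[of "i - int j" "i - 1 - int j"] by (simp add: e del: of_nat_Suc)
qed simp_all

lemma composable_tower_snoc:
  assumes "w \<in> qhom (Db_dg C) M (stalk C (fst M (i - int n))) d"
  shows "composable (Db_dg C) (tower_objs C M i n @ [M]) (replicate n 0 @ [d]) (tower_arrs M i n @ [w])"
  unfolding composable_def
proof (intro conjI allI impI)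
  show "set (tower_objs C M i n @ [M]) \<subseteq> qobj (Db_dg C)"
    using composable_tower[of i n] M by (auto simp: composable_def Db_dg_simps(1))
  fix j assume j: "j < length (tower_arrs M i n @ [w])"
  show "(tower_arrs M i n @ [w]) ! j \<in> qhom (Db_dg C) ((tower_objs C M i n @ [M]) ! Suc j)
      ((tower_objs C M i n @ [M]) ! j) ((replicate n 0 @ [d]) ! j)"
  proof (cases "j = n")
    case True
    then show ?thesis using assms by (simp add: nth_append)
  next
    case False
    then show ?thesis
      using composable_tower[of i n] j by (simp add: nth_append composable_def)
  qed
qed simp_all

text \<open>The stalk has zero differential, so only precomposition with the differential of
  \<open>M\<close> remains, with the sign coming from the degree \<open>- j\<close> of the
  projection.\<close>

lemma dg_structure_comp_proj:
  assumes "d = - j"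
  shows "dg_structure (Db_dg C) [stalk C (fst M j), M] [d] [comp_proj C M j] = comp_proj_diff M j"
proof -
  note O = Db_objectsD[OF M]
  have c: "composable (Db_dg C) [stalk C (fst M j), M] [d] [comp_proj C M j]"
    using M stalk_component comp_proj_mem[OF assms] by (simp add: composable_def Db_dg_simps(1))
  have "- ddiff (Db_dg C) M (stalk C (fst M j)) d (comp_proj C M j) k = comp_proj_diff M j k" for k
  proof -
    have p: "comp_proj C M j i \<in> Hom C (fst M i) (fst (stalk C (fst M j)) (i + d))" for i
      using comp_proj_mem[OF assms] by (simp add: Db_dg_simps)
    have 1: "Cmp C (fst M k) (fst (stalk C (fst M j)) (k + d)) (fst (stalk C (fst M j)) (k + d + 1))
      (snd (stalk C (fst M j)) (k + d)) (comp_proj C M j k) = 0"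
      using O p by (simp add: Cmp_zero_left stalk_Obj)
    have 2: "Cmp C (fst M k) (fst M (k + 1)) (fst (stalk C (fst M j)) (k + 1 + d))
        (comp_proj C M j (k + 1)) (snd M k)
      = (if k = j - 1 then snd M (j - 1) else 0)"
    proof (cases "k = j - 1")
      case True
      then show ?thesis using O O(2)[of "j - 1"] assms by (simp add: comp_proj_def Cmp_Idn_left)
    next
      case False
      then have "comp_proj C M j (k + 1) = 0" by (simp add: comp_proj_def)
      then show ?thesis using O False by (simp add: Cmp_zero_left stalk_Obj)
    qed
    show ?thesis unfolding ddiff_Db_dg 1 2 comp_proj_diff_def by (simp add: assms sgn_act_def)
  qed
  then show ?thesis unfolding dg_structure_unary[OF c] by (simp add: fun_eq_iff)
qed

lemma dg_structure_shifted_diff_comp_proj: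
  assumes "d = 1 - j" "k = j - 1"
  shows "dg_structure (Db_dg C) [stalk C (fst M j), stalk C (fst M k), M] [0, d]
    [shifted_diff M k, comp_proj C M k] = - comp_proj_diff M j"
proof -
  note O = Db_objectsD[OF M]
  have c: "composable (Db_dg C) [stalk C (fst M j), stalk C (fst M k), M] [0, d]
      [shifted_diff M k, comp_proj C M k]"
    using M stalk_component comp_proj_mem[of d k] shifted_diff_mem[of j k] assms
    by (simp add: composable_def Db_dg_simps(1) All_less_Suc2)
  have "dcomp (Db_dg C) M (stalk C (fst M k)) (stalk C (fst M j)) 0 d (shifted_diff M k)
      (comp_proj C M k) i
    = - comp_proj_diff M j i" for i
  proof (cases "i = k")
    case True
    then show ?thesis
      using O(1) O(2)[of k] assms
      by (simp add: dcomp_Db_dg shifted_diff_def conc_def comp_proj_def comp_proj_diff_def Cmp_Idn_right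
          Hom_uminus sgn_act_def)
  next
    case False
    moreover have "shifted_diff M k (i + d) \<in> Hom C (fst (stalk C (fst M k)) (i + d))
        (fst (stalk C (fst M j)) (i + d))"
      using shifted_diff_mem[of j k] assms by (simp add: Db_dg_simps)
    ultimately show ?thesis
      using O(1) assms by (simp add: dcomp_Db_dg comp_proj_def comp_proj_diff_def Cmp_zero_right
          stalk_Obj)
  qed
  then show ?thesis unfolding dg_structure_binary[OF c] by (simp add: fun_eq_iff sgn_act_def)
qed

text \<open>With the next lemma this removes all inner terms that do not involve the projection:
  maps between stalks are closed, and consecutive differentials compose to zero.\<close>

lemma dg_structure_shifted_diff:
  assumes "k = j + 1"
  shows "dg_structure (Db_dg C) [stalk C (fst M k), stalk C (fst M j)] [0] [shifted_diff M j] = 0"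
proof -
  note O = Db_objectsD(1)[OF M]
  have s: "shifted_diff M j i \<in> Hom C (fst (stalk C (fst M j)) i) (fst (stalk C (fst M k)) i)" for i
    using shifted_diff_mem[OF assms] by (simp add: Db_dg_simps)
  have c: "composable (Db_dg C) [stalk C (fst M k), stalk C (fst M j)] [0] [shifted_diff M j]"
    using stalk_component shifted_diff_mem[OF assms] by (simp add: composable_def Db_dg_simps(1))
  show ?thesis
    unfolding dg_structure_unary[OF c] using O s
    by (simp add: fun_eq_iff ddiff_Db_dg Cmp_zero_left Cmp_zero_right stalk_Obj sgn_act_def)
qed

lemma dg_structure_shifted_diff_shifted_diff:
  assumes "k = j + 1" "l = k + 1"
  shows "dg_structure (Db_dg C) [stalk C (fst M l), stalk C (fst M k), stalk C (fst M j)] [0, 0]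
    [shifted_diff M k, shifted_diff M j] = 0"
proof -
  note O = Db_objectsD[OF M]
  have c: "composable (Db_dg C) [stalk C (fst M l), stalk C (fst M k), stalk C (fst M j)] [0, 0]
    [shifted_diff M k, shifted_diff M j]"
    using stalk_component shifted_diff_mem[OF assms(1)] shifted_diff_mem[OF assms(2)]
    by (simp add: composable_def Db_dg_simps(1) All_less_Suc2)
  have l: "j + 2 = l" using assms by simp
  have d: "snd M j \<in> Hom C (fst M j) (fst M k)" "snd M k \<in> Hom C (fst M k) (fst M l)"
    "Cmp C (fst M j) (fst M k) (fst M l) (snd M k) (snd M j) = 0"
    using O(2)[of j] O(2)[of k] O(4)[of j] unfolding assms(1)[symmetric] assms(2)[symmetric] l by
        simp_all
  have "dcomp (Db_dg C) (stalk C (fst M j)) (stalk C (fst M k)) (stalk C (fst M l)) 0 0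
    (shifted_diff M k) (shifted_diff M j) i = 0" for i
    using O(1) d by (cases "i = 0")
      (simp_all add: dcomp_Db_dg shifted_diff_def conc_def Cmp_sgn_act_left Cmp_sgn_act_right
          Hom_sgn_act
        stalk_Obj Cmp_zero_left Hom_zero del: stalk_simps(2))
  then show ?thesis unfolding dg_structure_binary[OF c] by (simp add: fun_eq_iff sgn_act_def)
qed

end

end

lemma sgn_act_uminus: "- sgn_act i v = sgn_act (i - 1) v"
  by (simp add: sgn_act_def)

text \<open>The values \<open>x(a\<^bsub>i-1\<^esub>, \<dots>, a\<^bsub>i-n\<^esub>, v\<^bsub>i-n\<^esub>)\<close> and \<open>(-1)\<^sup>n x(a\<^bsub>i-1\<^esub>, \<dots>, a\<^bsub>i-n\<^esub>, b(v\<^bsub>i-n\<^esub>))\<close>, and the component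
  \<open>I\<^bsup>i-2\<^esup> \<rightarrow> I\<^sup>i\<close> of \<open>x(a\<^bsub>i-1\<^esub>, a\<^bsub>i-2\<^esub>)\<close>.\<close>

definition tower_value where
  "tower_value C M x i n = x (tower_objs C M i n @ [M]) (replicate n 0 @ [int n - i])
     (tower_arrs M i n @ [comp_proj C M (i - int n)])"

definition tower_rest where
  "tower_rest C M x i n = sgn_act (int n) (x (tower_objs C M i n @ [M])
      (replicate n 0 @ [int n + 1 - i])
     (tower_arrs M i n @ [comp_proj_diff M (i - int n)]))"

definition tower_curv where
  "tower_curv C M x i = x [stalk C (fst M i), stalk C (fst M (i - 1)), stalk C (fst M (i - 2))] [0, 0]
     [shifted_diff M (i - 1), shifted_diff M (i - 2)] 0"

section \<open>The cocycle equation along a tower\<close>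

context abelian_category
begin

context
  fixes M x assumes M: "M \<in> Db_objects C" and x: "x \<in> HZ (Db_dg C) 2"
begin

lemma cochain_mem: "x \<in> C_br (Db_dg C) 1"
  using x by (simp add: HZ_def)

text \<open>One more arrow contributes shifted degree -1, while the projection at the end gains
  degree 1. The degree of the value is thus independent of \<open>n\<close>, and the values over a
  fixed \<open>i\<close> can be summed into one homotopy.\<close>

lemma tower_value_mem: "tower_value C M x i n \<in> qhom (Db_dg C) M (stalk C (fst M i)) (1 - i)"
proof -
  have "composable (Db_dg C) (tower_objs C M i n @ [M]) (replicate n 0 @ [int n - i])
     (tower_arrs M i n @ [comp_proj C M (i - int n)])"
    by (intro composable_tower_snoc M comp_proj_mem) simp
  from C_br_mem[OF cochain_mem this] show ?thesis
    by (simp add: tower_value_def tower_objs_def hd_append hd_map upt_rec del: upt_Suc)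
qed

text \<open>Position \<open>i - 2\<close> is the one at which a map of degree \<open>2 - i\<close>
  meets the nonzero object of the stalk; the stalk itself contributes no differential.\<close>

lemma ddiff_tower_value:
  "ddiff (Db_dg C) M (stalk C (fst M i)) (1 - i) (tower_value C M x i n) (i - 2) =
    sgn_act i (Cmp C (fst M (i - 2)) (fst M (i - 1)) (fst M i) (tower_value C M x i n (i - 1))
        (snd M (i - 2)))"
proof -
  have "tower_value C M x i n j \<in> Hom C (fst M j) (fst (stalk C (fst M i)) (j + (1 - i)))" for j
    using tower_value_mem by (simp add: Db_dg_simps)
  from this[of "i - 2"] have 1: "Cmp C (fst M (i - 2)) (fst (stalk C (fst M i)) (i - 2 + (1 - i)))
      (fst (stalk C (fst M i)) (i - 2 + (1 - i) + 1)) 0 (tower_value C M x i n (i - 2)) = 0"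
    using Db_objectsD(1)[OF M] by (intro Cmp_zero_left stalk_Obj)
  have e: "i - 2 + 1 = i - 1" "i - 1 + (1 - i) = 0" by simp_all
  show ?thesis unfolding ddiff_Db_dg stalk_simps 1 e by (simp add: sgn_act_def)
qed

text \<open>The dg structure takes opposite values on the last argument and on the last pair, which
  gives a telescoping difference. The factor \<open>(-1)^n\<close> in \<open>tower_rest\<close> is
  the Koszul sign for moving it past \<open>n\<close> arrows of shifted degree -1.\<close>

lemma brace_tower_inner:
  "brace (Db_dg C) 1 x (dg_structure (Db_dg C)) (tower_objs C M i n @ [M]) (replicate n 0 @ [int n - i])
     (tower_arrs M i n @ [comp_proj C M (i - int n)])
   = tower_rest C M x i n - (if n = 0 then 0 else tower_rest C M x i (n - 1))"
proof -
  let ?D = "Db_dg C"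
  have c: "composable ?D (tower_objs C M i n @ [M]) (replicate n 0 @ [int n - i])
     (tower_arrs M i n @ [comp_proj C M (i - int n)])"
    by (intro composable_tower_snoc M comp_proj_mem) simp
  have 1: "sgn_act (1 * shifted_deg (take n (replicate n 0 @ [int n - i])))
      (x (tower_objs C M i n @ [M]) (take n (replicate n 0 @ [int n - i]) @
          [1 + (replicate n 0 @ [int n - i]) ! n])
        (take n (tower_arrs M i n @ [comp_proj C M (i - int n)]) @
         [dg_structure ?D [(tower_objs C M i n @ [M]) ! n, (tower_objs C M i n @ [M]) ! Suc n]
           [(replicate n 0 @ [int n - i]) ! n] [(tower_arrs M i n @ [comp_proj C M (i - int n)]) ! n]]))
    = tower_rest C M x i n"
    by (simp add: nth_append dg_structure_comp_proj[OF M] tower_rest_def sgn_act_def algebra_simps)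
  have 2: "sgn_act (1 * shifted_deg (take (n - 1) (replicate n 0 @ [int n - i])))
      (x (take n (tower_objs C M i n @ [M]) @ [(tower_objs C M i n @ [M]) ! Suc n])
        (take (n - 1) (replicate n 0 @ [int n - i]) @
          [1 + (replicate n 0 @ [int n - i]) ! (n - 1) + (replicate n 0 @ [int n - i]) ! n - 1])
        (take (n - 1) (tower_arrs M i n @ [comp_proj C M (i - int n)]) @
         [dg_structure ?D [(tower_objs C M i n @ [M]) ! (n - 1), (tower_objs C M i n @ [M]) ! n,
             (tower_objs C M i n @ [M]) ! Suc n]
           [(replicate n 0 @ [int n - i]) ! (n - 1), (replicate n 0 @ [int n - i]) ! n]
           [(tower_arrs M i n @ [comp_proj C M (i - int n)]) ! (n - 1),
               (tower_arrs M i n @ [comp_proj C M (i - int n)]) ! n]]))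
    = - tower_rest C M x i (n - 1)" if n: "n \<noteq> 0"
  proof -
    obtain m where m: "n = Suc m" using n by (cases n) auto
    have rs: "0 # replicate m 0 @ [z] = replicate m 0 @ [0, z]" for z :: int by (induction m) simp_all
    let ?w = "comp_proj_diff M (i - int m)"
    let ?As = "tower_objs C M i m @ [M]" and ?ds = "replicate m 0 @ [int m + 1 - i]"
    have d: "dg_structure ?D [stalk C (fst M (i - int m)), stalk C (fst M (i - (1 + int m))), M]
        [0, 1 + int m - i]
        [shifted_diff M (i - (1 + int m)), comp_proj C M (i - (1 + int m))] = - ?w"
      by (rule dg_structure_shifted_diff_comp_proj[OF M]) simp_all
    have w: "?w \<in> qhom ?D M (stalk C (fst M (i - int m))) (int m + 1 - i)"
      by (rule comp_proj_diff_mem[OF M]) simp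
    note cw = composable_tower_snoc[OF M w]
      composable_tower_snoc[OF M Db_qhom_closed(2)[OF M stalk_component[OF M] w w]]
    \<comment> \<open>Multilinearity pulls the minus sign out of the last argument.\<close>
    have "x ?As ?ds ((tower_arrs M i m @ [?w])[m := - ((tower_arrs M i m @ [?w]) ! m)]) = - x ?As
        ?ds (tower_arrs M i m @ [?w])"
      by (rule C_br_uminus[OF cochain_mem Db_scale_one _ cw(1)])
        (use cw(2) in \<open>simp_all add: nth_append list_update_append\<close>)
    then have "x ?As ?ds (tower_arrs M i m @ [- ?w]) = - x ?As ?ds (tower_arrs M i m @ [?w])"
      by (simp add: nth_append list_update_append)
    then show ?thesis
      unfolding m by (simp add: rs nth_append tower_snoc d tower_rest_def sgn_act_def algebra_simps)
  qed
  have e: "i - int (Suc j) = i - 1 - int j" for j by simp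
  have y1: "dg_structure ?D [(tower_objs C M i n @ [M]) ! j, (tower_objs C M i n @ [M]) ! Suc j]
      [(replicate n 0 @ [int n - i]) ! j] [(tower_arrs M i n @ [comp_proj C M (i - int n)]) ! j] = 0"
    if "j < n" for j
    using that by (simp add: nth_append e del: of_nat_Suc) (rule dg_structure_shifted_diff[OF M], simp)
  have y2: "dg_structure ?D [(tower_objs C M i n @ [M]) ! j, (tower_objs C M i n @ [M]) ! Suc j,
      (tower_objs C M i n @ [M]) ! Suc (Suc j)]
      [(replicate n 0 @ [int n - i]) ! j, (replicate n 0 @ [int n - i]) ! Suc j]
      [(tower_arrs M i n @ [comp_proj C M (i - int n)]) ! j,
          (tower_arrs M i n @ [comp_proj C M (i - int n)]) ! Suc j] = 0"
    if "Suc j < n" for j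
    using that by (simp add: nth_append e del: of_nat_Suc)
      (rule dg_structure_shifted_diff_shifted_diff[OF M], simp_all)
  have len: "length (tower_arrs M i n @ [comp_proj C M (i - int n)]) = Suc n" by simp
  note B = brace_inner_binary[where q = 1 and x = x and y = "dg_structure ?D", OF c len]
  show ?thesis
  proof (cases "n = 0")
    case True
    show ?thesis
      by (subst B; (rule dg_structure_local C_br_zero[OF cochain_mem Db_scale_one] y1 y2; assumption)?)
        (unfold 1 if_P[OF True], simp)
  next
    case False
    show ?thesis
      by (subst B; (rule dg_structure_local C_br_zero[OF cochain_mem Db_scale_one] y1 y2; assumption)?)
        (unfold 1 if_not_P[OF False] 2[OF False], simp)
  qed
qed

lemma brace_tower_outer_0:
  "brace (Db_dg C) 1 (dg_structure (Db_dg C)) x (tower_objs C M i 0 @ [M]) (replicate 0 0 @ [int 0 - i])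
     (tower_arrs M i 0 @ [comp_proj C M (i - int 0)]) (i - 2)
   = - ddiff (Db_dg C) M (stalk C (fst M i)) (1 - i) (tower_value C M x i 0) (i - 2) - x [M] [] []
       (i - 2)"
proof -
  let ?D = "Db_dg C" and ?E = "stalk C (fst M i)"
  note O = Db_objectsD[OF M]
  have p: "comp_proj C M i \<in> qhom ?D M ?E (- i)" by (rule comp_proj_mem[OF M]) simp
  have c: "composable ?D [?E, M] [- i] [comp_proj C M i]"
    using p M stalk_component[OF M] by (simp add: composable_def Db_dg_simps(1))
  have xX: "x [X] [] [] \<in> qhom ?D X X 2" if "X \<in> Db_objects C" for X
    using HZ_arity_zero[OF x that] by (simp add: hom_cocycles_def)
  have v: "x [?E, M] [- i] [comp_proj C M i] = tower_value C M x i 0"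
    by (simp add: tower_value_def tower_zero)
  have c': "composable ?D [?E, M] [1 - i] [tower_value C M x i 0]"
    "composable ?D [?E, ?E, M] [2, - i] [x [?E] [] [], comp_proj C M i]"
    "composable ?D [?E, M, M] [- i, 2] [comp_proj C M i, x [M] [] []]"
    using p M stalk_component[OF M] tower_value_mem xX
    by (simp_all add: composable_def Db_dg_simps(1) All_less_Suc2)
  \<comment> \<open>The projection lives only in position \<open>i\<close>, so this composite has no
    component at \<open>i - 2\<close>.\<close>
  have 1: "dcomp ?D M ?E ?E 2 (- i) (x [?E] [] []) (comp_proj C M i) (i - 2) = 0"
  proof -
    have "x [?E] [] [] j \<in> Hom C (fst ?E j) (fst ?E (j + 2))" for j
      using xX[OF stalk_component[OF M]] by (simp add: Db_dg_simps)
    then have "Cmp C (fst M (i - 2)) (fst ?E (i - 2 + - i)) (fst ?E (i - 2 + - i + 2))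
        (x [?E] [] [] (i - 2 + - i)) 0 = 0"
      using O(1) by (intro Cmp_zero_right stalk_Obj)
    then show ?thesis unfolding dcomp_Db_dg by (simp add: comp_proj_def)
  qed
  \<comment> \<open>Here the arity zero value enters: the projection reads off its component from
    position \<open>i - 2\<close> to position \<open>i\<close>.\<close>
  have 2: "dcomp ?D M M ?E (- i) 2 (comp_proj C M i) (x [M] [] []) (i - 2) = x [M] [] [] (i - 2)"
  proof -
    have "x [M] [] [] (i - 2) \<in> Hom C (fst M (i - 2)) (fst M (i - 2 + 2))"
      using xX[OF M] unfolding Db_dg_simps by blast
    then show ?thesis using O(1) by (simp add: dcomp_Db_dg comp_proj_def Cmp_Idn_left)
  qed
  have "brace ?D 1 (dg_structure ?D) x [?E, M] [- i] [comp_proj C M i] =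
    - ddiff ?D M ?E (1 - i) (tower_value C M x i 0)
    + dcomp ?D M ?E ?E 2 (- i) (x [?E] [] []) (comp_proj C M i)
    - dcomp ?D M M ?E (- i) 2 (comp_proj C M i) (x [M] [] [])"
    using c' by (subst brace_outer_binary[OF c])
      (auto simp: dg_structure_local dg_structure_unary dg_structure_binary v sgn_act_def)
  then show ?thesis using 1 2 by (simp add: tower_zero)
qed

text \<open>The three terms apply the dg structure to the whole value, to the value on the arrows
  alone followed by the projection, and to the first arrow followed by a tower value over
  \<open>i - 1\<close> of length \<open>m\<close>.\<close>

lemma brace_tower_outer_Suc:
  "brace (Db_dg C) 1 (dg_structure (Db_dg C)) x (tower_objs C M i (Suc m) @ [M])
      (replicate (Suc m) 0 @ [int (Suc m) - i])
     (tower_arrs M i (Suc m) @ [comp_proj C M (i - int (Suc m))]) (i - 2)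
   = - ddiff (Db_dg C) M (stalk C (fst M i)) (1 - i) (tower_value C M x i (Suc m)) (i - 2)
     + (if m = 1 then tower_curv C M x i else 0)
     - sgn_act (i - 1) (Cmp C (fst M (i - 2)) (fst M (i - 1)) (fst M i) (snd M (i - 1))
         (tower_value C M x (i - 1) m (i - 2)))"
proof -
  define n where "n = Suc m"
  let ?D = "Db_dg C" and ?E = "\<lambda>j. stalk C (fst M j)"
  let ?As = "tower_objs C M i n @ [M]" and ?ds = "replicate n 0 @ [int n - i]"
    and ?fs = "tower_arrs M i n @ [comp_proj C M (i - int n)]"
  define y where "y = x (tower_objs C M i n) (replicate n 0) (tower_arrs M i n)"
  note O = Db_objectsD[OF M]
  have p: "comp_proj C M (i - int n) \<in> qhom ?D M (?E (i - int n)) (int n - i)" by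
      (rule comp_proj_mem[OF M]) simp
  have c: "composable ?D ?As ?ds ?fs" by (rule composable_tower_snoc[OF M p])
  have "hd (tower_objs C M i n) = ?E i" by (simp add: n_def tower_Cons)
  moreover have "last (tower_objs C M i n) = ?E (i - int n)" by (simp add: n_def tower_snoc)
  ultimately have y: "y \<in> qhom ?D (?E (i - int n)) (?E i) (2 - int n)"
    using C_br_mem[OF cochain_mem composable_tower[OF M], of i n] by (simp add: y_def)
  have y': "y j \<in> Hom C (fst (?E (i - int n)) j) (fst (?E i) (j + (2 - int n)))" for j
    using y by (simp add: Db_dg_simps)
  have a: "shifted_diff M (i - 1) \<in> qhom ?D (?E (i - 1)) (?E i) 0"
    by (rule shifted_diff_mem[OF M]) simp
  have w: "tower_value C M x (i - 1) m \<in> qhom ?D M (?E (i - 1)) (2 - i)"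
    using tower_value_mem[of "i - 1" m] by simp
  have w': "tower_value C M x (i - 1) m (i - 2) \<in> Hom C (fst M (i - 2))
      (fst (?E (i - 1)) (i - 2 + (2 - i)))"
    using w unfolding Db_dg_simps by blast
  have c': "composable ?D [?E i, M] [1 - i] [tower_value C M x i n]"
    "composable ?D [?E i, ?E (i - int n), M] [2 - int n, int n - i] [y, comp_proj C M (i - int n)]"
    "composable ?D [?E i, ?E (i - 1), M] [0, 2 - i]
        [shifted_diff M (i - 1), tower_value C M x (i - 1) m]"
    using p M stalk_component[OF M] tower_value_mem y a w
    by (simp_all add: composable_def Db_dg_simps(1) All_less_Suc2)
  have s: "hd ?As = ?E i" "last ?As = M" "?As ! (length ?fs - 1) = ?E (i - int n)" "?As ! 1 = ?E
      (i - 1)"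
    "hd ?ds = 0" "hd ?fs = shifted_diff M (i - 1)" "last ?ds = int n - i" "last ?fs = comp_proj C M
        (i - int n)"
    "1 + 1 + shifted_deg ?ds = 1 - i" "1 + 1 + shifted_deg (butlast ?ds) = 2 - int n"
    "1 + 1 + shifted_deg (tl ?ds) = 2 - i"
    by (simp_all add: n_def tower_Cons nth_append algebra_simps)
  have v: "x ?As ?ds ?fs = tower_value C M x i n" "x (butlast ?As) (butlast ?ds) (butlast ?fs) = y"
    "x (tl ?As) (tl ?ds) (tl ?fs) = tower_value C M x (i - 1) m"
    by (simp_all add: tower_value_def y_def n_def tower_Cons algebra_simps)
  have ne: "?fs \<noteq> []" by simp
  note B = brace_outer_binary[where q = 1 and x = "dg_structure ?D" and y = x, OF c ne]
  have b: "brace ?D 1 (dg_structure ?D) x ?As ?ds ?fs =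
    - ddiff ?D M (?E i) (1 - i) (tower_value C M x i n)
    + sgn_act (2 - int n) (dcomp ?D M (?E (i - int n)) (?E i) (2 - int n) (int n - i) y
        (comp_proj C M (i - int n)))
    - dcomp ?D M (?E (i - 1)) (?E i) 0 (2 - i) (shifted_diff M (i - 1)) (tower_value C M x (i - 1) m)"
    by (subst B; (rule dg_structure_local; assumption)?)
      (unfold s v dg_structure_unary[OF c'(1)] dg_structure_binary[OF c'(2)]
          dg_structure_binary[OF c'(3)],
        simp add: sgn_act_def)
  \<comment> \<open>The projection sits in position \<open>i - n\<close>, so it is visible at
    \<open>i - 2\<close> exactly for \<open>n = 2\<close>, that is \<open>m = 1\<close>.\<close>
  have 1: "sgn_act (2 - int n) (dcomp ?D M (?E (i - int n)) (?E i) (2 - int n) (int n - i) y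
      (comp_proj C M (i - int n)) (i - 2))
    = (if m = 1 then tower_curv C M x i else 0)"
  proof (cases "m = 1")
    case True
    then have n2: "n = 2" by (simp add: n_def)
    have "y = x [?E i, ?E (i - 1), ?E (i - 2)] [0, 0] [shifted_diff M (i - 1), shifted_diff M (i - 2)]"
      by (simp add: y_def n2 numeral_2_eq_2 tower_Cons tower_zero)
    then have "tower_curv C M x i = y 0" by (simp add: tower_curv_def)
    then show ?thesis using True n2 O(1) y'[of 0]
      by (simp add: dcomp_Db_dg comp_proj_def Cmp_Idn_right sgn_act_def)
  next
    case False
    then have "comp_proj C M (i - int n) (i - 2) = 0" by (auto simp: comp_proj_def n_def)
    moreover have "Cmp C (fst M (i - 2)) (fst (?E (i - int n)) (i - 2 + (int n - i)))
      (fst (?E i) (i - 2 + (int n - i) + (2 - int n))) (y (i - 2 + (int n - i))) 0 = 0"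
      using O(1) y' by (intro Cmp_zero_right stalk_Obj)
    ultimately show ?thesis using False unfolding dcomp_Db_dg by simp
  qed
  have 2: "dcomp ?D M (?E (i - 1)) (?E i) 0 (2 - i) (shifted_diff M (i - 1))
      (tower_value C M x (i - 1) m) (i - 2)
    = sgn_act (i - 1) (Cmp C (fst M (i - 2)) (fst M (i - 1)) (fst M i) (snd M (i - 1))
        (tower_value C M x (i - 1) m (i - 2)))"
    using O(1) O(2)[of "i - 1"] w'
    by (simp add: dcomp_Db_dg shifted_diff_def conc_def Cmp_sgn_act_left)
  show ?thesis unfolding n_def[symmetric] b using 1 2 by (simp add: sgn_act_apply)
qed

text \<open>The cocycle equations of lengths 0 to \<open>K\<close>, added up at position
  \<open>i - 2\<close>; of the inner braces only the last remainder is left. The second sum is one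
  term shorter because a tower of length \<open>n\<close> contains one of length
  \<open>n - 1\<close> over \<open>i - 1\<close>, and the curvature term appears only once length 2
  is reached.\<close>

lemma tower_equation:
  "(\<Sum>n\<le>K. sgn_act (i - 1) (Cmp C (fst M (i - 2)) (fst M (i - 1)) (fst M i)
      (tower_value C M x i n (i - 1)) (snd M (i - 2))))
    + (if 2 \<le> K then tower_curv C M x i else 0)
    - (\<Sum>n<K. sgn_act (i - 1) (Cmp C (fst M (i - 2)) (fst M (i - 1)) (fst M i) (snd M (i - 1))
        (tower_value C M x (i - 1) n (i - 2))))
    + tower_rest C M x i K (i - 2) = x [M] [] [] (i - 2)"
proof (induction K)
  case 0
  show ?case
    using fun_cong[OF HZ_2_eq[OF x, of "tower_objs C M i 0 @ [M]" "replicate 0 0 @ [int 0 - i]"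
        "tower_arrs M i 0 @ [comp_proj C M (i - int 0)]"], of "i - 2"]
    unfolding plus_fun_def brace_tower_outer_0 brace_tower_inner ddiff_tower_value
    by (simp add: sgn_act_def algebra_simps split: if_splits)
next
  case (Suc K)
  let ?F = "\<lambda>n. sgn_act (i - 1) (Cmp C (fst M (i - 2)) (fst M (i - 1)) (fst M i)
      (tower_value C M x i n (i - 1)) (snd M (i - 2)))"
  let ?G = "\<lambda>n. sgn_act (i - 1) (Cmp C (fst M (i - 2)) (fst M (i - 1)) (fst M i) (snd M (i - 1))
      (tower_value C M x (i - 1) n (i - 2)))"
  let ?R = "\<lambda>n. tower_rest C M x i n (i - 2)" and ?c = "tower_curv C M x i"
  have step: "?F (Suc K) + (if K = 1 then ?c else 0) - ?G K + (?R (Suc K) - ?R K) = 0"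
    using fun_cong[OF HZ_2_eq[OF x, of "tower_objs C M i (Suc K) @ [M]" "replicate (Suc K) 0 @
        [int (Suc K) - i]"
        "tower_arrs M i (Suc K) @ [comp_proj C M (i - int (Suc K))]"], of "i - 2"]
    unfolding plus_fun_def brace_tower_outer_Suc brace_tower_inner ddiff_tower_value sgn_act_uminus
        by simp
  have c: "(if 2 \<le> Suc K then ?c else 0) = (if 2 \<le> K then ?c else 0) + (if K = 1 then ?c else 0)"
    by auto
  have "sum ?F {..Suc K} + (if 2 \<le> Suc K then ?c else 0) - sum ?G {..<Suc K} + ?R (Suc K)
    = (sum ?F {..K} + (if 2 \<le> K then ?c else 0) - sum ?G {..<K} + ?R K)
      + (?F (Suc K) + (if K = 1 then ?c else 0) - ?G K + (?R (Suc K) - ?R K))"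
    unfolding c sum.atMost_Suc sum.lessThan_Suc by (simp only: algebra_simps)
  then show ?case unfolding step Suc.IH by simp
qed

end

end

section \<open>The characteristic morphism and the obstruction\<close>

lemma Inj_simps [simp]:
  "Obj (Inj C) = {E. injective C E}" "Hom (Inj C) = Hom C" "Scale (Inj C) = Scale C"
  "Cmp (Inj C) = Cmp C" "Idn (Inj C) = Idn C"
  by (simp_all add: Inj_def full_sub_def)

lemma lin_dg_simps [simp]:
  "qobj (lin_dg C) = Obj C" "qhom (lin_dg C) X Y p = (if p = 0 then Hom C X Y else {0})"
  "qscale (lin_dg C) = Scale C" "dcomp (lin_dg C) X Y Z p q = Cmp C X Y Z" "ddiff (lin_dg C) X Y p f
      = 0"
  by (simp_all add: lin_dg_def)

lemma composable_binary:
  "composable Q [Z, Y, X] [p, q] [g, f] \<longleftrightarrow>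
    {X, Y, Z} \<subseteq> qobj Q \<and> g \<in> qhom Q Y Z p \<and> f \<in> qhom Q X Y q"
  by (auto simp: composable_def All_less_Suc2)

lemma composable_unary:
  "composable Q [Y, X] [p] [f] \<longleftrightarrow> {X, Y} \<subseteq> qobj Q \<and> f \<in> qhom Q X Y p"
  by (auto simp: composable_def)

lemma two_cochain_apply:
  "composable (lin_dg C) [Z, Y, X] [0, 0] [g, f] \<Longrightarrow> two_cochain C \<phi> [Z, Y, X] [0, 0] [g, f] = \<phi> X Y Z
      g f"
  by (simp add: two_cochain_def to_br_def arity2_def sgn_act_def numeral_2_eq_2)

lemma Hom_succ:
  fixes f :: "int \<Rightarrow> 'm::ab_group_add"
  assumes "\<And>j. f j \<in> Hom C (fst M j) (fst M (j + 1))"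
  shows "f (k + 1) \<in> Hom C (fst M (k + 1)) (fst M (k + 2))"
proof -
  have "k + 1 + 1 = k + 2" by simp
  then show ?thesis using assms[of "k + 1"] by (simp only:)
qed

lemma conc_uminus: "conc (- f) = - conc (f :: 'm::ab_group_add)"
  by (simp add: conc_def fun_eq_iff)

definition obstruction_cochain ::
    "('o \<Rightarrow> 'o \<Rightarrow> 'o \<Rightarrow> 'm \<Rightarrow> 'm \<Rightarrow> 'm) \<Rightarrow> ('o, 'm::ab_group_add) cplx \<Rightarrow> int \<Rightarrow> 'm" where
  "obstruction_cochain \<phi> M k = - \<phi> (fst M k) (fst M (k + 1)) (fst M (k + 2)) (snd M (k + 1)) (snd M k)"

lemma (in linear_category) obstruction_eq_ext_class:
  assumes M: "M \<in> Db_objects C"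
  shows "obstruction C \<phi> M = ext_class C 2 M M (obstruction_cochain \<phi> M)"
proof -
  have "composable (Db_dg C) [M, M, M] [1, 1] [snd M, snd M]"
    using M Db_objectsD(2)[OF M] by (simp add: composable_binary Db_dg_simps)
  then have "to_br (Db_dg C) 2 (arity2 (componentwise \<phi>)) [M, M, M] [1, 1] [snd M, snd M] =
      obstruction_cochain \<phi> M"
    by (simp add: fun_eq_iff to_br_def arity2_def numeral_2_eq_2 sgn_act_apply sgn_act_odd
        componentwise_def obstruction_cochain_def)
      (simp add: add.commute)
  then show ?thesis by (simp add: obstruction_def)
qed

section \<open>The homotopies between the arity zero value and the obstruction\<close>

context abelian_category
begin

context
  fixes M x assumes M: "M \<in> Db_objects C" and x: "x \<in> HZ (Db_dg C) 2"
begin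

lemma tower_curv_mem: "tower_curv C M x (k + 2) \<in> Hom C (fst M k) (fst M (k + 2))"
proof -
  have "composable (Db_dg C) [stalk C (fst M (k + 2)), stalk C (fst M (k + 1)), stalk C (fst M k)]
      [0, 0]
     [shifted_diff M (k + 1), shifted_diff M k]"
    using shifted_diff_mem[OF M, of "k + 1" k] shifted_diff_mem[OF M, of "k + 2" "k + 1"]
        stalk_component[OF M]
    by (simp add: composable_binary Db_dg_simps(1))
  from C_br_mem[OF cochain_mem[OF M x] this]
  have "x [stalk C (fst M (k + 2)), stalk C (fst M (k + 1)), stalk C (fst M k)] [0, 0]
     [shifted_diff M (k + 1), shifted_diff M k] 0 \<in> Hom C (fst M k) (fst M (k + 2))"
    by (auto simp: Db_dg_simps dest: spec[of _ 0])
  moreover have e: "k + 2 - 1 = k + 1" "k + 2 - 2 = k" by simp_all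
  ultimately show ?thesis unfolding tower_curv_def e by simp
qed

lemma arity_zero_cohomologous_curv:
  "\<exists>h\<in>qhom (Db_dg C) M M 1. \<forall>k. x [M] [] [] k = tower_curv C M x (k + 2) + ddiff (Db_dg C) M M 1 h k"
proof -
  note O = Db_objectsD[OF M]
  obtain b where b: "\<And>i. i < b \<Longrightarrow> zero_object C (fst M i)"
    using M by (auto simp: Db_objects_def)
  \<comment> \<open>The tower over \<open>i\<close> of length \<open>K i\<close> ends in position
    \<open>b\<close>, the lowest that may be nonzero. The homotopy \<open>h j\<close> then collects
    all tower values over \<open>j + 1\<close>, with a sign turning the signed sums into a
    differential.\<close>
  define K where "K i = nat (i - b)" for i
  define h where "h j = sgn_act j (\<Sum>n\<le>K (j + 1). tower_value C M x (j + 1) n j)" for j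
  have tv: "tower_value C M x (j + 1) n j \<in> Hom C (fst M j) (fst M (j + 1))" for j n
  proof -
    have "tower_value C M x (j + 1) n j \<in> Hom C (fst M j)
        (fst (stalk C (fst M (j + 1))) (j + (1 - (j + 1))))"
      using tower_value_mem[OF M x, of "j + 1" n] unfolding Db_dg_simps by blast
    then show ?thesis by simp
  qed
  have h: "h j \<in> Hom C (fst M j) (fst M (j + 1))" for j
    unfolding h_def using O tv by (intro Hom_sgn_act Hom_sum)
  have hq: "h \<in> qhom (Db_dg C) M M 1" using h by (simp add: Db_dg_simps)
  have "x [M] [] [] k = tower_curv C M x (k + 2) + ddiff (Db_dg C) M M 1 h k" for k
  proof (cases "k < b")
    case True
    then have z: "Hom C (fst M k) Y = {0}" if "Y \<in> Obj C" for Y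
      using b that by (auto simp: zero_object_def)
    have "x [M] [] [] \<in> qhom (Db_dg C) M M 2"
      using HZ_arity_zero[OF x M] by (simp add: hom_cocycles_def)
    moreover have "ddiff (Db_dg C) M M 1 h \<in> qhom (Db_dg C) M M 2"
      using Db_ddiff_closed[OF M M hq] by simp
    moreover have "tower_curv C M x (k + 2) = 0" using tower_curv_mem[of k] O(1) by (simp add: z)
    moreover have "x [M] [] [] k = 0" "ddiff (Db_dg C) M M 1 h k = 0"
      using calculation z[OF O(1)] unfolding Db_dg_simps by (metis singletonD)+
    ultimately show ?thesis by simp
  next
    case False
    define L where "L = K (k + 2)"
    \<comment> \<open>For \<open>k \<ge> b\<close> the length grows by exactly one from
      \<open>k + 1\<close> to \<open>k + 2\<close>. Hence the sum up to \<open>L\<close> is the one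
      in \<open>h (k + 1)\<close>, and the sum below \<open>L\<close> is the one in
      \<open>h k\<close>.\<close>
    have L: "2 \<le> L" "L = Suc (K (k + 1))" using False by (auto simp: L_def K_def)
    have d: "snd M k \<in> Hom C (fst M k) (fst M (k + 1))" "snd M (k + 1) \<in> Hom C (fst M (k + 1))
        (fst M (k + 2))"
      using O(2) Hom_succ[OF O(2)] by simp_all
    have e: "k + 2 - 1 = k + 1" "k + 2 - 2 = k" "k + 1 + 1 = k + 2" by simp_all
    have tv': "tower_value C M x (k + 2) n (k + 1) \<in> Hom C (fst M (k + 1)) (fst M (k + 2))" for n
      using tv[of "k + 1" n] by (simp only: e)
    have 1: "(\<Sum>n\<le>L. sgn_act (k + 1) (Cmp C (fst M k) (fst M (k + 1)) (fst M (k + 2))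
        (tower_value C M x (k + 2) n (k + 1)) (snd M k)))
      = Cmp C (fst M k) (fst M (k + 1)) (fst M (k + 2)) (h (k + 1)) (snd M k)"
      using O(1) d tv' unfolding h_def e L_def
      by (simp add: Cmp_sgn_act_left Cmp_sum_left Hom_sum) (simp add: sgn_act_def sum_negf)
    have 2: "(\<Sum>n<L. sgn_act (k + 1) (Cmp C (fst M k) (fst M (k + 1)) (fst M (k + 2)) (snd M (k + 1))
        (tower_value C M x (k + 1) n k)))
      = - Cmp C (fst M k) (fst M (k + 1)) (fst M (k + 2)) (snd M (k + 1)) (h k)"
      using O(1) d tv unfolding h_def L lessThan_Suc_atMost
      by (simp add: Cmp_sgn_act_right Cmp_sum_right Hom_sum) (simp add: sgn_act_def sum_negf)
    \<comment> \<open>At this length the last argument is, up to sign, the differential out of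
      position \<open>b - 1\<close>, where \<open>M\<close> is zero.\<close>
    have 3: "tower_rest C M x (k + 2) L k = 0"
    proof -
      have "snd M (b - 1) = 0" using b[of "b - 1"] O(1) O(2)[of "b - 1"] by (auto simp: zero_object_def)
      then have "comp_proj_diff M (k + 2 - int L) = 0"
        using False by (auto simp: comp_proj_diff_def fun_eq_iff L_def K_def)
      then show ?thesis
        unfolding tower_rest_def by (simp add: C_br_zero[OF cochain_mem[OF M x] Db_scale_one])
    qed
    have "ddiff (Db_dg C) M M 1 h k = Cmp C (fst M k) (fst M (k + 1)) (fst M (k + 2))
        (snd M (k + 1)) (h k)
      + Cmp C (fst M k) (fst M (k + 1)) (fst M (k + 2)) (h (k + 1)) (snd M k)"
      unfolding ddiff_Db_dg e by (simp add: sgn_act_def)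
    then show ?thesis
      using tower_equation[OF M x, of "k + 2" L] L(1) unfolding e 1 2 3 by (simp add: algebra_simps)
  qed
  then show ?thesis using hq by blast
qed

text \<open>Exactly one of two consecutive arrows carries a minus sign; this matches the minus sign
  in \<open>obstruction_cochain\<close>.\<close>

lemma tower_curv_eq:
  "tower_curv C M x (k + 2) = - x [stalk C (fst M (k + 2)), stalk C (fst M (k + 1)), stalk C
      (fst M k)] [0, 0]
    [conc (snd M (k + 1)), conc (snd M k)] 0"
proof -
  let ?As = "[stalk C (fst M (k + 2)), stalk C (fst M (k + 1)), stalk C (fst M k)]"
  let ?f = "conc (snd M k)" and ?g = "conc (snd M (k + 1))"
  note O = Db_objectsD[OF M]
  have d: "snd M k \<in> Hom C (fst M k) (fst M (k + 1))" "snd M (k + 1) \<in> Hom C (fst M (k + 1))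
      (fst M (k + 2))"
    using O(2) Hom_succ[OF O(2)] by simp_all
  have q: "?f \<in> qhom (Db_dg C) (stalk C (fst M k)) (stalk C (fst M (k + 1))) 0"
    "?g \<in> qhom (Db_dg C) (stalk C (fst M (k + 1))) (stalk C (fst M (k + 2))) 0"
    using conc_mem[OF M] O(1) d by blast+
  note st = stalk_component[OF M]
  have c: "composable (Db_dg C) ?As [0, 0] [?g, ?f]" "composable (Db_dg C) ?As [0, 0] [- ?g, ?f]"
    "composable (Db_dg C) ?As [0, 0] [?g, - ?f]"
    using q Db_qhom_closed(2)[OF st st q(1,1)] Db_qhom_closed(2)[OF st st q(2,2)] st
    by (simp_all add: composable_binary Db_dg_simps(1))
  have "x ?As [0, 0] [- ?g, ?f] = - x ?As [0, 0] [?g, ?f]"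
    using C_br_uminus[OF cochain_mem[OF M x] Db_scale_one, of 0 "[?g, ?f]" ?As "[0, 0]"] c by simp
  moreover have "x ?As [0, 0] [?g, - ?f] = - x ?As [0, 0] [?g, ?f]"
    using C_br_uminus[OF cochain_mem[OF M x] Db_scale_one, of 1 "[?g, ?f]" ?As "[0, 0]"] c by simp
  moreover have e: "k + 2 - 1 = k + 1" "k + 2 - 2 = k" by simp_all
  ultimately show ?thesis
    unfolding tower_curv_def e by (simp add: shifted_diff_def sgn_act_def conc_uminus)
qed

text \<open>On injectives \<open>\<phi>\<close> and the restriction of \<open>x\<close> differ by
  the Hochschild differential of a 1-cochain \<open>y\<close>; applying \<open>y\<close> to the
  differentials of \<open>M\<close> one at a time gives the homotopy.\<close>

lemma curv_cohomologous_restriction: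
  assumes \<phi>: "two_cochain (Inj C) \<phi> \<in> HH_class (lin_dg (Inj C)) 2 (restrict_cochain C x)"
  shows "\<exists>h\<in>qhom (Db_dg C) M M 1. \<forall>k. tower_curv C M x (k + 2) = obstruction_cochain \<phi> M k + ddiff
      (Db_dg C) M M 1 h k"
proof -
  let ?R = "lin_dg (Inj C)"
  note O = Db_objectsD[OF M]
  obtain y where y: "y \<in> C_br ?R 0" and eq: "two_cochain (Inj C) \<phi> - restrict_cochain C x =
      hoch_diff ?R 1 y"
    using \<phi> by (auto simp: HH_class_def HB_def)
  have sc: "qscale ?R 1 v = v" for v by simp
  define h where "h k = y [fst M (k + 1), fst M k] [0] [snd M k]" for k
  have cu: "composable ?R [fst M (k + 1), fst M k] [0] [snd M k]" for k
    using O by (simp add: composable_unary)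
  have h: "h k \<in> Hom C (fst M k) (fst M (k + 1))" for k
    using C_br_mem[OF y cu[of k]] by (simp add: h_def)
  have hq: "h \<in> qhom (Db_dg C) M M 1" using h by (simp add: Db_dg_simps)
  have "tower_curv C M x (k + 2) = obstruction_cochain \<phi> M k + ddiff (Db_dg C) M M 1 h k" for k
  proof -
    let ?As = "[fst M (k + 2), fst M (k + 1), fst M k]" and ?fs = "[snd M (k + 1), snd M k]"
    have d: "snd M k \<in> Hom C (fst M k) (fst M (k + 1))" "snd M (k + 1) \<in> Hom C (fst M (k + 1))
        (fst M (k + 2))"
      using O(2) Hom_succ[OF O(2)] by simp_all
    have c: "composable ?R ?As [0, 0] ?fs" using O(3) d by (simp add: composable_binary)
    \<comment> \<open>With two arguments of degree 0 the value of \<open>y\<close> would have degree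
      -1, where a linear category has only 0.\<close>
    have yv: "y ?As [0, 0] ?fs = 0" using C_br_mem[OF y c] by simp
    have h1: "y [fst M (k + 2), fst M (k + 1)] [0] [snd M (k + 1)] = h (k + 1)"
      by (simp add: h_def add.commute)
    have h1': "h (k + 1) \<in> Hom C (fst M (k + 1)) (fst M (k + 2))" using Hom_succ[OF h] .
    have cs: "composable ?R [fst M (k + 2), fst M k] [- 1] [0]"
      "composable ?R ?As [0, 0] [h (k + 1), snd M k]" "composable ?R ?As [0, 0] [snd M (k + 1), h k]"
      "composable ?R [fst M (k + 2), fst M (k + 1)] [0] [snd M (k + 1)]"
      using O(3) d h[of k] h1' by (simp_all add: composable_binary composable_unary)
    have "brace ?R 0 (dg_structure ?R) y ?As [0, 0] ?fs =
      Cmp C (fst M k) (fst M (k + 1)) (fst M (k + 2)) (h (k + 1)) (snd M k)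
      + Cmp C (fst M k) (fst M (k + 1)) (fst M (k + 2)) (snd M (k + 1)) (h k)"
      using cs by (subst brace_outer_binary[OF c])
        (simp_all add: dg_structure_local dg_structure_unary dg_structure_binary yv h1
            h_def[symmetric] sgn_act_def)
    \<comment> \<open>No inner term survives: a linear category has zero differential, and the
      composite of the two differentials of \<open>M\<close> is 0.\<close>
    moreover have "brace ?R 1 y (dg_structure ?R) ?As [0, 0] ?fs = 0"
      using cs(4) cu[of k] c O(4)[of k]
      by (subst brace_inner_binary[OF c, of 1])
        (simp_all add: dg_structure_local dg_structure_unary dg_structure_binary C_br_zero[OF y sc]
            less_Suc_eq)
    ultimately have "two_cochain (Inj C) \<phi> ?As [0, 0] ?fs - restrict_cochain C x ?As [0, 0] ?fs =
      ddiff (Db_dg C) M M 1 h k"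
      using fun_cong[OF fun_cong[OF fun_cong[OF eq, of ?As], of "[0, 0]"], of ?fs]
      by (simp add: hoch_diff_def br_bracket_def ddiff_Db_dg sgn_act_def algebra_simps)
    moreover have "two_cochain (Inj C) \<phi> ?As [0, 0] ?fs = - obstruction_cochain \<phi> M k"
      using c by (simp add: two_cochain_apply obstruction_cochain_def)
    moreover have "restrict_cochain C x ?As [0, 0] ?fs = - tower_curv C M x (k + 2)"
      using c by (simp add: restrict_cochain_def tower_curv_eq)
    ultimately show ?thesis by (simp add: algebra_simps)
  qed
  then show ?thesis using hq by blast
qed

lemma arity_zero_cohomologous_obstruction:
  assumes "two_cochain (Inj C) \<phi> \<in> HH_class (lin_dg (Inj C)) 2 (restrict_cochain C x)"
  shows "x [M] [] [] - obstruction_cochain \<phi> M \<in> hom_coboundaries (Db_dg C) M M 2"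
proof -
  obtain h h' where h: "h \<in> qhom (Db_dg C) M M 1" "\<And>k. x [M] [] [] k = tower_curv C M x (k + 2) +
      ddiff (Db_dg C) M M 1 h k"
    "h' \<in> qhom (Db_dg C) M M 1" "\<And>k. tower_curv C M x (k + 2) = obstruction_cochain \<phi> M k + ddiff
        (Db_dg C) M M 1 h' k"
    using arity_zero_cohomologous_curv curv_cohomologous_restriction[OF assms] by blast
  have "x [M] [] [] - obstruction_cochain \<phi> M = ddiff (Db_dg C) M M 1 (h + h')"
    using h(2,4) by (simp add: fun_eq_iff Db_ddiff_add[OF M M h(1,3)])
  then show ?thesis
    using Db_qhom_closed(1)[OF M M h(1,3)] by (simp add: hom_coboundaries_def)
qed

end

lemma char_mor_eq:
  assumes M: "M \<in> Db_objects C" and c: "c \<in> HH_ex C 2" and \<phi>: "two_cochain (Inj C) \<phi> \<in>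
      restrict_class C 2 c"
  shows "char_mor C 2 c M \<in> Ext C 2 M M" "char_mor C 2 c M = obstruction C \<phi> M"
    "char_mor C 2 c M = ext_class C 2 M M 0 \<longleftrightarrow> obstruction_cochain \<phi> M \<in> hom_coboundaries (Db_dg C) M
        M 2"
proof -
  \<comment> \<open>As \<open>restrict_class\<close> is a union over representatives,
    \<open>\<phi>\<close> comes with a particular \<open>x\<close>. The comparison is made for this
    \<open>x\<close>, and any other representative of \<open>c\<close> changes the arity zero value
    by a coboundary.\<close>
  obtain x where x: "x \<in> c" "two_cochain (Inj C) \<phi> \<in> HH_class (lin_dg (Inj C)) 2 (restrict_cochain C x)"
    using \<phi> by (auto simp: restrict_class_def)
  obtain z where z: "c = HH_class (Db_dg C) 2 z" using c by (auto simp: HH_ex_def HH_def)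
  have HZ: "y \<in> HZ (Db_dg C) 2" if "y \<in> c" for y using that by (simp add: z HH_class_def)
  note cob = arity_zero_cohomologous_obstruction[OF M HZ[OF x(1)] x(2)]
  have yx: "y [M] [] [] - x [M] [] [] \<in> hom_coboundaries (Db_dg C) M M 2" if "y \<in> c" for y
  proof -
    have "y - z \<in> HB (Db_dg C) 2" "x - z \<in> HB (Db_dg C) 2" using that x(1) by
        (simp_all add: z HH_class_def)
    then have "y [M] [] [] - z [M] [] [] \<in> hom_coboundaries (Db_dg C) M M 2"
      "x [M] [] [] - z [M] [] [] \<in> hom_coboundaries (Db_dg C) M M 2"
      using HB_arity_zero[OF _ M] by (metis (no_types) minus_apply)+
    from Db_coboundary_closed(2)[OF M M this] show ?thesis by simp
  qed
  have x0: "x [M] [] [] \<in> hom_cocycles (Db_dg C) M M 2" by (rule HZ_arity_zero[OF HZ[OF x(1)] M])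
  have "ext_class C 2 M M (y [M] [] []) = ext_class C 2 M M (x [M] [] [])" if "y \<in> c" for y
    unfolding ext_class_def using hom_class_eq_iff[OF M M HZ_arity_zero[OF HZ[OF that] M]]
        yx[OF that] by blast
  then have ch: "char_mor C 2 c M = ext_class C 2 M M (x [M] [] [])"
    using x(1) unfolding char_mor_def by blast
  show "char_mor C 2 c M \<in> Ext C 2 M M"
    unfolding ch Ext_def hom_cohomology_def ext_class_def using x0 by blast
  show "char_mor C 2 c M = obstruction C \<phi> M"
    unfolding ch obstruction_eq_ext_class[OF M] ext_class_def using hom_class_eq_iff[OF M M x0] cob
        by blast
  have "x [M] [] [] \<in> hom_coboundaries (Db_dg C) M M 2 \<longleftrightarrow> obstruction_cochain \<phi> M \<in> hom_coboundaries
      (Db_dg C) M M 2"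
    using Db_coboundary_closed(1)[OF M M cob, of "obstruction_cochain \<phi> M"]
      Db_coboundary_closed(2)[OF M M _ cob, of "x [M] [] []"] by auto
  then show "char_mor C 2 c M = ext_class C 2 M M 0 \<longleftrightarrow> obstruction_cochain \<phi> M \<in> hom_coboundaries
      (Db_dg C) M M 2"
    unfolding ch ext_class_def hom_class_eq_iff[OF M M x0] by simp
qed

lemma obstruction_iso_invariant:
  assumes O: "M \<in> Db_objects C" "N \<in> Db_objects C" and i: "Db_iso C N M"
    and c: "c \<in> HH_ex C 2" and \<phi>: "two_cochain (Inj C) \<phi> \<in> restrict_class C 2 c"
    and N: "obstruction_cochain \<phi> N \<in> hom_coboundaries (Db_dg C) N N 2"
  shows "obstruction_cochain \<phi> M \<in> hom_coboundaries (Db_dg C) M M 2"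
proof -
  obtain x where x: "x \<in> c" "two_cochain (Inj C) \<phi> \<in> HH_class (lin_dg (Inj C)) 2 (restrict_cochain C x)"
    using \<phi> by (auto simp: restrict_class_def)
  then have HZ: "x \<in> HZ (Db_dg C) 2" using c by (auto simp: HH_ex_def HH_def HH_class_def)
  have "x [N] [] [] \<in> hom_coboundaries (Db_dg C) N N 2"
    using Db_coboundary_closed(1)[OF O(2,2) arity_zero_cohomologous_obstruction[OF O(2) HZ x(2)] N]
        by simp
  then have "x [M] [] [] \<in> hom_coboundaries (Db_dg C) M M 2"
    by (rule Db_iso_coboundary[OF HZ O i])
  from Db_coboundary_closed(2)[OF O(1,1) this arity_zero_cohomologous_obstruction[OF O(1) HZ x(2)]]
  show ?thesis by simp
qed

end

section \<open>Lifting complexes to the deformation\<close>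

lemma lin_deformation_simps [simp]:
  "Obj (lin_deformation C \<phi>) = Obj C" "Hom (lin_deformation C \<phi>) X Y = Hom C X Y \<times> Hom C X Y"
  "Cmp (lin_deformation C \<phi>) X Y Z (g, g') (f, f') =
    (Cmp C X Y Z g f, Cmp C X Y Z g f' + Cmp C X Y Z g' f + \<phi> X Y Z g f)"
  "Idn (lin_deformation C \<phi>) X = (Idn C X, - \<phi> X X X (Idn C X) (Idn C X))"
  by (simp_all add: lin_deformation_def)

context linear_category
begin

lemma Cmp_Scale_Idn:
  assumes "X \<in> Obj C" "Y \<in> Obj C" "f \<in> Hom C X Y"
  shows "Cmp C X Y Y (Scale C a (Idn C Y)) f = Scale C a f" "Cmp C X X Y f (Scale C a (Idn C X)) =
      Scale C a f"
  using assms by (simp_all add: Cmp_scale_left Cmp_scale_right Idn_in Cmp_Idn_left Cmp_Idn_right)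

lemma is_mono_comp:
  assumes "is_mono C X Y f" "is_mono C Y Z g"
  shows "is_mono C X Z (Cmp C X Y Z g f)"
proof -
  have O: "X \<in> Obj C" "Y \<in> Obj C" "Z \<in> Obj C" "f \<in> Hom C X Y" "g \<in> Hom C Y Z"
    using assms by (auto simp: is_mono_def)
  show ?thesis
  proof (rule is_monoI)
    fix W h assume h: "W \<in> Obj C" "h \<in> Hom C W X" "Cmp C W X Z (Cmp C X Y Z g f) h = 0"
    then have "Cmp C W Y Z g (Cmp C W X Y f h) = 0" using O by (simp add: Cmp_assoc)
    then have "Cmp C W X Y f h = 0" using is_mono_zero[OF assms(2)] O h by (meson Cmp_in)
    then show "h = 0" using is_mono_zero[OF assms(1)] h by blast
  qed (use O in \<open>simp_all add: Cmp_in\<close>)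
qed

lemma is_mono_left_inverse:
  assumes O: "X \<in> Obj C" "Y \<in> Obj C" "f \<in> Hom C X Y" "g \<in> Hom C Y X" and gf: "Cmp C X Y X g f = Idn C X"
  shows "is_mono C X Y f"
proof (rule is_monoI[OF O(1-3)])
  fix W h assume h: "W \<in> Obj C" "h \<in> Hom C W X" "Cmp C W X Y f h = 0"
  have "h = Cmp C W X X (Cmp C X Y X g f) h" unfolding gf using O h by (simp add: Cmp_Idn_left)
  also have "\<dots> = Cmp C W Y X g (Cmp C W X Y f h)" using O h by (simp add: Cmp_assoc)
  also have "\<dots> = 0" using O h by (simp add: Cmp_zero_right)
  finally show "h = 0" .
qed

end

text \<open>\<open>\<phi>\<close> is an arbitrary function; what is known about its values is read
  off the normalised cochain at composable arguments between injectives.\<close>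

lemma (in linear_category) two_cochain_values:
  assumes \<phi>: "two_cochain (Inj C) \<phi> \<in> C_br (lin_dg (Inj C)) 1"
    and O: "injective C X" "injective C Y" "injective C Z" "f \<in> Hom C X Y"
  shows "g \<in> Hom C Y Z \<Longrightarrow> \<phi> X Y Z g f \<in> Hom C X Z" "\<phi> X Y Z 0 f = 0"
proof -
  have c: "composable (lin_dg (Inj C)) [Z, Y, X] [0, 0] [g, f]" if "g \<in> Hom C Y Z" for g
    using that O by (simp add: composable_binary)
  show "\<phi> X Y Z g f \<in> Hom C X Z" if "g \<in> Hom C Y Z"
    using C_br_mem[OF \<phi> c[OF that]] by (simp add: two_cochain_apply[OF c[OF that]])
  have 0: "0 \<in> Hom C Y Z" using O by (simp add: Hom_zero injective_def)
  have "two_cochain (Inj C) \<phi> [Z, Y, X] [0, 0] [0, f] = 0"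
    by (rule C_br_zero[OF \<phi>, of 1]) simp_all
  then show "\<phi> X Y Z 0 f = 0" by (simp add: two_cochain_apply[OF c[OF 0]])
qed

text \<open>The minus sign in \<open>obstruction_cochain\<close> lets the bounding map
  \<open>h\<close> itself, not its negative, be the \<open>\<epsilon>\<close> part of a deformed
  differential.\<close>

lemma (in linear_category) obstruction_cochain_coboundary_iff:
  assumes M: "M \<in> Db_objects C"
  shows "obstruction_cochain \<phi> M \<in> hom_coboundaries (Db_dg C) M M 2 \<longleftrightarrow>
    (\<exists>h. (\<forall>k. h k \<in> Hom C (fst M k) (fst M (k + 1))) \<and>
      (\<forall>k. Cmp C (fst M k) (fst M (k + 1)) (fst M (k + 2)) (snd M (k + 1)) (h k)
        + Cmp C (fst M k) (fst M (k + 1)) (fst M (k + 2)) (h (k + 1)) (snd M k)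
        + \<phi> (fst M k) (fst M (k + 1)) (fst M (k + 2)) (snd M (k + 1)) (snd M k) = 0))"
proof -
  have e: "k + 1 + 1 = k + 2" for k :: int by simp
  have d: "ddiff (Db_dg C) M M 1 h k = Cmp C (fst M k) (fst M (k + 1)) (fst M (k + 2))
      (snd M (k + 1)) (h k)
      + Cmp C (fst M k) (fst M (k + 1)) (fst M (k + 2)) (h (k + 1)) (snd M k)" for h k
    unfolding ddiff_Db_dg e by (simp add: sgn_act_def)
  have "obstruction_cochain \<phi> M \<in> hom_coboundaries (Db_dg C) M M 2 \<longleftrightarrow>
    (\<exists>h. h \<in> qhom (Db_dg C) M M 1 \<and> obstruction_cochain \<phi> M = ddiff (Db_dg C) M M 1 h)"
    by (auto simp: hom_coboundaries_def)
  moreover have "obstruction_cochain \<phi> M = ddiff (Db_dg C) M M 1 h \<longleftrightarrow>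
    (\<forall>k. ddiff (Db_dg C) M M 1 h k + \<phi> (fst M k) (fst M (k + 1)) (fst M (k + 2)) (snd M (k + 1))
        (snd M k) = 0)" for h
    unfolding fun_eq_iff obstruction_cochain_def neg_eq_iff_add_eq_0 by (simp only: add.commute)
  ultimately show ?thesis unfolding d Db_dg_simps by simp
qed

section \<open>Consequences of the two equivalences of a deformation\<close>

locale deformation = A: abelian_category A + B: abelian_category B
  for A :: "('k::field, 'o, 'm::ab_group_add) lincat"
    and B :: "('k dualnum, 'p, 'q::ab_group_add) lincat" +
  fixes \<phi> :: "'o \<Rightarrow> 'o \<Rightarrow> 'o \<Rightarrow> 'm \<Rightarrow> 'm \<Rightarrow> 'm" and Fo :: "'o \<Rightarrow> 'p" and Fm :: "'o \<Rightarrow> 'o \<Rightarrow> 'm \<Rightarrow> 'q"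
    and Go :: "'o \<Rightarrow> 'p" and Gm :: "'o \<Rightarrow> 'o \<Rightarrow> 'm \<times> 'm \<Rightarrow> 'q" and \<kappa> :: "'o \<Rightarrow> 'q"
  assumes enough_A: "enough_injectives A"
    and cochain: "two_cochain (Inj A) \<phi> \<in> C_br (lin_dg (Inj A)) 1"
    and deformation: "deformation_of_class A \<phi> B Fo Fm Go Gm \<kappa>"
begin

lemma F_equivalence: "linear_equivalence (\<lambda>a. Dual a 0) A (full_sub B (eps_zero_objects B)) Fo Fm"
  and G_equivalence: "linear_equivalence id (lin_deformation (Inj A) \<phi>) (Inj B) Go Gm"
  using deformation by (auto simp: deformation_of_class_def abelian_deformation_def)

lemma \<kappa>_kernel: "injective A E \<Longrightarrow> is_kernel B (Go E) (Go E) (eps_end B (Go E)) (Fo E) (\<kappa> E)"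
  and \<kappa>_natural: "\<lbrakk>injective A E; injective A E'; f \<in> Hom A E E'; f' \<in> Hom A E E'\<rbrakk> \<Longrightarrow>
    Cmp B (Fo E) (Go E) (Go E') (Gm E E' (f, f')) (\<kappa> E) = Cmp B (Fo E) (Fo E') (Go E') (\<kappa> E')
        (Fm E E' f)"
  using deformation by (simp_all add: deformation_of_class_def)

lemma Fo_Obj: "X \<in> Obj A \<Longrightarrow> Fo X \<in> Obj B"
  and Fm_Idn: "X \<in> Obj A \<Longrightarrow> Fm X X (Idn A X) = Idn B (Fo X)"
  and Fm_Cmp: "\<lbrakk>X \<in> Obj A; Y \<in> Obj A; Z \<in> Obj A; f \<in> Hom A X Y; g \<in> Hom A Y Z\<rbrakk> \<Longrightarrow>
    Fm X Z (Cmp A X Y Z g f) = Cmp B (Fo X) (Fo Y) (Fo Z) (Fm Y Z g) (Fm X Y f)"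
  and Fm_linear: "\<lbrakk>X \<in> Obj A; Y \<in> Obj A; f \<in> Hom A X Y; f' \<in> Hom A X Y\<rbrakk> \<Longrightarrow>
    Fm X Y (Scale A a f + f') = Scale B (Dual a 0) (Fm X Y f) + Fm X Y f'"
  and Fm_bij: "\<lbrakk>X \<in> Obj A; Y \<in> Obj A\<rbrakk> \<Longrightarrow> bij_betw (Fm X Y) (Hom A X Y) (Hom B (Fo X) (Fo Y))"
  and Fo_surj: "\<lbrakk>P \<in> Obj B; eps_end B P = 0\<rbrakk> \<Longrightarrow> \<exists>X\<in>Obj A. iso_objects B (Fo X) P"
  using F_equivalence by (auto simp: linear_equivalence_def full_sub_def eps_zero_objects_def
      iso_objects_def)

lemma Fm_mem: "\<lbrakk>X \<in> Obj A; Y \<in> Obj A; f \<in> Hom A X Y\<rbrakk> \<Longrightarrow> Fm X Y f \<in> Hom B (Fo X) (Fo Y)"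
  using Fm_bij bij_betwE by blast

lemma Fm_inj: "\<lbrakk>X \<in> Obj A; Y \<in> Obj A; f \<in> Hom A X Y; g \<in> Hom A X Y; Fm X Y f = Fm X Y g\<rbrakk> \<Longrightarrow> f = g"
  using Fm_bij[of X Y] by (auto simp: bij_betw_def inj_on_def)

lemma Fm_obtain:
  assumes "X \<in> Obj A" "Y \<in> Obj A" "u \<in> Hom B (Fo X) (Fo Y)"
  obtains f where "f \<in> Hom A X Y" "Fm X Y f = u"
proof -
  have "u \<in> Fm X Y ` Hom A X Y" using bij_betw_imp_surj_on[OF Fm_bij[OF assms(1,2)]] assms(3) by simp
  then show thesis using that by blast
qed

lemma Fm_zero:
  assumes "X \<in> Obj A" "Y \<in> Obj A"
  shows "Fm X Y 0 = 0"
proof -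
  have "Fm X Y (Scale A 1 0 + 0) = Scale B (Dual 1 0) (Fm X Y 0) + Fm X Y 0"
    using Fm_linear[OF assms A.Hom_zero[OF assms] A.Hom_zero[OF assms]] .
  moreover have "Dual 1 0 = (1 :: 'k dualnum)" by (simp add: one_dualnum_def)
  ultimately show ?thesis by simp
qed

lemma Go_injective: "injective A E \<Longrightarrow> injective B (Go E)"
  and Gm_Idn: "injective A E \<Longrightarrow> Gm E E (Idn (lin_deformation (Inj A) \<phi>) E) = Idn B (Go E)"
  and Gm_Cmp: "\<lbrakk>injective A X; injective A Y; injective A Z; f \<in> Hom A X Y \<times> Hom A X Y; g \<in> Hom A Y
      Z \<times> Hom A Y Z\<rbrakk> \<Longrightarrow>
    Gm X Z (Cmp (lin_deformation (Inj A) \<phi>) X Y Z g f) = Cmp B (Go X) (Go Y) (Go Z) (Gm Y Z g)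
        (Gm X Y f)"
  and Gm_bij: "\<lbrakk>injective A X; injective A Y\<rbrakk> \<Longrightarrow> bij_betw (Gm X Y) (Hom A X Y \<times> Hom A X Y)
      (Hom B (Go X) (Go Y))"
  using G_equivalence unfolding linear_equivalence_def by auto

lemma Go_Obj: "injective A E \<Longrightarrow> Go E \<in> Obj B"
  using Go_injective by (simp add: injective_def)

lemma Gm_mem: "\<lbrakk>injective A X; injective A Y; f \<in> Hom A X Y; f' \<in> Hom A X Y\<rbrakk> \<Longrightarrow> Gm X Y (f, f') \<in> Hom
    B (Go X) (Go Y)"
  using Gm_bij[of X Y] bij_betwE by blast

lemma Gm_inj: "\<lbrakk>injective A X; injective A Y; f \<in> Hom A X Y \<times> Hom A X Y; g \<in> Hom A X Y \<times> Hom A X Y;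
    Gm X Y f = Gm X Y g\<rbrakk> \<Longrightarrow> f = g"
  using Gm_bij[of X Y] by (auto simp: bij_betw_def inj_on_def)

lemma Gm_obtain:
  assumes "injective A X" "injective A Y" "u \<in> Hom B (Go X) (Go Y)"
  obtains f f' where "f \<in> Hom A X Y" "f' \<in> Hom A X Y" "Gm X Y (f, f') = u"
proof -
  have "u \<in> Gm X Y ` (Hom A X Y \<times> Hom A X Y)"
    using bij_betw_imp_surj_on[OF Gm_bij[OF assms(1,2)]] assms(3) by simp
  then show thesis using that by blast
qed

lemma Gm_add:
  assumes "injective A X" "injective A Y" "f \<in> Hom A X Y \<times> Hom A X Y" "g \<in> Hom A X Y \<times> Hom A X Y"
  shows "Gm X Y (f + g) = Gm X Y f + Gm X Y g"
proof -
  have "Scale (lin_deformation (Inj A) \<phi>) 1 f = f"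
    by (simp add: lin_deformation_def one_dualnum_def)
  moreover have "Gm X Y (Scale (lin_deformation (Inj A) \<phi>) 1 f + g) = Scale B (id 1) (Gm X Y f) + Gm
      X Y g"
    using G_equivalence assms unfolding linear_equivalence_def
    by (simp only: lin_deformation_simps Inj_simps mem_Collect_eq)
  ultimately show ?thesis by simp
qed

lemma Gm_zero: "injective A X \<Longrightarrow> injective A Y \<Longrightarrow> Gm X Y (0, 0) = 0"
  using Gm_add[of X Y "(0, 0)" "(0, 0)"] A.Hom_zero[of X Y] by (simp add: injective_def)

lemmas \<phi>_mem = A.two_cochain_values(1)[OF cochain]
lemmas \<phi>_zero = A.two_cochain_values(2)[OF cochain]

text \<open>Since \<open>\<epsilon>\<^sup>2 = 0\<close>, a subobject meeting the kernel of \<open>\<epsilon>\<close> trivially is zero.\<close>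

lemma is_mono_if_mono_on_kernel_eps:
  assumes k: "is_kernel B X X (eps_end B X) K i" and f: "f \<in> Hom B X Y" "Y \<in> Obj B"
    and m: "is_mono B K Y (Cmp B K X Y f i)"
  shows "is_mono B X Y f"
proof -
  have O: "X \<in> Obj B" "K \<in> Obj B" "i \<in> Hom B K X" using k by (auto simp: is_kernel_def)
  have *: "g = 0" if g: "W \<in> Obj B" "g \<in> Hom B W X" "Scale B eps g = 0" "Cmp B W X Y f g = 0" for W g
  proof -
    have "Cmp B W X X (eps_end B X) g = 0" using g O by (simp add: eps_end_def B.Cmp_Scale_Idn)
    then obtain g' where g': "g' \<in> Hom B W K" "Cmp B W K X i g' = g" using B.kernel_lift[OF k] g by
        metis
    then have "Cmp B W K Y (Cmp B K X Y f i) g' = 0" using g O f by (simp add: B.Cmp_assoc)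
    then have "g' = 0" using B.is_mono_zero[OF m] g g' by blast
    then show "g = 0" using g' O g by (simp add: B.Cmp_zero_right)
  qed
  have eps2: "eps * eps = (0 :: 'k dualnum)" by (simp add: eps_def times_dualnum_def zero_dualnum_def)
  show ?thesis
  proof (rule B.is_monoI)
    fix W g assume g: "W \<in> Obj B" "g \<in> Hom B W X" "Cmp B W X Y f g = 0"
    have "Scale B eps g = 0"
      by (rule *[OF g(1)]) (use g O f in \<open>simp_all add: B.Hom_scale B.Cmp_scale_right eps2\<close>)
    then show "g = 0" using * g by blast
  qed (use O f in auto)
qed

section \<open>Subobjects and injectives of the deformed category\<close>

lemma eps_end_subobject:
  assumes "is_mono B K X i" "eps_end B X = 0"
  shows "eps_end B K = 0"
proof -
  have O: "X \<in> Obj B" "K \<in> Obj B" "i \<in> Hom B K X" using assms by (auto simp: is_mono_def)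
  have "Cmp B K K X i (eps_end B K) = Cmp B K X X (eps_end B X) i"
    using O by (simp add: eps_end_def B.Cmp_Scale_Idn)
  then have "Cmp B K K X i (eps_end B K) = 0" using O assms by (simp add: B.Cmp_zero_left)
  then show ?thesis
    using B.is_mono_zero[OF assms(1)] O by (simp add: eps_end_def B.Hom_scale B.Idn_in)
qed

lemma eps_end_kernel:
  assumes "is_kernel B X X (eps_end B X) K i"
  shows "eps_end B K = 0"
proof -
  have O: "X \<in> Obj B" "K \<in> Obj B" "i \<in> Hom B K X" "Cmp B K X X (eps_end B X) i = 0"
    using assms by (auto simp: is_kernel_def)
  then have "Cmp B K K X i (eps_end B K) = 0"
    by (simp add: eps_end_def B.Cmp_Scale_Idn)
  then show ?thesis
    using B.is_mono_zero[OF B.kernel_is_mono[OF assms]] O by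
        (simp add: eps_end_def B.Hom_scale B.Idn_in)
qed

text \<open>Fullness and faithfulness only give cancellation against objects killed by
  \<open>\<epsilon>\<close>. But the kernel of \<open>Fm X Y m\<close> is a subobject of
  \<open>Fo X\<close>, hence killed by \<open>\<epsilon>\<close> and isomorphic to some
  \<open>Fo Z\<close>, where cancellation applies.\<close>

lemma Fm_is_mono:
  assumes m: "is_mono A X Y m"
  shows "is_mono B (Fo X) (Fo Y) (Fm X Y m)"
proof -
  have O: "X \<in> Obj A" "Y \<in> Obj A" "m \<in> Hom A X Y" using m by (auto simp: is_mono_def)
  note FO = Fo_Obj[OF O(1)] Fo_Obj[OF O(2)] Fm_mem[OF O]
  obtain K j where k: "is_kernel B (Fo X) (Fo Y) (Fm X Y m) K j" using B.ex_kernel FO by blast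
  then have K: "K \<in> Obj B" "j \<in> Hom B K (Fo X)" "Cmp B K (Fo X) (Fo Y) (Fm X Y m) j = 0"
    by (auto simp: is_kernel_def)
  have "eps_end B (Fo X) = 0"
    using F_equivalence O by (auto simp: linear_equivalence_def full_sub_def eps_zero_objects_def)
  then have "eps_end B K = 0" by (rule eps_end_subobject[OF B.kernel_is_mono[OF k]])
  then obtain Z a b where Z: "Z \<in> Obj A" "a \<in> Hom B (Fo Z) K" "b \<in> Hom B K (Fo Z)"
    "Cmp B K (Fo Z) K a b = Idn B K"
    using Fo_surj[OF K(1)] unfolding iso_objects_def by blast
  note FZ = Fo_Obj[OF Z(1)]
  obtain y where y: "y \<in> Hom A Z X" "Fm Z X y = Cmp B (Fo Z) K (Fo X) j a"
    using Fm_obtain[OF Z(1) O(1)] B.Cmp_in[OF FZ K(1) FO(1) Z(2) K(2)] by metis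
  have "Fm Z Y (Cmp A Z X Y m y) = Cmp B (Fo Z) K (Fo Y) (Cmp B K (Fo X) (Fo Y) (Fm X Y m) j) a"
    using Fm_Cmp[OF Z(1) O(1,2) y(1) O(3)] y(2)
      B.Cmp_assoc[OF FZ K(1) FO(1,2) Z(2) K(2) FO(3)] by simp
  also have "\<dots> = Fm Z Y 0" using K Z FZ FO O by (simp add: B.Cmp_zero_left Fm_zero)
  finally have "Cmp A Z X Y m y = 0"
    using Fm_inj Z O y by (meson A.Cmp_in A.Hom_zero)
  then have "y = 0" using A.is_mono_zero[OF m] Z y by blast
  then have ja: "Cmp B (Fo Z) K (Fo X) j a = 0" using y Fm_zero Z O by simp
  have "j = Cmp B K K (Fo X) j (Cmp B K (Fo Z) K a b)" unfolding Z(4) using K FO by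
      (simp add: B.Cmp_Idn_right)
  also have "\<dots> = Cmp B K (Fo Z) (Fo X) (Cmp B (Fo Z) K (Fo X) j a) b" using K FO FZ Z by
      (simp add: B.Cmp_assoc)
  also have "\<dots> = 0" unfolding ja using K FO FZ Z by (simp add: B.Cmp_zero_left)
  finally have j0: "j = 0" .
  show ?thesis
  proof (rule B.is_monoI[OF FO])
    fix W g assume g: "W \<in> Obj B" "g \<in> Hom B W (Fo X)" "Cmp B W (Fo X) (Fo Y) (Fm X Y m) g = 0"
    then obtain g' where "g' \<in> Hom B W K" "Cmp B W K (Fo X) j g' = g" using B.kernel_lift[OF k] by metis
    then show "g = 0" unfolding j0 using B.Cmp_zero_left[OF g(1) K(1) FO(1)] by simp
  qed
qed

text \<open>The objects \<open>Go E\<close> cogenerate. The kernel of \<open>\<epsilon>\<close> on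
  \<open>X\<close> is some \<open>Fo Z\<close>; an embedding of \<open>Z\<close> into an injective
  \<open>E\<close> gives a map from this kernel to \<open>Go E\<close>, which extends to
  \<open>X\<close> and remains mono because it is so on the kernel.\<close>

lemma embed_in_Go:
  assumes X: "X \<in> Obj B"
  shows "\<exists>E. injective A E \<and> (\<exists>u. is_mono B X (Go E) u)"
proof -
  have eX: "eps_end B X \<in> Hom B X X" using X by (simp add: eps_end_def B.Hom_scale B.Idn_in)
  obtain K i where k: "is_kernel B X X (eps_end B X) K i" using B.ex_kernel X eX by blast
  then have K: "K \<in> Obj B" "i \<in> Hom B K X" by (auto simp: is_kernel_def)
  obtain Z a b where Z: "Z \<in> Obj A" "a \<in> Hom B (Fo Z) K" "b \<in> Hom B K (Fo Z)"
    "Cmp B K (Fo Z) K a b = Idn B K"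
    using Fo_surj[OF K(1) eps_end_kernel[OF k]] unfolding iso_objects_def by blast
  obtain E m where E: "injective A E" "is_mono A Z E m" using enough_A Z unfolding
      enough_injectives_def by blast
  have b: "is_mono B K (Fo Z) b" using B.is_mono_left_inverse[OF K(1) Fo_Obj[OF Z(1)] Z(3,2,4)] .
  define t where "t = Cmp B K (Fo E) (Go E) (\<kappa> E) (Cmp B K (Fo Z) (Fo E) (Fm Z E m) b)"
  have t: "is_mono B K (Go E) t"
    unfolding t_def by (intro B.is_mono_comp[OF _ B.kernel_is_mono[OF \<kappa>_kernel[OF E(1)]]]
        B.is_mono_comp[OF b] Fm_is_mono E)
  then have "t \<in> Hom B K (Go E)" by (simp add: is_mono_def)
  then obtain u where u: "u \<in> Hom B X (Go E)" "Cmp B K X (Go E) u i = t"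
    using B.injective_extend[OF Go_injective[OF E(1)] B.kernel_is_mono[OF k]] by metis
  then have "is_mono B X (Go E) u"
    using is_mono_if_mono_on_kernel_eps[OF k u(1) Go_Obj[OF E(1)]] t by simp
  then show ?thesis using E by blast
qed

text \<open>Each inclusion of \<open>Fo E\<close> extends along the other, which gives maps in both
  directions. Compatibility with \<open>\<kappa> E\<close> and \<open>\<iota>\<close> is kept so
  that differentials can later be compared on kernels.\<close>

lemma Go_iso_of_kernel_eps:
  assumes E: "injective A E" and J: "injective B J" and k: "is_kernel B J J (eps_end B J) (Fo E) \<iota>"
  shows "\<exists>\<theta> \<sigma>. \<theta> \<in> Hom B (Go E) J \<and> \<sigma> \<in> Hom B J (Go E) \<and> Cmp B (Go E) J (Go E) \<sigma> \<theta> = Idn B (Go E) \<and>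
    Cmp B J (Go E) J \<theta> \<sigma> = Idn B J \<and> Cmp B (Fo E) (Go E) J \<theta> (\<kappa> E) = \<iota>"
proof -
  let ?D = "lin_deformation (Inj A) \<phi>" and ?G = "Go E"
  have EO: "E \<in> Obj A" using E by (simp add: injective_def)
  note kk = \<kappa>_kernel[OF E]
  have O: "?G \<in> Obj B" "J \<in> Obj B" "Fo E \<in> Obj B" "\<kappa> E \<in> Hom B (Fo E) ?G" "\<iota> \<in> Hom B (Fo E) J"
    using k kk by (auto simp: is_kernel_def)
  obtain \<theta> where \<theta>: "\<theta> \<in> Hom B ?G J" "Cmp B (Fo E) ?G J \<theta> (\<kappa> E) = \<iota>"
    using B.injective_extend[OF J B.kernel_is_mono[OF kk] O(5)] .
  obtain \<theta>' where \<theta>': "\<theta>' \<in> Hom B J ?G" "Cmp B (Fo E) J ?G \<theta>' \<iota> = \<kappa> E"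
    using B.injective_extend[OF Go_injective[OF E] B.kernel_is_mono[OF k] O(4)] .
  \<comment> \<open>\<open>\<theta>' \<theta>\<close> is the identity on the kernel of \<open>\<epsilon>\<close>, hence of the form \<open>1 + \<epsilon>q\<close> and invertible.\<close>
  have m: "is_mono B ?G J \<theta>" "is_mono B J ?G \<theta>'"
    using is_mono_if_mono_on_kernel_eps[OF kk \<theta>(1) O(2)] \<theta>(2) B.kernel_is_mono[OF k]
      is_mono_if_mono_on_kernel_eps[OF k \<theta>'(1) O(1)] \<theta>'(2) B.kernel_is_mono[OF kk] by simp_all
  have tt: "Cmp B ?G J ?G \<theta>' \<theta> \<in> Hom B ?G ?G" using O \<theta> \<theta>' by (simp add: B.Cmp_in)
  obtain p q where pq: "p \<in> Hom A E E" "q \<in> Hom A E E" "Gm E E (p, q) = Cmp B ?G J ?G \<theta>' \<theta>"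
    using Gm_obtain[OF E E tt] .
  have "Cmp B (Fo E) (Fo E) ?G (\<kappa> E) (Fm E E p) = Cmp B (Fo E) ?G ?G (Cmp B ?G J ?G \<theta>' \<theta>) (\<kappa> E)"
    using \<kappa>_natural[OF E E pq(1,2)] pq(3) by simp
  also have "\<dots> = \<kappa> E" using O \<theta> \<theta>' by (simp add: B.Cmp_assoc)
  also have "\<dots> = Cmp B (Fo E) (Fo E) ?G (\<kappa> E) (Fm E E (Idn A E))"
    using Fm_Idn[OF EO] O by (simp add: B.Cmp_Idn_right)
  finally have "Fm E E p = Fm E E (Idn A E)"
    using B.kernel_is_mono[OF kk] Fm_mem[OF EO EO] pq(1) A.Idn_in[OF EO] O unfolding is_mono_def by
        blast
  then have p: "p = Idn A E" using Fm_inj[OF EO EO pq(1)] A.Idn_in[OF EO] by blast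
  let ?c = "\<phi> E E E (Idn A E) (Idn A E)"
  have I: "Idn A E \<in> Hom A E E" "?c \<in> Hom A E E" using A.Idn_in[OF EO] \<phi>_mem[OF E E E] by blast+
  \<comment> \<open>With \<open>c\<close> for \<open>?c\<close>, the inverse
    \<open>1 + \<epsilon>r\<close> must solve
    \<open>(1 + \<epsilon>q)(1 + \<epsilon>r) = 1 - \<epsilon>c\<close>, the right side being the
    identity. The deformed composition adds a further \<open>\<epsilon>c\<close>, so
    \<open>r = - q - 2c\<close>.\<close>
  have r: "- q - ?c - ?c \<in> Hom A E E" using EO pq I by (intro A.Hom_diff A.Hom_uminus)
  define \<rho> where "\<rho> = Gm E E (Idn A E, - q - ?c - ?c)"
  have \<rho>: "\<rho> \<in> Hom B ?G ?G" unfolding \<rho>_def using Gm_mem[OF E E I(1) r] .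
  have "Cmp ?D E E E (Idn A E, q) (Idn A E, - q - ?c - ?c) = Idn ?D E"
    using EO pq I r by (simp add: A.Cmp_Idn_left A.Cmp_Idn_right)
  then have "Cmp B ?G ?G ?G (Gm E E (Idn A E, q)) \<rho> = Idn B ?G"
    using Gm_Cmp[OF E E E, of "(Idn A E, - q - ?c - ?c)" "(Idn A E, q)"] Gm_Idn[OF E] pq I r
    by (simp add: \<rho>_def del: lin_deformation_simps(3,4))
  then have inv: "Cmp B ?G ?G ?G (Cmp B ?G J ?G \<theta>' \<theta>) \<rho> = Idn B ?G" using pq p by simp
  define \<sigma> where "\<sigma> = Cmp B J ?G ?G \<rho> \<theta>'"
  have \<sigma>: "\<sigma> \<in> Hom B J ?G" unfolding \<sigma>_def using O \<rho> \<theta>' by (simp add: B.Cmp_in)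
  have mono: "f = g" if "is_mono B X Y m" "X \<in> Obj B" "f \<in> Hom B W X" "g \<in> Hom B W X" "W \<in> Obj B"
      "Cmp B W X Y m f = Cmp B W X Y m g" for X Y m W f g
    using that unfolding is_mono_def by blast
  \<comment> \<open>So far \<open>\<rho>\<close> is a right inverse of
    \<open>\<theta>' \<theta>\<close>. Cancelling the monomorphism \<open>\<theta>'\<close>, then
    \<open>\<theta>\<close>, makes \<open>\<sigma>\<close> a two-sided inverse of
    \<open>\<theta>\<close>.\<close>
  have "Cmp B J J ?G \<theta>' (Cmp B J ?G J \<theta> \<sigma>) = Cmp B J ?G ?G (Cmp B ?G ?G ?G (Cmp B ?G J ?G \<theta>' \<theta>) \<rho>) \<theta>'"
    unfolding \<sigma>_def using O \<theta> \<theta>' \<rho> tt by (simp add: B.Cmp_assoc B.Cmp_in)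
  also have "\<dots> = Cmp B J J ?G \<theta>' (Idn B J)"
    unfolding inv using O \<theta>' by (simp add: B.Cmp_Idn_left B.Cmp_Idn_right)
  finally have \<theta>\<sigma>: "Cmp B J ?G J \<theta> \<sigma> = Idn B J"
    using mono[OF m(2)] O \<theta> \<sigma> by (meson B.Cmp_in B.Idn_in)
  have "Cmp B ?G ?G J \<theta> (Cmp B ?G J ?G \<sigma> \<theta>) = Cmp B ?G J J (Cmp B J ?G J \<theta> \<sigma>) \<theta>"
    using O \<theta> \<sigma> by (simp add: B.Cmp_assoc)
  also have "\<dots> = Cmp B ?G ?G J \<theta> (Idn B ?G)"
    unfolding \<theta>\<sigma> using O \<theta> by (simp add: B.Cmp_Idn_left B.Cmp_Idn_right)
  finally have "Cmp B ?G J ?G \<sigma> \<theta> = Idn B ?G"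
    using mono[OF m(1)] O \<theta> \<sigma> by (meson B.Cmp_in B.Idn_in)
  then show ?thesis using \<theta> \<sigma> \<theta>\<sigma> by blast
qed

section \<open>Lifts of complexes and the vanishing of the obstruction\<close>

lemma deformed_complex_Db_object:
  assumes M: "M \<in> Db_objects A" and h: "\<And>k. h k \<in> Hom A (fst M k) (fst M (k + 1))"
    and eq: "\<And>k. Cmp A (fst M k) (fst M (k + 1)) (fst M (k + 2)) (snd M (k + 1)) (h k)
        + Cmp A (fst M k) (fst M (k + 1)) (fst M (k + 2)) (h (k + 1)) (snd M k)
        + \<phi> (fst M k) (fst M (k + 1)) (fst M (k + 2)) (snd M (k + 1)) (snd M k) = 0"
  shows "(\<lambda>i. Go (fst M i), \<lambda>i. Gm (fst M i) (fst M (i + 1)) (snd M i, h i)) \<in> Db_objects B"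
      (is "?L \<in> _")
proof -
  let ?D = "lin_deformation (Inj A) \<phi>" and ?I = "fst M" and ?d = "snd M" and ?G = "\<lambda>i. Go (fst M i)"
  define dL where "dL i = Gm (?I i) (?I (i + 1)) (?d i, h i)" for i
  note O = Db_objectsD[OF M]
  note d2 = Hom_succ[OF O(2)] and h2 = Hom_succ[OF h]
  have Gd: "dL i \<in> Hom B (?G i) (?G (i + 1))" for i
    unfolding dL_def using Gm_mem[OF O(3) O(3) O(2) h] .
  have e: "i + 1 + 1 = i + 2" for i :: int by simp
  have dd: "Cmp B (?G i) (?G (i + 1)) (?G (i + 2)) (dL (i + 1)) (dL i) = 0" for i
  proof -
    have "Gm (?I i) (?I (i + 2)) (Cmp ?D (?I i) (?I (i + 1)) (?I (i + 2)) (?d (i + 1), h (i + 1))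
        (?d i, h i))
      = Cmp B (?G i) (?G (i + 1)) (?G (i + 2)) (dL (i + 1)) (dL i)"
      unfolding dL_def e using O(2,3) d2 h h2 by (intro Gm_Cmp) auto
    moreover have "Cmp ?D (?I i) (?I (i + 1)) (?I (i + 2)) (?d (i + 1), h (i + 1)) (?d i, h i) = (0, 0)"
      using O(4)[of i] eq[of i] by simp
    ultimately show ?thesis using Gm_zero[OF O(3) O(3)] by simp
  qed
  \<comment> \<open>The deformed identity is \<open>1 - \<epsilon>\<phi>(1, 1)\<close>; at a zero
    object both of its components lie in a zero module.\<close>
  have Gz: "zero_object B (Go Z)" if Z: "zero_object A Z" for Z
  proof (rule B.zero_objectI)
    have iZ: "injective A Z" using A.injective_zero_object[OF Z] .
    then show "Go Z \<in> Obj B" by (rule Go_Obj)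
    have ZO: "Z \<in> Obj A" "Hom A Z Z = {0}" using Z by (auto simp: zero_object_def)
    then have "Idn A Z = 0" "\<phi> Z Z Z (Idn A Z) (Idn A Z) = 0"
      using A.Idn_in[OF ZO(1)] \<phi>_mem[OF iZ iZ iZ] by auto
    then show "Idn B (Go Z) = 0" using Gm_Idn[OF iZ] Gm_zero[OF iZ iZ] by simp
  qed
  \<comment> \<open>Exactness is tested on morphisms into the injectives \<open>Go E\<close>, where both components of a morphism
    can be lifted successively by exactness of \<open>M\<close>.\<close>
  have coh: "cohomology_vanishes B ?L i" if v: "cohomology_vanishes A M i" for i
    unfolding cohomology_vanishes_def fst_conv snd_conv dL_def[symmetric]
  proof (rule B.exactI[where S = "Go ` {E. injective A E}"])
    have Mi: "?d (i - 1) \<in> Hom A (?I (i - 1)) (?I i)" "h (i - 1) \<in> Hom A (?I (i - 1)) (?I i)"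
      using O(2)[of "i - 1"] h[of "i - 1"] by simp_all
    have e1: "i - 1 + 1 = i" "i - 1 + 2 = i + 1" by simp_all
    obtain K j H p where ex: "is_cohomology A (?I (i - 1)) (?I i) (?I (i + 1)) (?d (i - 1)) (?d i) K
        j H p" "zero_object A H"
      using v by (auto simp: cohomology_vanishes_def)
    show "?G (i - 1) \<in> Obj B" "?G i \<in> Obj B" "?G (i + 1) \<in> Obj B"
      using Go_Obj O(3) by simp_all
    show L1: "dL (i - 1) \<in> Hom B (?G (i - 1)) (?G i)" using Gd[of "i - 1"] unfolding e1 .
    show L2: "dL i \<in> Hom B (?G i) (?G (i + 1))" by (rule Gd)
    show L3: "Cmp B (?G (i - 1)) (?G i) (?G (i + 1)) (dL i) (dL (i - 1)) = 0"
      using dd[of "i - 1"] unfolding e1 .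
    have s1: "dL (i - 1) = Gm (?I (i - 1)) (?I i) (?d (i - 1), h (i - 1))" unfolding dL_def e1 ..
    show "\<exists>E\<in>Go ` {E. injective A E}. \<exists>m. is_mono B X E m" if "X \<in> Obj B" for X
      using embed_in_Go[OF that] by blast
    show "injective B E" if "E \<in> Go ` {E. injective A E}" for E
      using that Go_injective by blast
    fix J u assume "J \<in> Go ` {E. injective A E}" and u: "u \<in> Hom B (?G i) J"
      "Cmp B (?G (i - 1)) (?G i) J u (dL (i - 1)) = 0"
    then obtain E where E: "injective A E" "J = Go E" by blast
    have EO: "E \<in> Obj A" using E by (simp add: injective_def)
    obtain p q where pq: "p \<in> Hom A (?I i) E" "q \<in> Hom A (?I i) E" "Gm (?I i) E (p, q) = u"
      using Gm_obtain[OF O(3) E(1) u(1)[unfolded E(2)]] .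
    have comp: "Gm (?I (i - 1)) E (Cmp ?D (?I (i - 1)) (?I i) E (a, b) (?d (i - 1), h (i - 1)))
        = Cmp B (?G (i - 1)) (?G i) J (Gm (?I i) E (a, b)) (dL (i - 1))"
      if "a \<in> Hom A (?I i) E" "b \<in> Hom A (?I i) E" for a b
      unfolding s1 E(2) using that Mi O(3) E(1) by (intro Gm_Cmp) auto
    have comp': "Gm (?I i) E (Cmp ?D (?I i) (?I (i + 1)) E (a, b) (?d i, h i))
        = Cmp B (?G i) (?G (i + 1)) J (Gm (?I (i + 1)) E (a, b)) (dL i)"
      if "a \<in> Hom A (?I (i + 1)) E" "b \<in> Hom A (?I (i + 1)) E" for a b
      unfolding dL_def E(2) using that O(2,3) h E(1) by (intro Gm_Cmp) auto
    have compmem: "Cmp ?D (?I (i - 1)) (?I i) E (a, b) (?d (i - 1), h (i - 1)) \<in> Hom A (?I (i - 1))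
        E \<times> Hom A (?I (i - 1)) E"
      if "a \<in> Hom A (?I i) E" "b \<in> Hom A (?I i) E" for a b
      using that Mi O(1) EO \<phi>_mem[OF O(3) O(3) E(1) Mi(1)] by (simp add: A.Cmp_in A.Hom_add)
    have z: "0 \<in> Hom A X E" if "X \<in> Obj A" for X using that EO by (rule A.Hom_zero)
    have fact: "Cmp ?D (?I (i - 1)) (?I i) E (a, b) (?d (i - 1), h (i - 1)) = (0, 0)"
      if "a \<in> Hom A (?I i) E" "b \<in> Hom A (?I i) E" 
        "Cmp B (?G (i - 1)) (?G i) J (Gm (?I i) E (a, b)) (dL (i - 1)) = 0" for a b
      using comp[OF that(1,2)] that(3) compmem[OF that(1,2)] Gm_zero[OF O(3) E(1)] z[OF O(1)]
      by (intro Gm_inj[OF O(3) E(1)]) simp_all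
    have "Cmp A (?I (i - 1)) (?I i) E p (?d (i - 1)) = 0"
      using fact[OF pq(1,2)] u(2) pq(3) by simp
    then obtain w where w: "w \<in> Hom A (?I (i + 1)) E" "Cmp A (?I i) (?I (i + 1)) E w (?d i) = p"
      using A.exact_extend[OF ex O(1) Mi(1) E(1) pq(1)] by blast
    \<comment> \<open>Composing \<open>(w, 0)\<close> with the deformed differential gives first
      component \<open>p\<close> and second component \<open>w h + \<phi>(w, \<delta>)\<close>.
      Subtracting this from \<open>(p, q)\<close> leaves \<open>(0, q')\<close>.\<close>
    define q' where "q' = q - (Cmp A (?I i) (?I (i + 1)) E w (h i) + \<phi> (?I i) (?I (i + 1)) E w (?d i))"
    have wc: "Cmp ?D (?I i) (?I (i + 1)) E (w, 0) (?d i, h i) = (p, q - q')"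
      using w(2) A.Cmp_zero_left[OF O(1) O(1) EO O(2)] by (simp add: q'_def)
    have q'm: "q' \<in> Hom A (?I i) E" "q - q' \<in> Hom A (?I i) E"
      unfolding q'_def using O(1,2) h w pq EO \<phi>_mem[OF O(3) O(3) E(1) O(2) w(1)]
      by (simp_all add: A.Cmp_in A.Hom_add A.Hom_diff)
    have u0: "Gm (?I i) E (0, q') = u - Cmp B (?G i) (?G (i + 1)) J (Gm (?I (i + 1)) E (w, 0)) (dL i)"
    proof -
      have "Gm (?I i) E (p, q) = Gm (?I i) E ((0, q') + (p, q - q'))" by simp
      also have "\<dots> = Gm (?I i) E (0, q') + Gm (?I i) E (p, q - q')"
        using pq q'm z[OF O(1)] O(3) E(1) by (intro Gm_add) auto
      finally show ?thesis using comp'[OF w(1) z[OF O(1)]] pq(3) unfolding wc by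
          (simp add: algebra_simps)
    qed
    have wm: "Gm (?I (i + 1)) E (w, 0) \<in> Hom B (?G (i + 1)) J"
      using Gm_mem[OF O(3) E(1) w(1) z[OF O(1)]] E(2) by simp
    note LO = \<open>?G (i - 1) \<in> Obj B\<close> \<open>?G i \<in> Obj B\<close> \<open>?G (i + 1) \<in> Obj B\<close>
    have JO: "J \<in> Obj B" using E Go_Obj by simp
    have "Cmp B (?G (i - 1)) (?G i) J (Gm (?I i) E (0, q')) (dL (i - 1))
      = Cmp B (?G (i - 1)) (?G i) J u (dL (i - 1))
        - Cmp B (?G (i - 1)) (?G (i + 1)) J (Gm (?I (i + 1)) E (w, 0))
          (Cmp B (?G (i - 1)) (?G i) (?G (i + 1)) (dL i) (dL (i - 1)))"
      unfolding u0 B.Cmp_diff_left[OF LO(1,2) JO L1 u(1) B.Cmp_in[OF LO(2,3) JO L2 wm]]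
        B.Cmp_assoc[OF LO JO L1 L2 wm] ..
    then have "Cmp B (?G (i - 1)) (?G i) J (Gm (?I i) E (0, q')) (dL (i - 1)) = 0"
      unfolding u(2) L3 B.Cmp_zero_right[OF LO(1,3) JO wm] by simp
    \<comment> \<open>For a pair with first component 0 the terms with \<open>h\<close> and
      \<open>\<phi>\<close> drop out, so \<open>q'\<close> kills the differential and the extension
      property applies a second time.\<close>
    from fact[OF z[OF O(1)] q'm(1) this]
    have "Cmp A (?I (i - 1)) (?I i) E q' (?d (i - 1)) = 0"
      using A.Cmp_zero_left[OF O(1) O(1) EO Mi(2)] \<phi>_zero[OF O(3) O(3) E(1) Mi(1)] by simp
    then obtain w' where w': "w' \<in> Hom A (?I (i + 1)) E" "Cmp A (?I i) (?I (i + 1)) E w' (?d i) = q'"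
      using A.exact_extend[OF ex O(1) Mi(1) E(1) q'm(1)] by blast
    have "Cmp ?D (?I i) (?I (i + 1)) E (0, w') (?d i, h i) = (0, q')"
      using w'(2) A.Cmp_zero_left[OF O(1) O(1) EO O(2)] A.Cmp_zero_left[OF O(1) O(1) EO h]
        \<phi>_zero[OF O(3) O(3) E(1) O(2)] by simp
    then have "Gm (?I i) E (0, q') = Cmp B (?G i) (?G (i + 1)) J (Gm (?I (i + 1)) E (0, w')) (dL i)"
      using comp'[OF z[OF O(1)] w'(1)] by simp
    moreover have wm': "Gm (?I (i + 1)) E (0, w') \<in> Hom B (?G (i + 1)) J"
      using Gm_mem[OF O(3) E(1) z[OF O(1)] w'(1)] E(2) by simp
    ultimately have "u = Cmp B (?G i) (?G (i + 1)) J
        (Gm (?I (i + 1)) E (0, w') + Gm (?I (i + 1)) E (w, 0)) (dL i)"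
      using u0 B.Cmp_add_left[OF LO(2,3) JO L2 wm' wm] by (metis diff_add_cancel)
    then show "\<exists>v\<in>Hom B (?G (i + 1)) J. Cmp B (?G i) (?G (i + 1)) J v (dL i) = u"
      using B.Hom_add[OF LO(3) JO wm' wm] by metis
  qed
  have "is_complex B ?L"
    unfolding is_complex_def fst_conv snd_conv using Gd dd Go_Obj O(3) unfolding dL_def by blast
  moreover obtain n where "\<forall>i<n. zero_object A (?I i)" using M by (auto simp: Db_objects_def)
  then have "\<exists>n. \<forall>i<n. zero_object B (?G i)" using Gz by blast
  moreover obtain n where "\<forall>i. \<bar>i\<bar> > n \<longrightarrow> cohomology_vanishes A M i" using M by
      (auto simp: Db_objects_def)
  then have "\<exists>n. \<forall>i. \<bar>i\<bar> > n \<longrightarrow> cohomology_vanishes B ?L i" using coh by blast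
  ultimately show ?thesis
    unfolding Db_objects_def mem_Collect_eq fst_conv using Go_injective O(3) by blast
qed

lemma has_deformation_if_obstruction_vanishes:
  assumes M: "M \<in> Db_objects A" and v: "obstruction_cochain \<phi> M \<in> hom_coboundaries (Db_dg A) M M 2"
  shows "has_deformation A B Fo Fm M"
proof -
  note O = Db_objectsD[OF M]
  obtain h where h: "\<And>k. h k \<in> Hom A (fst M k) (fst M (k + 1))"
    "\<And>k. Cmp A (fst M k) (fst M (k + 1)) (fst M (k + 2)) (snd M (k + 1)) (h k)
        + Cmp A (fst M k) (fst M (k + 1)) (fst M (k + 2)) (h (k + 1)) (snd M k)
        + \<phi> (fst M k) (fst M (k + 1)) (fst M (k + 2)) (snd M (k + 1)) (snd M k) = 0"
    using v unfolding A.obstruction_cochain_coboundary_iff[OF M] by blast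
  show ?thesis
    unfolding has_deformation_def
    by (rule bexI[OF _ deformed_complex_Db_object[OF M h]], rule bexI[OF _ M], rule
        exI[of _ "\<lambda>i. \<kappa> (fst M i)"])
      (use \<kappa>_kernel[OF O(3)] \<kappa>_natural[OF O(3) O(3) O(2) h(1)] A.Db_iso_refl[OF M] in simp)
qed

text \<open>The isomorphisms between \<open>Go (fst N i)\<close> and the terms of \<open>L\<close>
  transport the differential of \<open>L\<close>. The result has the differential of
  \<open>N\<close> as first component, and the \<open>\<epsilon>\<close> part of its square being
  zero is the equation for \<open>h\<close>.\<close>

lemma obstruction_vanishes_if_lift:
  assumes L: "L \<in> Db_objects B" and N: "N \<in> Db_objects A"
    and k: "\<And>i. is_kernel B (fst L i) (fst L i) (eps_end B (fst L i)) (Fo (fst N i)) (\<iota> i)"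
    and c: "\<And>i. Cmp B (Fo (fst N i)) (fst L i) (fst L (i + 1)) (snd L i) (\<iota> i) =
          Cmp B (Fo (fst N i)) (Fo (fst N (i + 1))) (fst L (i + 1))
            (\<iota> (i + 1)) (Fm (fst N i) (fst N (i + 1)) (snd N i))"
  shows "obstruction_cochain \<phi> N \<in> hom_coboundaries (Db_dg A) N N 2"
proof -
  let ?D = "lin_deformation (Inj A) \<phi>" and ?N = "fst N" and ?J = "fst L" and ?d = "snd N"
  let ?G = "\<lambda>i. Go (?N i)" and ?F = "\<lambda>i. Fo (?N i)"
  note OL = Db_objectsD[OF L] and ON = Db_objectsD[OF N]
  note GO = Go_Obj[OF ON(3)] and FO = Fo_Obj[OF ON(1)]
  have "\<forall>i. \<exists>\<theta> \<sigma>. \<theta> \<in> Hom B (?G i) (?J i) \<and> \<sigma> \<in> Hom B (?J i) (?G i) \<and>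
    Cmp B (?G i) (?J i) (?G i) \<sigma> \<theta> = Idn B (?G i) \<and> Cmp B (?J i) (?G i) (?J i) \<theta> \<sigma> = Idn B (?J i) \<and>
    Cmp B (?F i) (?G i) (?J i) \<theta> (\<kappa> (?N i)) = \<iota> i"
    using Go_iso_of_kernel_eps[OF ON(3) OL(3) k] by blast
  then obtain \<theta> \<sigma> where ts: "\<And>i. \<theta> i \<in> Hom B (?G i) (?J i)" "\<And>i. \<sigma> i \<in> Hom B (?J i) (?G i)"
    "\<And>i. Cmp B (?G i) (?J i) (?G i) (\<sigma> i) (\<theta> i) = Idn B (?G i)"
    "\<And>i. Cmp B (?J i) (?G i) (?J i) (\<theta> i) (\<sigma> i) = Idn B (?J i)"
    "\<And>i. Cmp B (?F i) (?G i) (?J i) (\<theta> i) (\<kappa> (?N i)) = \<iota> i"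
    by metis
  have \<kappa>: "\<kappa> (?N i) \<in> Hom B (?F i) (?G i)" "is_mono B (?F i) (?G i) (\<kappa> (?N i))" for i
    using \<kappa>_kernel[OF ON(3)] B.kernel_is_mono[OF \<kappa>_kernel[OF ON(3)]] by (simp_all add: is_kernel_def)
  have \<iota>: "\<iota> i \<in> Hom B (?F i) (?J i)" for i using k by (auto simp: is_kernel_def)
  define d' where "d' i = Cmp B (?G i) (?J (i + 1)) (?G (i + 1)) (\<sigma> (i + 1))
      (Cmp B (?G i) (?J i) (?J (i + 1)) (snd L i) (\<theta> i))" for i
  have d'm: "d' i \<in> Hom B (?G i) (?G (i + 1))" for i
    unfolding d'_def using GO OL(1,2) ts(1,2) by (intro B.Cmp_in)
  have "\<exists>h. h \<in> Hom A (?N i) (?N (i + 1)) \<and> Gm (?N i) (?N (i + 1)) (?d i, h) = d' i" for i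
  proof -
    obtain a b where ab: "a \<in> Hom A (?N i) (?N (i + 1))" "b \<in> Hom A (?N i) (?N (i + 1))" "Gm (?N i)
        (?N (i + 1)) (a, b) = d' i"
      using Gm_obtain[OF ON(3) ON(3) d'm] .
    have si: "Cmp B (?F j) (?J j) (?G j) (\<sigma> j) (\<iota> j) = \<kappa> (?N j)" for j
    proof -
      have "Cmp B (?F j) (?J j) (?G j) (\<sigma> j) (\<iota> j) = Cmp B (?F j) (?G j) (?G j)
          (Cmp B (?G j) (?J j) (?G j) (\<sigma> j) (\<theta> j)) (\<kappa> (?N j))"
        unfolding ts(5)[symmetric] using FO GO OL(1) ts(1,2) \<kappa>(1) by (simp add: B.Cmp_assoc del: ts(3))
      then show ?thesis unfolding ts(3) using FO GO \<kappa>(1) by (simp add: B.Cmp_Idn_left)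
    qed
    have Fd: "Fm (?N i) (?N (i + 1)) (?d i) \<in> Hom B (?F i) (?F (i + 1))"
      using Fm_mem[OF ON(1) ON(1) ON(2)] .
    \<comment> \<open>On kernels of \<open>\<epsilon>\<close> both \<open>Fm a\<close> and
      \<open>Fm\<close> of the differential of \<open>N\<close> induce the restriction of
      \<open>d'\<close>. As \<open>\<kappa>\<close> is mono and \<open>Fm\<close> is faithful,
      \<open>a\<close> is that differential.\<close>
    have "Cmp B (?F i) (?F (i + 1)) (?G (i + 1)) (\<kappa> (?N (i + 1))) (Fm (?N i) (?N (i + 1)) a)
      = Cmp B (?F i) (?G i) (?G (i + 1)) (d' i) (\<kappa> (?N i))"
      using \<kappa>_natural[OF ON(3) ON(3) ab(1,2)] ab(3) by simp
    also have "\<dots> = Cmp B (?F i) (?J (i + 1)) (?G (i + 1)) (\<sigma> (i + 1))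
        (Cmp B (?F i) (?J i) (?J (i + 1)) (snd L i) (\<iota> i))"
      unfolding d'_def ts(5)[symmetric]
      using FO GO OL(1,2) ts(1,2) \<kappa>(1) by (simp add: B.Cmp_assoc B.Cmp_in)
    also have "\<dots> = Cmp B (?F i) (?F (i + 1)) (?G (i + 1)) (\<kappa> (?N (i + 1)))
        (Fm (?N i) (?N (i + 1)) (?d i))"
      unfolding c si[symmetric] using FO GO OL(1) ts(2) \<iota> Fd by (simp add: B.Cmp_assoc)
    finally have "Fm (?N i) (?N (i + 1)) a = Fm (?N i) (?N (i + 1)) (?d i)"
      using \<kappa>(2)[of "i + 1"] FO Fd Fm_mem[OF ON(1) ON(1) ab(1)] unfolding is_mono_def by blast
    then have "a = ?d i" using Fm_inj[OF ON(1) ON(1) ab(1) ON(2)] by blast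
    then show ?thesis using ab by blast
  qed
  then obtain h where h: "\<And>i. h i \<in> Hom A (?N i) (?N (i + 1))" "\<And>i. Gm (?N i) (?N (i + 1))
      (?d i, h i) = d' i"
    by metis
  note d2 = Hom_succ[OF ON(2)] and h2 = Hom_succ[OF h(1)]
  have "Cmp A (?N i) (?N (i + 1)) (?N (i + 2)) (?d (i + 1)) (h i)
        + Cmp A (?N i) (?N (i + 1)) (?N (i + 2)) (h (i + 1)) (?d i)
        + \<phi> (?N i) (?N (i + 1)) (?N (i + 2)) (?d (i + 1)) (?d i) = 0" (is "?e = 0") for i
  proof -
    have e: "i + 1 + 1 = i + 2" by simp
    let ?a = "Cmp B (?G i) (?J i) (?J (i + 1)) (snd L i) (\<theta> i)"
    have am: "?a \<in> Hom B (?G i) (?J (i + 1))" using GO OL(1,2) ts(1) by (intro B.Cmp_in)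
    have L1: "snd L (i + 1) \<in> Hom B (?J (i + 1)) (?J (i + 2))" by (rule Hom_succ[OF OL(2)])
    have bm: "Cmp B (?G (i + 1)) (?J (i + 1)) (?J (i + 2)) (snd L (i + 1)) (\<theta> (i + 1)) \<in> Hom B
        (?G (i + 1)) (?J (i + 2))"
      using GO OL(1) L1 ts(1) by (intro B.Cmp_in)
    \<comment> \<open>In the middle \<open>\<theta>\<close> meets \<open>\<sigma>\<close> and
      cancels, which leaves the square of the differential of \<open>L\<close>.\<close>
    have inner: "Cmp B (?G i) (?G (i + 1)) (?J (i + 2))
        (Cmp B (?G (i + 1)) (?J (i + 1)) (?J (i + 2)) (snd L (i + 1)) (\<theta> (i + 1))) (d' i) = 0"
    proof -
      have "Cmp B (?G i) (?G (i + 1)) (?J (i + 2))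
          (Cmp B (?G (i + 1)) (?J (i + 1)) (?J (i + 2)) (snd L (i + 1)) (\<theta> (i + 1))) (d' i)
        = Cmp B (?G i) (?J (i + 1)) (?J (i + 2)) (snd L (i + 1))
            (Cmp B (?G i) (?G (i + 1)) (?J (i + 1)) (\<theta> (i + 1)) (d' i))"
        by (rule B.Cmp_assoc[OF GO GO OL(1) OL(1) d'm ts(1) L1])
      also have "Cmp B (?G i) (?G (i + 1)) (?J (i + 1)) (\<theta> (i + 1)) (d' i) = ?a"
        unfolding d'_def B.Cmp_assoc[OF GO OL(1) GO OL(1) am ts(2) ts(1), symmetric] ts(4)
        by (rule B.Cmp_Idn_left[OF GO OL(1) am])
      also have "Cmp B (?G i) (?J (i + 1)) (?J (i + 2)) (snd L (i + 1)) ?a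
        = Cmp B (?G i) (?J i) (?J (i + 2)) (Cmp B (?J i) (?J (i + 1)) (?J (i + 2)) (snd L (i + 1))
            (snd L i)) (\<theta> i)"
        by (rule B.Cmp_assoc[OF GO OL(1) OL(1) OL(1) ts(1) OL(2) L1, symmetric])
      also have "\<dots> = 0" unfolding OL(4) by (rule B.Cmp_zero_left[OF GO OL(1) OL(1) ts(1)])
      finally show ?thesis .
    qed
    have s2: "\<sigma> (i + 2) \<in> Hom B (?J (i + 2)) (?G (i + 2))" by (rule ts(2))
    have d1: "d' (i + 1) = Cmp B (?G (i + 1)) (?J (i + 2)) (?G (i + 2)) (\<sigma> (i + 2))
        (Cmp B (?G (i + 1)) (?J (i + 1)) (?J (i + 2)) (snd L (i + 1)) (\<theta> (i + 1)))"
      unfolding d'_def e ..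
    have "Cmp B (?G i) (?G (i + 1)) (?G (i + 2)) (d' (i + 1)) (d' i) = 0"
      unfolding d1 B.Cmp_assoc[OF GO GO OL(1) GO d'm bm s2] inner
      by (rule B.Cmp_zero_right[OF GO OL(1) GO s2])
    moreover have "Gm (?N i) (?N (i + 2)) (Cmp ?D (?N i) (?N (i + 1)) (?N (i + 2))
        (?d (i + 1), h (i + 1)) (?d i, h i))
      = Cmp B (?G i) (?G (i + 1)) (?G (i + 2)) (d' (i + 1)) (d' i)"
      unfolding h(2)[symmetric] e using ON(2,3) d2 h(1) h2 by (intro Gm_Cmp) auto
    ultimately have "Gm (?N i) (?N (i + 2)) (0, ?e) = Gm (?N i) (?N (i + 2)) (0, 0)"
      using ON(4)[of i] Gm_zero[OF ON(3) ON(3)] by simp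
    moreover have "?e \<in> Hom A (?N i) (?N (i + 2))"
      using ON(1,2) d2 h(1) h2 \<phi>_mem[OF ON(3) ON(3) ON(3) ON(2) d2] by (intro A.Hom_add A.Cmp_in)
    ultimately have "(0 :: 'm, ?e) = (0, 0)"
      using A.Hom_zero[OF ON(1) ON(1)] by (intro Gm_inj[OF ON(3) ON(3)]) auto
    then show ?thesis by simp
  qed
  then show ?thesis using h(1) unfolding A.obstruction_cochain_coboundary_iff[OF N] by blast
qed

lemma has_deformation_iff:
  assumes M: "M \<in> Db_objects A" and c: "c \<in> HH_ex A 2" and \<phi>: "two_cochain (Inj A) \<phi> \<in>
      restrict_class A 2 c"
  shows "has_deformation A B Fo Fm M \<longleftrightarrow> obstruction_cochain \<phi> M \<in> hom_coboundaries (Db_dg A) M M 2"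
proof
  assume "has_deformation A B Fo Fm M"
  then obtain L N \<iota> where LN: "L \<in> Db_objects B" "N \<in> Db_objects A" "Db_iso A N M"
    "\<And>i. is_kernel B (fst L i) (fst L i) (eps_end B (fst L i)) (Fo (fst N i)) (\<iota> i)"
    "\<And>i. Cmp B (Fo (fst N i)) (fst L i) (fst L (i + 1)) (snd L i) (\<iota> i) =
          Cmp B (Fo (fst N i)) (Fo (fst N (i + 1))) (fst L (i + 1))
            (\<iota> (i + 1)) (Fm (fst N i) (fst N (i + 1)) (snd N i))"
    unfolding has_deformation_def by blast
  show "obstruction_cochain \<phi> M \<in> hom_coboundaries (Db_dg A) M M 2"
    by (rule A.obstruction_iso_invariant[OF M LN(2,3) c \<phi> obstruction_vanishes_if_lift[OF LN(1,2,4,5)]])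
qed (rule has_deformation_if_obstruction_vanishes[OF M])

end

theorem theorem1p1:
  fixes A :: "('k::field, 'o, 'm::ab_group_add) lincat"
    and B :: "('k dualnum, 'p, 'q::ab_group_add) lincat"
    and \<phi> :: "'o \<Rightarrow> 'o \<Rightarrow> 'o \<Rightarrow> 'm \<Rightarrow> 'm \<Rightarrow> 'm"
  assumes "abelian_category A" and "enough_injectives A"
    and "c \<in> HH_ex A 2"
    and "two_cochain (Inj A) \<phi> \<in> restrict_class A 2 c"
    and "deformation_of_class A \<phi> B Fo Fm Go Gm \<kappa>"
    and "M \<in> Db_objects A"
  shows "char_mor A 2 c M \<in> Ext A 2 M M
    \<and> char_mor A 2 c M = obstruction A \<phi> M
    \<and> (has_deformation A B Fo Fm M \<longleftrightarrow> char_mor A 2 c M = ext_class A 2 M M 0)"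
proof -
  interpret A: abelian_category A by fact
  have "two_cochain (Inj A) \<phi> \<in> C_br (lin_dg (Inj A)) 1"
    using assms(4) by (auto simp: restrict_class_def HH_class_def HZ_def)
  moreover have "abelian_category B"
    using assms(5) by (simp add: deformation_of_class_def abelian_deformation_def)
  ultimately interpret deformation A B \<phi> Fo Fm Go Gm \<kappa>
    using assms(1,2,5) by (intro deformation.intro deformation_axioms.intro)
  show ?thesis
    using A.char_mor_eq[OF assms(6,3,4)] has_deformation_iff[OF assms(6,3,4)] by blast
qed

end
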